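(* Let $\kappa\in(0,\infty)$, $\tau_{\mathrm{fin}}>0$, and let $(U,P,M,\Xi)$ be a limit (in the sense specified in the context) of scaled single-interface lattice data with well-prepared initial data along a sequence $\varepsilon\to0$. Put $\Omega=[0,\tau_{\mathrm{fin}}]\times\mathbb{R}$ and $\Gamma=\{(\tau,\xi)\in\Omega:\xi=\Xi(\tau)\}$. Then: 1. (Free boundary problem with Stefan condition) $(P,\Xi)$ is a distributional solution of $$\partial_\tau P=\partial_\xi^2P\ \text{ in }\Omega\setminus\Gamma,\qquad [\![P]\!]=0\ \text{ and }\ 2\tfrac{\mathrm d}{\mathrm d\tau}\Xi=[\![\partial_\xi P]\!]\ \text{ on }\Gamma,$$ and attains the initial data $(P(0,\cdot),0)$. Moreover, $$M(\tau,\xi)=\operatorname{sgn}(U(\tau,\xi))=\operatorname{sgn}(\Xi(\tau)-\xi)\quad\text{for }\xi\ne\Xi(\tau),$$ $$P(\tau,\xi)\ge-p_*\ \text{ for }\xi\le\Xi(\tau),\qquad P(\tau,\xi)\in[-p_*,+p_*]\ \text{ for }\xi\ge\Xi(\tau),$$ and $\tfrac{\mathrm d}{\mathrm d\tau}\Xi(\tau)\ge0$ for almost all $\tau$. 2. (Hysteretic flow rule and entropy balances) The implication $$P(\tau,\Xi(\tau))<p_*\ \Longrightarrow\ \tfrac{\mathrm d}{\mathrm d\tau}\Xi(\tau)=0$$ holds for almost all $\tau$, and the entropy inequality $$\partial_\tau\eta(U)-\partial_\xi\big(\mu(P)\,\partial_\xi P\big)\le0$$ is satisfied in the sense of distributions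 for every smooth entropy pair $(\eta,\mu)$.
   Context: Parameters: $u_*=\frac1{1+\kappa}$, $p_*=\frac{\kappa}{1+\kappa}$, $u_{**}=\frac{1+2\kappa}{1+\kappa}$. The trilinear function $\Phi'$ is $\Phi'(u)=u+1$ for $u\le-u_*$, $\Phi'(u)=u-1$ for $u\ge u_*$, $\Phi'(u)=-\kappa u$ for $-u_*<u<u_*$. $\Delta v_j=v_{j+1}+v_{j-1}-2v_j$, $\nabla_+v_j=v_{j+1}-v_j$, $j\in\mathbb{Z}$. Lattice equation: $\dot u_j=\Delta p_j$, $p_j=\Phi'(u_j)$, $j\in\mathbb{Z}$, $t\ge0$. $X_k$ ($k\in\mathbb{Z}$) is the set of $u\in\ell^\infty(\mathbb{Z})$ with $u_*<\inf_{j<k}u_j\le\sup_{j<k}u_j<\infty$, $-u_{**}<\inf_{j>k}u_j\le\sup_{j>k}u_j<-u_*$, $-u_{**}<u_k<u_*$. A single-interface solution is a differentiable $u:[0,\infty)\to\ell^\infty(\mathbb{Z})$ solving the lattice equation for which there is a non-decreasing sequence $(t_k^* )_{k\ge1}\subset(0,\infty]$ such that, with $t_0^*:=0$ and for all $k\ge1$: either $t_k^*=\infty$ or $t_{k+1}^*>t_k^*$; and if $t_{k-1}^*<\infty$ then $u(t)\in X_k$ for $t\in(t_{k-1}^*,t_k^* )$. For each $u(0)\in X_1$ there is a unique one. Set $t_0^\#:=0$, $t_k^\#:=\inf\{t>t_{k-1}^*:u_k(t)>-u_*\}$ for $k\ge1$ ($\inf\emptyset=\infty$). Well-prepared initial data: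 for each $\varepsilon>0$, $u(0)=u^\varepsilon(0)\in X_1$, $u_1(0)\notin(-u_*,u_* )$, and, with constants $\alpha,\beta>0$ independent of $\varepsilon$, $p(0)=\Phi'(u(0))$ satisfies $\sup_j|p_j(0)|\le\alpha$, $\sup_j|\nabla_+p_j(0)|\le\alpha\varepsilon$, $\sup_{j\ne1}|\Delta p_j(0)|\le\alpha\varepsilon^2$, $|\Delta p_1(0)|\le\beta\varepsilon$, $p_j(0)\le p_*+\varepsilon\beta\max\{0,1-j\}$ for all $j$. Scaled data: write $\xi=\varepsilon(j_\xi+\zeta_\xi)$ with $j_\xi\in\mathbb{Z}$, $\zeta_\xi\in(-1/2,1/2]$; $U_\varepsilon(\tau,\xi)=u_{j_\xi}(\tau/\varepsilon^2)$, $P_\varepsilon(\tau,\xi)=p_{j_\xi}(\tau/\varepsilon^2)$; $\Xi_\varepsilon^*(\tau)=\varepsilon\sum_{k\ge1}k\,\chi_{[t_{k-1}^*,t_k^* )}(\tau/\varepsilon^2)$, $\Xi_\varepsilon^\#(\tau)=\varepsilon\sum_{k\ge1}k\,\chi_{[t_{k-1}^\#,t_k^\#)}(\tau/\varepsilon^2)$; $M_\varepsilon(\tau,\xi)=-1$ if $\xi>\Xi^\#_\varepsilon(\tau)$, $+1$ if $\xi<\Xi^*_\varepsilon(\tau)$, $0$ otherwise; $\nabla_{+\varepsilon}F(\xi)=(F(\xi+\varepsilon)-F(\xi))/\varepsilon$. "Limit": along the given sequence $\varepsilon\to0$, the measure of $\Gamma_\varepsilon=\{(\tau,\xi):\Xi_\varepsilon^*(\tau)\le\xi\le\Xi_\varepsilon^\#(\tau),\,0\le\tau\le\tau_{\mathrm{fin}}\}$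 tends to $0$; $\Xi^*_\varepsilon$ and $\Xi^\#_\varepsilon$ converge in $L^\infty([0,\tau_{\mathrm{fin}}])$ to the same Lipschitz function $\Xi$; $U_\varepsilon\to U$, $P_\varepsilon\to P$, $M_\varepsilon\to M$ strongly in $L^s_{\mathrm{loc}}(\Omega)$ for all $1\le s<\infty$ with $U,P,M$ bounded; $P$ is locally H\"older continuous on $\Omega$; $P_\varepsilon(\tau,\cdot)\to P(\tau,\cdot)$ in $L^s_{\mathrm{loc}}(\mathbb{R})$ for every $\tau\in[0,\tau_{\mathrm{fin}}]$; $P$ has a weak derivative $\partial_\xi P$ for every $\tau$, and $\nabla_{+\varepsilon}P_\varepsilon\to\partial_\xi P$ weakly in $L^2_{\mathrm{loc}}(\Omega)$. (Such sequences exist.) Since $U,M$ are defined as elements of $L^s_{\mathrm{loc}}$, identities for them hold almost everywhere. Jumps $[\![\cdot]\!]$ are right limit minus left limit in $\xi$. "Distributional solution" means $$\int_0^{\tau_{\mathrm{fin}}}\!\!\int_{\mathbb{R}}(P+M)\,\partial_\tau\Psi\,d\xi\,d\tau=\int_0^{\tau_{\mathrm{fin}}}\!\!\int_{\mathbb{R}}\partial_\xi P\,\partial_\xi\Psi\,d\xi\,d\tau\quad\text{for all }\Psi\in C_c^\infty((0,\tau_{\mathrm{fin}})\times\mathbb{R}),$$ and attaining the initial data means that $P$ has initial value $P(0,\cdot)$ and $\Xi(0)=0$. A smooth entropy pair $(\eta,\mu)$ consists of a smooth $\mu:\mathbb{R}\to\mathbb{R}$ with $\mu'\ge0$ and a differentiable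 $\eta:\mathbb{R}\to\mathbb{R}$ with $\eta'=\mu\circ\Phi'$. The entropy inequality in the sense of distributions means $\int\!\!\int(\eta(U)\partial_\tau\Psi-\mu(P)\,\partial_\xi P\,\partial_\xi\Psi)\,d\xi\,d\tau\ge0$ for all nonnegative $\Psi\in C_c^\infty((0,\tau_{\mathrm{fin}})\times\mathbb{R})$. *)

theory Defs
  imports "HOL-Analysis.Analysis" "HOL-Probability.Essential_Supremum"
begin

section \<open>Function spaces and modes of convergence\<close>

primrec C_k :: "nat \<Rightarrow> ('a::euclidean_space \<Rightarrow> real) \<Rightarrow> bool" where
  "C_k 0 f \<longleftrightarrow> continuous_on UNIV f"
| "C_k (Suc k) f \<longleftrightarrow>
     (\<forall>x. f differentiable at x) \<and> (\<forall>v. C_k k (\<lambda>x. frechet_derivative f (at x) v))"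

definition smooth :: "('a::euclidean_space \<Rightarrow> real) \<Rightarrow> bool" where
  "smooth f \<longleftrightarrow> (\<forall>k. C_k k f)"

text \<open>The space \<open>C\<^sub>c\<^sup>\<infinity>(A)\<close> for open \<open>A\<close>; its elements are extended by zero to the whole space.\<close>

definition test_function :: "'a::euclidean_space set \<Rightarrow> ('a \<Rightarrow> real) \<Rightarrow> bool" where
  "test_function A \<Psi> \<longleftrightarrow>
     smooth \<Psi> \<and> (\<exists>K. compact K \<and> K \<subseteq> A \<and> (\<forall>x. x \<notin> K \<longrightarrow> \<Psi> x = 0))"

definition d_tau :: "(real \<times> real \<Rightarrow> real) \<Rightarrow> real \<times> real \<Rightarrow> real" where
  "d_tau \<Psi> = (\<lambda>(\<tau>, \<xi>). deriv (\<lambda>t. \<Psi> (t, \<xi>)) \<tau>)"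

definition d_xi :: "(real \<times> real \<Rightarrow> real) \<Rightarrow> real \<times> real \<Rightarrow> real" where
  "d_xi \<Psi> = (\<lambda>(\<tau>, \<xi>). deriv (\<lambda>x. \<Psi> (\<tau>, x)) \<xi>)"

text \<open>Since \<open>K\<close> ranges over the compact subsets of \<open>A\<close> itself, \<open>local\<close> includes
  neighbourhoods of those boundary points of \<open>A\<close> that belong to \<open>A\<close>.\<close>

definition Ls_loc :: "real \<Rightarrow> 'a::euclidean_space set \<Rightarrow> ('a \<Rightarrow> real) \<Rightarrow> bool" where
  "Ls_loc s A f \<longleftrightarrow>
     f \<in> borel_measurable (lebesgue_on A) \<and>
     (\<forall>K. compact K \<and> K \<subseteq> A \<longrightarrow> (\<integral>\<^sup>+x. ennreal (\<bar>f x\<bar> powr s) \<partial>lebesgue_on K) < \<infinity>)"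

definition Ls_loc_tendsto ::
  "real \<Rightarrow> 'a::euclidean_space set \<Rightarrow> (nat \<Rightarrow> 'a \<Rightarrow> real) \<Rightarrow> ('a \<Rightarrow> real) \<Rightarrow> bool" where
  "Ls_loc_tendsto s A f g \<longleftrightarrow>
     (\<forall>n. Ls_loc s A (f n)) \<and> Ls_loc s A g \<and>
     (\<forall>K. compact K \<and> K \<subseteq> A \<longrightarrow>
        (\<lambda>n. \<integral>\<^sup>+x. ennreal (\<bar>f n x - g x\<bar> powr s) \<partial>lebesgue_on K) \<longlonglongrightarrow> 0)"

definition L2_loc_weakly_tendsto ::
  "'a::euclidean_space set \<Rightarrow> (nat \<Rightarrow> 'a \<Rightarrow> real) \<Rightarrow> ('a \<Rightarrow> real) \<Rightarrow> bool" where
  "L2_loc_weakly_tendsto A f g \<longleftrightarrow>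
     (\<forall>n. Ls_loc 2 A (f n)) \<and> Ls_loc 2 A g \<and>
     (\<forall>K h. compact K \<and> K \<subseteq> A \<and> h \<in> borel_measurable (lebesgue_on K) \<and>
        integrable (lebesgue_on K) (\<lambda>x. (h x)\<^sup>2) \<longrightarrow>
        (\<lambda>n. LINT x|lebesgue_on K. f n x * h x) \<longlonglongrightarrow> (LINT x|lebesgue_on K. g x * h x))"

definition Linf_tendsto ::
  "'a::euclidean_space set \<Rightarrow> (nat \<Rightarrow> 'a \<Rightarrow> real) \<Rightarrow> ('a \<Rightarrow> real) \<Rightarrow> bool" where
  "Linf_tendsto A f g \<longleftrightarrow>
     (\<lambda>n. esssup (lebesgue_on A) (\<lambda>x. ereal \<bar>f n x - g x\<bar>)) \<longlonglongrightarrow> 0"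

definition ess_bounded_on :: "'a::euclidean_space set \<Rightarrow> ('a \<Rightarrow> real) \<Rightarrow> bool" where
  "ess_bounded_on A f \<longleftrightarrow>
     f \<in> borel_measurable (lebesgue_on A) \<and> (\<exists>C. AE x in lebesgue_on A. \<bar>f x\<bar> \<le> C)"

definition locally_Hoelder_on :: "'a::euclidean_space set \<Rightarrow> ('a \<Rightarrow> real) \<Rightarrow> bool" where
  "locally_Hoelder_on A f \<longleftrightarrow>
     (\<forall>K. compact K \<and> K \<subseteq> A \<longrightarrow>
        (\<exists>\<gamma> C. 0 < \<gamma> \<and> \<gamma> \<le> 1 \<and> (\<forall>x\<in>K. \<forall>y\<in>K. \<bar>f x - f y\<bar> \<le> C * dist x y powr \<gamma>)))"

definition weak_derivative :: "(real \<Rightarrow> real) \<Rightarrow> (real \<Rightarrow> real) \<Rightarrow> bool" where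
  "weak_derivative f g \<longleftrightarrow>
     Ls_loc 1 UNIV f \<and> Ls_loc 1 UNIV g \<and>
     (\<forall>\<phi>. test_function UNIV \<phi> \<longrightarrow>
        (LINT x|lebesgue. f x * deriv \<phi> x) = - (LINT x|lebesgue. g x * \<phi> x))"

definition has_jump :: "(real \<Rightarrow> real) \<Rightarrow> real \<Rightarrow> real \<Rightarrow> bool" where
  "has_jump f J x \<longleftrightarrow>
     (\<exists>l r. (f \<longlongrightarrow> l) (at_left x) \<and> (f \<longlongrightarrow> r) (at_right x) \<and> J = r - l)"

section \<open>The lattice\<close>

definition u_star :: "real \<Rightarrow> real" where
  "u_star \<kappa> = 1 / (1 + \<kappa>)"

definition p_star :: "real \<Rightarrow> real" where
  "p_star \<kappa> = \<kappa> / (1 + \<kappa>)"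

definition u_dstar :: "real \<Rightarrow> real" where
  "u_dstar \<kappa> = (1 + 2 * \<kappa>) / (1 + \<kappa>)"

definition Phi' :: "real \<Rightarrow> real \<Rightarrow> real" where
  "Phi' \<kappa> v =
     (if v \<le> - u_star \<kappa> then v + 1 else if v \<ge> u_star \<kappa> then v - 1 else - \<kappa> * v)"

definition Lap :: "(int \<Rightarrow> real) \<Rightarrow> int \<Rightarrow> real" where
  "Lap v j = v (j + 1) + v (j - 1) - 2 * v j"

definition Grad_plus :: "(int \<Rightarrow> real) \<Rightarrow> int \<Rightarrow> real" where
  "Grad_plus v j = v (j + 1) - v j"

text \<open>As \<open>int\<close> carries the discrete topology, the Banach space \<open>int \<Rightarrow>\<^sub>C real\<close> of
  bounded continuous functions is \<open>\<ell>\<^sup>\<infinity>(\<int>)\<close> with the supremum norm.\<close>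

type_synonym linf = "int \<Rightarrow>\<^sub>C real"

definition pressure :: "real \<Rightarrow> linf \<Rightarrow> int \<Rightarrow> real" where
  "pressure \<kappa> w j = Phi' \<kappa> (apply_bcontfun w j)"

definition X_set :: "real \<Rightarrow> int \<Rightarrow> linf set" where
  "X_set \<kappa> k = {w.
     u_star \<kappa> < (INF j\<in>{..<k}. apply_bcontfun w j) \<and>
     - u_dstar \<kappa> < (INF j\<in>{k<..}. apply_bcontfun w j) \<and>
     (SUP j\<in>{k<..}. apply_bcontfun w j) < - u_star \<kappa> \<and>
     - u_dstar \<kappa> < apply_bcontfun w k \<and> apply_bcontfun w k < u_star \<kappa>}"

definition solves_lattice :: "real \<Rightarrow> (real \<Rightarrow> linf) \<Rightarrow> bool" where
  "solves_lattice \<kappa> u \<longleftrightarrow>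
     (\<forall>t\<ge>0. \<exists>D. (u has_vector_derivative D) (at t within {0..}) \<and>
        (\<forall>j. apply_bcontfun D j = Lap (pressure \<kappa> (u t)) j))"

text \<open>The phase transition times are \<open>ts k\<close> for \<open>k \<ge> 1\<close>; \<open>ts 0 = 0\<close> is the convention
  of the source and not a transition time.\<close>

definition single_interface_solution ::
  "real \<Rightarrow> (real \<Rightarrow> linf) \<Rightarrow> (nat \<Rightarrow> ereal) \<Rightarrow> bool" where
  "single_interface_solution \<kappa> u ts \<longleftrightarrow>
     solves_lattice \<kappa> u \<and>
     ts 0 = 0 \<and>
     (\<forall>k\<ge>1. 0 < ts k \<and> ts k \<le> ts (k + 1)) \<and>
     (\<forall>k\<ge>1. (ts k = \<infinity> \<or> ts k < ts (k + 1)) \<and>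
        (ts (k - 1) < \<infinity> \<longrightarrow>
           (\<forall>t. ts (k - 1) < ereal t \<and> ereal t < ts k \<longrightarrow> u t \<in> X_set \<kappa> (int k))))"

definition t_sharp :: "real \<Rightarrow> (real \<Rightarrow> linf) \<Rightarrow> (nat \<Rightarrow> ereal) \<Rightarrow> nat \<Rightarrow> ereal" where
  "t_sharp \<kappa> u ts k =
     (if k = 0 then 0
      else Inf {ereal t | t. ts (k - 1) < ereal t \<and> apply_bcontfun (u t) (int k) > - u_star \<kappa>})"

definition well_prepared :: "real \<Rightarrow> real \<Rightarrow> real \<Rightarrow> real \<Rightarrow> linf \<Rightarrow> bool" where
  "well_prepared \<kappa> \<alpha> \<beta> \<epsilon> w \<longleftrightarrow>
     w \<in> X_set \<kappa> 1 \<and>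
     apply_bcontfun w 1 \<notin> {- u_star \<kappa><..<u_star \<kappa>} \<and>
     (\<forall>j. \<bar>pressure \<kappa> w j\<bar> \<le> \<alpha>) \<and>
     (\<forall>j. \<bar>Grad_plus (pressure \<kappa> w) j\<bar> \<le> \<alpha> * \<epsilon>) \<and>
     (\<forall>j. j \<noteq> 1 \<longrightarrow> \<bar>Lap (pressure \<kappa> w) j\<bar> \<le> \<alpha> * \<epsilon>\<^sup>2) \<and>
     \<bar>Lap (pressure \<kappa> w) 1\<bar> \<le> \<beta> * \<epsilon> \<and>
     (\<forall>j. pressure \<kappa> w j \<le> p_star \<kappa> + \<epsilon> * \<beta> * max 0 (1 - real_of_int j))"

section \<open>Scaled data and macroscopic limits\<close>

definition cell :: "real \<Rightarrow> real \<Rightarrow> int" where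
  "cell \<epsilon> \<xi> = \<lceil>\<xi> / \<epsilon> - 1 / 2\<rceil>"

lemma cell_iff:
  assumes "0 < \<epsilon>"
  shows "cell \<epsilon> \<xi> = j \<longleftrightarrow> (\<exists>\<zeta>. \<xi> = \<epsilon> * (real_of_int j + \<zeta>) \<and> - 1 / 2 < \<zeta> \<and> \<zeta> \<le> 1 / 2)"
proof -
  have "(\<exists>\<zeta>. \<xi> = \<epsilon> * (real_of_int j + \<zeta>) \<and> - 1 / 2 < \<zeta> \<and> \<zeta> \<le> 1 / 2) \<longleftrightarrow>
        - 1 / 2 < \<xi> / \<epsilon> - real_of_int j \<and> \<xi> / \<epsilon> - real_of_int j \<le> 1 / 2"
  proof
    assume "- 1 / 2 < \<xi> / \<epsilon> - real_of_int j \<and> \<xi> / \<epsilon> - real_of_int j \<le> 1 / 2"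
    then show "\<exists>\<zeta>. \<xi> = \<epsilon> * (real_of_int j + \<zeta>) \<and> - 1 / 2 < \<zeta> \<and> \<zeta> \<le> 1 / 2"
      using assms by (intro exI[of _ "\<xi> / \<epsilon> - real_of_int j"]) simp
  qed (use assms in auto)
  also have "\<dots> \<longleftrightarrow> cell \<epsilon> \<xi> = j"
    unfolding cell_def ceiling_eq_iff by linarith
  finally show ?thesis by blast
qed

definition U_eps :: "real \<Rightarrow> (real \<Rightarrow> linf) \<Rightarrow> real \<times> real \<Rightarrow> real" where
  "U_eps \<epsilon> u = (\<lambda>(\<tau>, \<xi>). apply_bcontfun (u (\<tau> / \<epsilon>\<^sup>2)) (cell \<epsilon> \<xi>))"

definition P_eps :: "real \<Rightarrow> real \<Rightarrow> (real \<Rightarrow> linf) \<Rightarrow> real \<times> real \<Rightarrow> real" where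
  "P_eps \<kappa> \<epsilon> u = (\<lambda>(\<tau>, \<xi>). pressure \<kappa> (u (\<tau> / \<epsilon>\<^sup>2)) (cell \<epsilon> \<xi>))"

definition Grad_P_eps :: "real \<Rightarrow> real \<Rightarrow> (real \<Rightarrow> linf) \<Rightarrow> real \<times> real \<Rightarrow> real" where
  "Grad_P_eps \<kappa> \<epsilon> u = (\<lambda>(\<tau>, \<xi>). (P_eps \<kappa> \<epsilon> u (\<tau>, \<xi> + \<epsilon>) - P_eps \<kappa> \<epsilon> u (\<tau>, \<xi>)) / \<epsilon>)"

text \<open>The summation index is shifted by one: the term with index \<open>k\<close> belongs to the
  interface position \<open>k + 1\<close>.\<close>

definition interface :: "real \<Rightarrow> (nat \<Rightarrow> ereal) \<Rightarrow> real \<Rightarrow> real" where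
  "interface \<epsilon> ts \<tau> =
     \<epsilon> * (\<Sum>k. real (k + 1) * indicator {ts k..<ts (k + 1)} (ereal (\<tau> / \<epsilon>\<^sup>2)))"

definition Xi_star :: "real \<Rightarrow> (nat \<Rightarrow> ereal) \<Rightarrow> real \<Rightarrow> real" where
  "Xi_star \<epsilon> ts = interface \<epsilon> ts"

definition Xi_sharp :: "real \<Rightarrow> real \<Rightarrow> (real \<Rightarrow> linf) \<Rightarrow> (nat \<Rightarrow> ereal) \<Rightarrow> real \<Rightarrow> real" where
  "Xi_sharp \<kappa> \<epsilon> u ts = interface \<epsilon> (t_sharp \<kappa> u ts)"

definition M_eps ::
  "real \<Rightarrow> real \<Rightarrow> (real \<Rightarrow> linf) \<Rightarrow> (nat \<Rightarrow> ereal) \<Rightarrow> real \<times> real \<Rightarrow> real" where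
  "M_eps \<kappa> \<epsilon> u ts = (\<lambda>(\<tau>, \<xi>).
     if \<xi> > Xi_sharp \<kappa> \<epsilon> u ts \<tau> then - 1
     else if \<xi> < Xi_star \<epsilon> ts \<tau> then 1 else 0)"

definition Gamma_eps ::
  "real \<Rightarrow> real \<Rightarrow> real \<Rightarrow> (real \<Rightarrow> linf) \<Rightarrow> (nat \<Rightarrow> ereal) \<Rightarrow> (real \<times> real) set" where
  "Gamma_eps \<kappa> \<tau>fin \<epsilon> u ts =
     {(\<tau>, \<xi>). Xi_star \<epsilon> ts \<tau> \<le> \<xi> \<and> \<xi> \<le> Xi_sharp \<kappa> \<epsilon> u ts \<tau> \<and> 0 \<le> \<tau> \<and> \<tau> \<le> \<tau>fin}"

definition Omega :: "real \<Rightarrow> (real \<times> real) set" where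
  "Omega \<tau>fin = {0..\<tau>fin} \<times> UNIV"

text \<open>\<open>u \<epsilon>\<close> and \<open>ts \<epsilon>\<close> are the lattice solution with parameter \<open>\<epsilon>\<close> and its transition
  times, \<open>e\<close> is the sequence of parameters. \<open>U\<close> and \<open>M\<close> stand for their classes modulo
  null sets, \<open>P\<close> for the continuous representative, and \<open>DP\<close> for \<open>\<partial>\<^sub>\<xi>P\<close>.\<close>

definition macroscopic_limit ::
  "real \<Rightarrow> real \<Rightarrow> (nat \<Rightarrow> real) \<Rightarrow> (real \<Rightarrow> real \<Rightarrow> linf) \<Rightarrow> (real \<Rightarrow> nat \<Rightarrow> ereal) \<Rightarrow>
   (real \<times> real \<Rightarrow> real) \<Rightarrow> (real \<times> real \<Rightarrow> real) \<Rightarrow> (real \<times> real \<Rightarrow> real) \<Rightarrow>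
   (real \<times> real \<Rightarrow> real) \<Rightarrow> (real \<Rightarrow> real) \<Rightarrow> bool" where
  "macroscopic_limit \<kappa> \<tau>fin e u ts U P DP M \<Xi> \<longleftrightarrow>
     (\<lambda>n. emeasure lebesgue (Gamma_eps \<kappa> \<tau>fin (e n) (u (e n)) (ts (e n)))) \<longlonglongrightarrow> 0 \<and>
     (\<exists>L. L-lipschitz_on {0..\<tau>fin} \<Xi>) \<and>
     Linf_tendsto {0..\<tau>fin} (\<lambda>n. Xi_star (e n) (ts (e n))) \<Xi> \<and>
     Linf_tendsto {0..\<tau>fin} (\<lambda>n. Xi_sharp \<kappa> (e n) (u (e n)) (ts (e n))) \<Xi> \<and>
     (\<forall>s\<ge>1.
        Ls_loc_tendsto s (Omega \<tau>fin) (\<lambda>n. U_eps (e n) (u (e n))) U \<and>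
        Ls_loc_tendsto s (Omega \<tau>fin) (\<lambda>n. P_eps \<kappa> (e n) (u (e n))) P \<and>
        Ls_loc_tendsto s (Omega \<tau>fin) (\<lambda>n. M_eps \<kappa> (e n) (u (e n)) (ts (e n))) M) \<and>
     ess_bounded_on (Omega \<tau>fin) U \<and>
     ess_bounded_on (Omega \<tau>fin) P \<and>
     ess_bounded_on (Omega \<tau>fin) M \<and>
     locally_Hoelder_on (Omega \<tau>fin) P \<and>
     (\<forall>\<tau>\<in>{0..\<tau>fin}. \<forall>s\<ge>1.
        Ls_loc_tendsto s UNIV (\<lambda>n \<xi>. P_eps \<kappa> (e n) (u (e n)) (\<tau>, \<xi>)) (\<lambda>\<xi>. P (\<tau>, \<xi>))) \<and>
     (\<forall>\<tau>\<in>{0..\<tau>fin}. weak_derivative (\<lambda>\<xi>. P (\<tau>, \<xi>)) (\<lambda>\<xi>. DP (\<tau>, \<xi>))) \<and>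
     L2_loc_weakly_tendsto (Omega \<tau>fin) (\<lambda>n. Grad_P_eps \<kappa> (e n) (u (e n))) DP"

section \<open>The limit problem\<close>

text \<open>Weak form of \<open>\<partial>\<^sub>\<tau>P = \<partial>\<^sub>\<xi>\<^sup>2P\<close> off the interface together with
  \<open>2 \<Xi>' = [[\<partial>\<^sub>\<xi>P]]\<close> on it; the phase field \<open>M\<close> jumps by \<open>-2\<close> across the interface.\<close>

definition Stefan_distributional_solution ::
  "real \<Rightarrow> (real \<times> real \<Rightarrow> real) \<Rightarrow> (real \<times> real \<Rightarrow> real) \<Rightarrow> (real \<times> real \<Rightarrow> real) \<Rightarrow> bool" where
  "Stefan_distributional_solution \<tau>fin P DP M \<longleftrightarrow>
     (\<forall>\<Psi>. test_function ({0<..<\<tau>fin} \<times> UNIV) \<Psi> \<longrightarrow>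
        (LINT z|lebesgue_on (Omega \<tau>fin). (P z + M z) * d_tau \<Psi> z) =
        (LINT z|lebesgue_on (Omega \<tau>fin). DP z * d_xi \<Psi> z))"

definition attains_initial_data ::
  "(real \<times> real \<Rightarrow> real) \<Rightarrow> (real \<Rightarrow> real) \<Rightarrow> (real \<Rightarrow> real) \<Rightarrow> real \<Rightarrow> bool" where
  "attains_initial_data P \<Xi> P0 \<Xi>0 \<longleftrightarrow>
     (\<forall>K. compact K \<longrightarrow> uniform_limit K (\<lambda>\<tau> \<xi>. P (\<tau>, \<xi>)) P0 (at_right 0)) \<and>
     (\<forall>\<xi>. P (0, \<xi>) = P0 \<xi>) \<and> \<Xi> 0 = \<Xi>0"

definition smooth_entropy_pair :: "real \<Rightarrow> (real \<Rightarrow> real) \<Rightarrow> (real \<Rightarrow> real) \<Rightarrow> bool" where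
  "smooth_entropy_pair \<kappa> \<eta> \<mu> \<longleftrightarrow>
     smooth \<mu> \<and> (\<forall>x. deriv \<mu> x \<ge> 0) \<and>
     (\<forall>x. (\<eta> has_real_derivative \<mu> (Phi' \<kappa> x)) (at x))"

definition entropy_inequality ::
  "real \<Rightarrow> (real \<times> real \<Rightarrow> real) \<Rightarrow> (real \<times> real \<Rightarrow> real) \<Rightarrow> (real \<times> real \<Rightarrow> real) \<Rightarrow>
   (real \<Rightarrow> real) \<Rightarrow> (real \<Rightarrow> real) \<Rightarrow> bool" where
  "entropy_inequality \<tau>fin U P DP \<eta> \<mu> \<longleftrightarrow>
     (\<forall>\<Psi>. test_function ({0<..<\<tau>fin} \<times> UNIV) \<Psi> \<and> (\<forall>z. \<Psi> z \<ge> 0) \<longrightarrow>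
        (LINT z|lebesgue_on (Omega \<tau>fin).
           \<eta> (U z) * d_tau \<Psi> z - \<mu> (P z) * DP z * d_xi \<Psi> z) \<ge> 0)"

end

theory Submission
  imports Defs
begin

text \<open>The proof rests on one inequality for the lattice and on the fact that it survives the limit under
  strong convergence alone. Let \<open>N\<close> be convex with \<open>N' = \<mu>\<close>, and let \<open>\<eta>' = \<mu> \<circ> \<Phi>'\<close>. Since \<open>N\<close> lies above its
  tangents, the lattice equation gives
  \<open>d/dt \<eta>(u\<^sub>j) = \<mu>(p\<^sub>j) \<Delta>p\<^sub>j \<le> \<Delta>N(p)\<^sub>j\<close>, with equality if \<open>N\<close> is linear. In weak form all derivatives
  fall on the test function \<open>\<Psi>\<close>, and only \<open>\<eta>(U\<^sub>\<epsilon>)\<close> and \<open>N(P\<^sub>\<epsilon>)\<close> remain. For Lipschitz continuous \<open>\<eta>\<close> and \<open>N\<close> these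
  converge in \<open>L\<^sup>1\<close> on compact sets; this is \<open>lattice_entropy_limit\<close>. In the limit, the continuous
  function \<open>P(\<tau>, \<cdot>)\<close> is absolutely continuous with density \<open>\<partial>\<^sub>\<xi>P\<close>, so the chain rule
  \<open>weak_chain_rule\<close> turns \<open>N(P) \<partial>\<^sub>\<xi>\<^sup>2\<Psi>\<close> into \<open>-\<mu>(P) \<partial>\<^sub>\<xi>P \<partial>\<^sub>\<xi>\<Psi>\<close>. Bounded \<open>U\<close> and \<open>P\<close> see only a truncated \<open>\<mu>\<close>, for which \<open>\<eta>\<close>
  and \<open>N\<close> are Lipschitz continuous, and this yields the entropy inequality for every smooth pair. The
  linear choices \<open>N(p) = \<plusminus>p\<close> yield an equality for test functions of any sign, the distributional Stefan problem.

  The algebraic statements come from the phase structure. A particle to the left of the interface has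
  \<open>u \<ge> u\<^sub>*\<close>, one to the right has \<open>-u\<^sub>*\<^sub>* \<le> u \<le> -u\<^sub>*\<close>, at all times because the transition times do not accumulate
  (\<open>transition_times_cover\<close>). Uniform convergence of the interfaces and convergence almost everywhere of
  a subsequence carry this over to the limit (\<open>phase_separated_AE\<close>), whence \<open>U = P + M\<close> and the bounds on \<open>P\<close>;
  the continuity of \<open>P\<close> and \<open>\<Xi>\<close> removes the exceptional null sets. The lattice interface never moves back, so \<open>\<Xi>\<close> is
  nondecreasing. A monotone Lipschitz function is differentiable almost everywhere
  (\<open>mono_lipschitz_differentiable_AE\<close>, by Vitali's covering theorem).

  An interface that starts at \<open>\<Xi>(0) > 0\<close> would require \<open>U\<close> to jump by at least \<open>2 u\<^sub>*\<close> on an interval at time 0,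
  which the equation, tested with functions that do not vanish at time 0, rules out (\<open>Xi_initial\<close>).
  The flow rule is a consequence of the entropy inequality: if \<open>P < c < p\<^sub>*\<close> near a point of the interface, choose \<open>\<mu>\<close> with
  \<open>\<mu> = 0\<close> on \<open>(-\<infinity>, c]\<close> and \<open>\<mu> > 0\<close> beyond. Then the flux vanishes locally, \<open>\<eta>(U)\<close> is larger behind the interface than
  ahead of it, and the inequality forbids the interface to advance
  (\<open>interface_constant_below_threshold\<close>).\<close>

section \<open>Smooth functions and cutoffs\<close>

lemma C_k_cmult:
  fixes f :: "'a::euclidean_space \<Rightarrow> real"
  shows "C_k k f \<Longrightarrow> C_k k (\<lambda>x. c * f x)"
proof (induction k arbitrary: f)
  case (Suc k)
  have "frechet_derivative (\<lambda>x. c * f x) (at x) v = c * frechet_derivative f (at x) v" for x v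
  proof -
    have "(f has_derivative frechet_derivative f (at x)) (at x)"
      using Suc.prems by (simp add: frechet_derivative_works)
    from frechet_derivative_at[OF has_derivative_mult_right[OF this, of c], symmetric] show ?thesis
      by simp
  qed
  then show ?case using Suc by (simp add: differentiable_cmult_right_iff)
qed (auto intro!: continuous_intros)

lemma C_k_add:
  fixes f g :: "'a::euclidean_space \<Rightarrow> real"
  shows "C_k k f \<Longrightarrow> C_k k g \<Longrightarrow> C_k k (\<lambda>x. f x + g x)"
proof (induction k arbitrary: f g)
  case (Suc k)
  have "frechet_derivative (\<lambda>x. f x + g x) (at x) v =
      frechet_derivative f (at x) v + frechet_derivative g (at x) v" for x v
  proof -
    have "(f has_derivative frechet_derivative f (at x)) (at x)"
      "(g has_derivative frechet_derivative g (at x)) (at x)"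
      using Suc.prems by (simp_all add: frechet_derivative_works)
    from frechet_derivative_at[OF has_derivative_add[OF this], symmetric] show ?thesis
      by simp
  qed
  then show ?case using Suc by simp
qed (auto intro!: continuous_intros)

lemma C_k_diff:
  fixes f g :: "'a::euclidean_space \<Rightarrow> real"
  assumes "C_k k f" "C_k k g" shows "C_k k (\<lambda>x. f x - g x)"
  using C_k_add[OF assms(1) C_k_cmult[OF assms(2), of "- 1"]] by simp

lemma C_k_SucD:
  fixes f :: "'a::euclidean_space \<Rightarrow> real"
  shows "C_k (Suc k) f \<Longrightarrow> C_k k f"
proof (induction k arbitrary: f)
  case 0
  then show ?case
    by (auto intro!: continuous_at_imp_continuous_on differentiable_imp_continuous_within)
next
  case (Suc k)
  from Suc.prems have "\<forall>v. C_k (Suc k) (\<lambda>x. frechet_derivative f (at x) v)" "\<forall>x. f differentiable at x"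
    by simp_all
  then show ?case using Suc.IH by simp
qed

lemma C_k_mult:
  fixes f g :: "'a::euclidean_space \<Rightarrow> real"
  shows "C_k k f \<Longrightarrow> C_k k g \<Longrightarrow> C_k k (\<lambda>x. f x * g x)"
proof (induction k arbitrary: f g)
  case (Suc k)
  have "frechet_derivative (\<lambda>x. f x * g x) (at x) v =
      f x * frechet_derivative g (at x) v + frechet_derivative f (at x) v * g x" for x v
  proof -
    have "(f has_derivative frechet_derivative f (at x)) (at x)"
      "(g has_derivative frechet_derivative g (at x)) (at x)"
      using Suc.prems by (simp_all add: frechet_derivative_works)
    from frechet_derivative_at[OF has_derivative_mult[OF this], symmetric] show ?thesis
      by simp
  qed
  moreover have "C_k k f" "C_k k g" using Suc.prems C_k_SucD by blast+
  ultimately show ?case using Suc by (simp add: C_k_add)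
qed (auto intro!: continuous_intros)

text \<open>Slices of functions of two variables, tensor products and rescaled cutoffs all come from
  precomposition with an affine map.\<close>
lemma C_k_compose_affine:
  fixes f :: "'a::euclidean_space \<Rightarrow> real" and A :: "'b::euclidean_space \<Rightarrow> 'a"
  assumes A: "bounded_linear A"
  shows "C_k k f \<Longrightarrow> C_k k (\<lambda>x. f (A x + c))"
proof (induction k arbitrary: f)
  case 0
  have "continuous_on UNIV (\<lambda>x. A x + c)"
    using A by (intro continuous_intros linear_continuous_on)
  with 0 show ?case using continuous_on_compose2[of UNIV f UNIV "\<lambda>x. A x + c"] by simp
next
  case (Suc k)
  have D: "((\<lambda>x. f (A x + c)) has_derivative (\<lambda>v. frechet_derivative f (at (A x + c)) (A v))) (at x)" for x
  proof -
    have "(f has_derivative frechet_derivative f (at (A x + c))) (at (A x + c))"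
      using Suc.prems by (simp add: frechet_derivative_works)
    moreover have "((\<lambda>x. A x + c) has_derivative A) (at x)"
      using A by (auto intro!: derivative_eq_intros bounded_linear_imp_has_derivative)
    ultimately show ?thesis
      using has_derivative_compose by blast
  qed
  from frechet_derivative_at[OF this, symmetric]
  have "frechet_derivative (\<lambda>x. f (A x + c)) (at x) v = frechet_derivative f (at (A x + c)) (A v)" for x v
    by simp
  moreover have "(\<lambda>x. f (A x + c)) differentiable at x" for x
    using D differentiableI by blast
  moreover have "C_k k (\<lambda>x. frechet_derivative f (at (A x + c)) (A v))" for v
    using Suc.IH[of "\<lambda>y. frechet_derivative f (at y) (A v)"] Suc.prems by simp
  ultimately show ?case by simp
qed

lemma frechet_derivative_real:
  assumes "(f has_real_derivative d) (at x)"
  shows "frechet_derivative f (at x) v = d * v"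
  using assms by (metis frechet_derivative_at has_field_derivative_def)

lemma C_k_real_Suc:
  assumes "\<And>x. (f has_real_derivative f' x) (at x)" "C_k k f'"
  shows "C_k (Suc k) f"
proof -
  have "C_k k (\<lambda>x. v * f' x)" for v using assms(2) by (rule C_k_cmult)
  moreover have "(\<lambda>x. frechet_derivative f (at x) v) = (\<lambda>x. v * f' x)" for v
    using frechet_derivative_real[OF assms(1)] by (simp add: mult.commute)
  moreover have "f differentiable at x" for x
    using assms(1) real_differentiable_def by blast
  ultimately show ?thesis by simp
qed

lemma smooth_real_deriv:
  fixes f :: "real \<Rightarrow> real"
  assumes "smooth f"
  shows "(f has_real_derivative deriv f x) (at x)" "smooth (deriv f)"
proof -
  have 1: "C_k (Suc k) f" for k using assms smooth_def by blast
  have "f differentiable at x" for x using 1[of 0] by simp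
  then show D: "(f has_real_derivative deriv f x) (at x)" for x
    using real_differentiable_def DERIV_imp_deriv by blast
  have "(\<lambda>x. frechet_derivative f (at x) 1) = deriv f"
    using frechet_derivative_real[OF D] by simp
  then have "C_k k (deriv f)" for k using 1[of k] by (metis C_k.simps(2))
  then show "smooth (deriv f)" by (simp add: smooth_def)
qed

lemma smooth_continuous_on: "smooth f \<Longrightarrow> continuous_on A f"
  using continuous_on_subset[of UNIV f A] by (metis C_k.simps(1) smooth_def subset_UNIV)

lemma smooth_directional_derivative:
  assumes "smooth f"
  shows "smooth (\<lambda>x. frechet_derivative f (at x) v)"
  using assms unfolding smooth_def by (metis C_k.simps(2))

text \<open>The functions \<open>e\<^sup>-\<^sup>1\<^sup>/\<^sup>x x\<^sup>-\<^sup>m\<close> on the positive half-line. All exponents \<open>m\<close> are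
  treated together because the derivative of the \<open>m\<close>-th function is a combination of the
  functions with exponents \<open>m + 2\<close> and \<open>m + 1\<close>, so that one induction over the order of
  differentiability proves smoothness of the whole family.\<close>
definition flat :: "nat \<Rightarrow> real \<Rightarrow> real" where
  "flat m x = (if x \<le> 0 then 0 else exp (- inverse x) * inverse x ^ m)"

lemma flat_tendsto_0: "((\<lambda>x. exp (- inverse x) * inverse x ^ m) \<longlongrightarrow> 0) (at_right (0::real))"
proof -
  have "((\<lambda>y. y ^ m / exp y) \<longlongrightarrow> 0) (at_top :: real filter)"
    by (rule tendsto_power_div_exp_0)
  then have "((\<lambda>x. (inverse x) ^ m / exp (inverse x)) \<longlongrightarrow> 0) (at_right (0::real))"
    using filterlim_compose filterlim_inverse_at_top_right by blast
  then show ?thesis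
    by (simp add: exp_minus divide_inverse mult.commute)
qed

lemma flat_has_derivative:
  "(flat m has_real_derivative flat (m + 2) x - real m * flat (m + 1) x) (at x)"
proof -
  consider "x < 0" | "x = 0" | "x > 0" by linarith
  then show ?thesis
  proof cases
    case 1
    have "((\<lambda>x. 0) has_real_derivative 0) (at x)" by simp
    then have "(flat m has_real_derivative 0) (at x)"
      by (rule has_field_derivative_transform_within_open[of _ _ _ "{..<0}"])
         (use 1 in \<open>auto simp: flat_def\<close>)
    then show ?thesis using 1 by (simp add: flat_def)
  next
    case 2
    have "((\<lambda>h. flat m h / h) \<longlongrightarrow> 0) (at_right 0)"
      by (rule Lim_transform_eventually[OF flat_tendsto_0[of "Suc m"]])
         (auto simp: flat_def divide_inverse eventually_at_filter)
    moreover have "((\<lambda>h. flat m h / h) \<longlongrightarrow> 0) (at_left 0)"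
      by (rule tendsto_eventually) (auto simp: flat_def eventually_at_filter)
    ultimately have "((\<lambda>h. flat m h / h) \<longlongrightarrow> 0) (at 0)"
      by (simp add: filterlim_split_at)
    then have "(flat m has_real_derivative 0) (at 0)"
      by (simp add: DERIV_def flat_def)
    then show ?thesis using 2 by (simp add: flat_def)
  next
    case 3
    have I: "(inverse has_real_derivative - (inverse x ^ 2)) (at x)"
      using 3 DERIV_inverse[of x] by (simp add: numeral_2_eq_2)
    have E: "((\<lambda>x. exp (- inverse x)) has_real_derivative exp (- inverse x) * inverse x ^ 2) (at x)"
      using DERIV_fun_exp[OF DERIV_minus[OF I]] by simp
    have "((\<lambda>x. inverse x ^ m) has_real_derivative - (real m * inverse x ^ (m + 1))) (at x)"
      using DERIV_power[OF I, of m] by (cases m) (simp_all add: power2_eq_square mult_ac)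
    from DERIV_mult[OF E this] have "((\<lambda>x. exp (- inverse x) * inverse x ^ m) has_real_derivative
        flat (m + 2) x - real m * flat (m + 1) x) (at x)"
      using 3 by (simp add: flat_def power2_eq_square mult_ac)
    then show ?thesis
      by (rule has_field_derivative_transform_within_open[of _ _ _ "{0<..}"])
         (use 3 in \<open>auto simp: flat_def\<close>)
  qed
qed

lemma smooth_flat: "smooth (flat m)"
proof -
  have "C_k k (flat m)" for k
  proof (induction k arbitrary: m)
    case 0
    show ?case
      using DERIV_isCont[OF flat_has_derivative] by (auto intro!: continuous_at_imp_continuous_on)
  next
    case (Suc k)
    show ?case
      by (rule C_k_real_Suc[OF flat_has_derivative]) (intro C_k_diff C_k_cmult Suc.IH)
  qed
  then show ?thesis by (simp add: smooth_def)
qed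

lemma flat_mono: "x \<le> y \<Longrightarrow> flat 0 x \<le> flat 0 y"
  by (auto simp: flat_def divide_simps)

lemma flat_pos_iff: "flat 0 x > 0 \<longleftrightarrow> x > 0"
  by (simp add: flat_def)

lemma flat_nonneg: "flat 0 x \<ge> 0"
  by (simp add: flat_def)

lemma C_k_inverse:
  fixes f :: "'a::euclidean_space \<Rightarrow> real"
  assumes "\<And>x. f x \<noteq> 0"
  shows "C_k k f \<Longrightarrow> C_k k (\<lambda>x. inverse (f x))"
proof (induction k)
  case 0
  then show ?case using assms by (auto intro!: continuous_intros)
next
  case (Suc k)
  have D: "((\<lambda>x. inverse (f x)) has_derivative
      (\<lambda>v. - (inverse (f x) * frechet_derivative f (at x) v * inverse (f x)))) (at x)" for x
    using Suc.prems assms by (intro Deriv.has_derivative_inverse) (simp_all add: frechet_derivative_works)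
  have "frechet_derivative (\<lambda>x. inverse (f x)) (at x) v =
      (-1) * (inverse (f x) * frechet_derivative f (at x) v * inverse (f x))" for x v
    using frechet_derivative_at[OF D, symmetric] by simp
  moreover have "(\<lambda>x. inverse (f x)) differentiable at x" for x
    using D differentiableI by blast
  moreover have "C_k k (\<lambda>x. (-1) * (inverse (f x) * frechet_derivative f (at x) v * inverse (f x)))" for v
    using Suc C_k_SucD[OF Suc.prems] by (intro C_k_cmult C_k_mult) simp_all
  ultimately show ?case by simp
qed

lemma smooth_mult: "smooth f \<Longrightarrow> smooth g \<Longrightarrow> smooth (\<lambda>x. f x * g x)"
  by (simp add: smooth_def C_k_mult)

lemma smooth_diff: "smooth f \<Longrightarrow> smooth g \<Longrightarrow> smooth (\<lambda>x. f x - g x)"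
  by (simp add: smooth_def C_k_diff)

lemma smooth_compose_affine: "bounded_linear A \<Longrightarrow> smooth f \<Longrightarrow> smooth (\<lambda>x. f (A x + c))"
  by (simp add: smooth_def C_k_compose_affine)

lemma smooth_compose_real_affine:
  fixes f :: "real \<Rightarrow> real"
  shows "smooth f \<Longrightarrow> smooth (\<lambda>x. f (m * x + c))"
  by (intro smooth_compose_affine bounded_linear_mult_right)

text \<open>A smooth transition from 0 on the left of 0 to 1 on the right of 1. The denominator never
  vanishes because \<open>x\<close> or \<open>1 - x\<close> is positive.\<close>
definition smooth_step :: "real \<Rightarrow> real" where
  "smooth_step x = flat 0 x * inverse (flat 0 x + flat 0 (1 - x))"

lemma smooth_smooth_step: "smooth smooth_step"
proof -
  have pos: "flat 0 x + flat 0 (1 - x) > 0" for x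
    using flat_pos_iff[of x] flat_pos_iff[of "1 - x"] flat_nonneg[of x] flat_nonneg[of "1 - x"]
    by (cases "x > 0") linarith+
  have "smooth (\<lambda>x. flat 0 (1 - x))"
    using smooth_compose_real_affine[OF smooth_flat, of 0 "-1" 1] by simp
  then have "C_k k (\<lambda>x. flat 0 x + flat 0 (1 - x))" for k
    using smooth_flat by (intro C_k_add) (simp_all add: smooth_def)
  then show ?thesis
    unfolding smooth_def smooth_step_def using smooth_flat pos
    by (intro allI C_k_mult C_k_inverse) (simp_all add: smooth_def less_imp_neq[THEN not_sym])
qed

lemma smooth_step_eq_0: "x \<le> 0 \<Longrightarrow> smooth_step x = 0"
  by (simp add: smooth_step_def flat_def)

lemma smooth_step_eq_1: "x \<ge> 1 \<Longrightarrow> smooth_step x = 1"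
  by (simp add: smooth_step_def flat_def)

lemma smooth_step_bounds: "0 \<le> smooth_step x" "smooth_step x \<le> 1"
  using flat_nonneg[of x] flat_nonneg[of "1 - x"]
  by (auto simp: smooth_step_def divide_inverse[symmetric] divide_le_eq_1)

definition bump :: "real \<Rightarrow> real \<Rightarrow> real \<Rightarrow> real" where
  "bump a b x = flat 0 (x - a) * flat 0 (b - x)"

lemma smooth_bump: "smooth (bump a b)"
proof -
  have "smooth (\<lambda>x. flat 0 (1 * x + - a) * flat 0 (-1 * x + b))"
    by (intro smooth_mult smooth_compose_real_affine smooth_flat)
  then show ?thesis by (simp add: bump_def[abs_def])
qed

lemma bump_nonneg: "0 \<le> bump a b x"
  by (simp add: bump_def flat_nonneg)

lemma bump_pos: "a < x \<Longrightarrow> x < b \<Longrightarrow> 0 < bump a b x"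
  by (simp add: bump_def flat_pos_iff)

lemma bump_eq_0: "x \<le> a \<or> b \<le> x \<Longrightarrow> bump a b x = 0"
  by (auto simp: bump_def flat_def)

lemma smooth_tensor:
  fixes f g :: "real \<Rightarrow> real"
  assumes "smooth f" "smooth g"
  shows "smooth (\<lambda>z. f (fst z) * g (snd z))"
  using smooth_compose_affine[OF bounded_linear_fst assms(1), of 0]
    smooth_compose_affine[OF bounded_linear_snd assms(2), of 0]
  by (intro smooth_mult) simp_all

lemma test_function_bump_tensor:
  assumes "{a..b} \<times> {c..d} \<subseteq> A"
  shows "test_function A (\<lambda>z. bump a b (fst z) * bump c d (snd z))"
  unfolding test_function_def
proof (intro conjI exI)
  show "smooth (\<lambda>z. bump a b (fst z) * bump c d (snd z))"
    by (intro smooth_tensor smooth_bump)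
  show "compact ({a..b} \<times> {c..d})" by (intro compact_Times compact_Icc)
  show "{a..b} \<times> {c..d} \<subseteq> A" by fact
  show "\<forall>z. z \<notin> {a..b} \<times> {c..d} \<longrightarrow> bump a b (fst z) * bump c d (snd z) = 0"
    by (auto simp: bump_eq_0)
qed

lemma test_function_directional_derivative:
  fixes \<Psi> :: "'a::euclidean_space \<Rightarrow> real"
  assumes "test_function A \<Psi>"
  shows "test_function A (\<lambda>x. frechet_derivative \<Psi> (at x) v)"
proof -
  obtain K where K: "compact K" "K \<subseteq> A" "\<And>x. x \<notin> K \<Longrightarrow> \<Psi> x = 0" and s: "smooth \<Psi>"
    using assms by (auto simp: test_function_def)
  have "frechet_derivative \<Psi> (at x) v = 0" if "x \<notin> K" for x
  proof -
    have "((\<lambda>_. 0) has_derivative (\<lambda>_. 0)) (at x)" by simp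
    then have "(\<Psi> has_derivative (\<lambda>_. 0)) (at x)"
      by (rule has_derivative_transform_within_open[of _ _ _ _ "- K"])
         (use K that in \<open>auto simp: compact_imp_closed\<close>)
    then show ?thesis by (metis frechet_derivative_at)
  qed
  then show ?thesis
    using K smooth_directional_derivative[OF s] unfolding test_function_def by blast
qed

text \<open>Smoothness is phrased with directional Frechet derivatives, the weak formulations with
  the partial derivatives \<open>d_tau\<close> and \<open>d_xi\<close>; these are the derivatives in the directions
  \<open>(1, 0)\<close> and \<open>(0, 1)\<close>, and hence again test functions if \<open>\<Psi>\<close> is one.\<close>
lemma
  fixes \<Psi> :: "real \<times> real \<Rightarrow> real"
  assumes "smooth \<Psi>"
  shows smooth_has_tau_derivative: "((\<lambda>t. \<Psi> (t, \<xi>)) has_real_derivative d_tau \<Psi> (\<tau>, \<xi>)) (at \<tau>)"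
    and smooth_has_xi_derivative: "((\<lambda>x. \<Psi> (\<tau>, x)) has_real_derivative d_xi \<Psi> (\<tau>, \<xi>)) (at \<xi>)"
    and d_tau_eq: "d_tau \<Psi> = (\<lambda>z. frechet_derivative \<Psi> (at z) (1, 0))"
    and d_xi_eq: "d_xi \<Psi> = (\<lambda>z. frechet_derivative \<Psi> (at z) (0, 1))"
proof -
  have "C_k 1 \<Psi>" using assms smooth_def by blast
  then have "\<Psi> differentiable at z" for z by (cases z) auto
  then have F: "(\<Psi> has_derivative frechet_derivative \<Psi> (at z)) (at z)" for z
    by (simp only: frechet_derivative_works)
  have L: "linear (frechet_derivative \<Psi> (at z))" for z
    using F has_derivative_linear by blast
  have 1: "((\<lambda>t. \<Psi> (t, \<xi>)) has_real_derivative frechet_derivative \<Psi> (at (\<tau>, \<xi>)) (1, 0)) (at \<tau>)" for \<tau> \<xi>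
  proof -
    have "((\<lambda>t. (t, \<xi>)) has_derivative (\<lambda>h. (h, 0))) (at \<tau>)"
      by (auto intro!: derivative_eq_intros)
    from has_derivative_compose[OF this F]
    have "((\<lambda>t. \<Psi> (t, \<xi>)) has_derivative (\<lambda>h. frechet_derivative \<Psi> (at (\<tau>, \<xi>)) (h, 0))) (at \<tau>)" .
    moreover have "(\<lambda>h. frechet_derivative \<Psi> (at (\<tau>, \<xi>)) (h, 0)) = (*) (frechet_derivative \<Psi> (at (\<tau>, \<xi>)) (1, 0))"
    proof
      fix h
      have "frechet_derivative \<Psi> (at (\<tau>, \<xi>)) (h *\<^sub>R (1, 0)) = h *\<^sub>R frechet_derivative \<Psi> (at (\<tau>, \<xi>)) (1, 0)"
        by (rule linear_cmul[OF L])
      then show "frechet_derivative \<Psi> (at (\<tau>, \<xi>)) (h, 0) = frechet_derivative \<Psi> (at (\<tau>, \<xi>)) (1, 0) * h"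
        by (simp add: mult.commute)
    qed
    ultimately show ?thesis by (simp only: has_field_derivative_def)
  qed
  have 2: "((\<lambda>x. \<Psi> (\<tau>, x)) has_real_derivative frechet_derivative \<Psi> (at (\<tau>, \<xi>)) (0, 1)) (at \<xi>)" for \<tau> \<xi>
  proof -
    have "((\<lambda>x. (\<tau>, x)) has_derivative (\<lambda>h. (0, h))) (at \<xi>)"
      by (auto intro!: derivative_eq_intros)
    from has_derivative_compose[OF this F]
    have "((\<lambda>x. \<Psi> (\<tau>, x)) has_derivative (\<lambda>h. frechet_derivative \<Psi> (at (\<tau>, \<xi>)) (0, h))) (at \<xi>)" .
    moreover have "(\<lambda>h. frechet_derivative \<Psi> (at (\<tau>, \<xi>)) (0, h)) = (*) (frechet_derivative \<Psi> (at (\<tau>, \<xi>)) (0, 1))"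
    proof
      fix h
      have "frechet_derivative \<Psi> (at (\<tau>, \<xi>)) (h *\<^sub>R (0, 1)) = h *\<^sub>R frechet_derivative \<Psi> (at (\<tau>, \<xi>)) (0, 1)"
        by (rule linear_cmul[OF L])
      then show "frechet_derivative \<Psi> (at (\<tau>, \<xi>)) (0, h) = frechet_derivative \<Psi> (at (\<tau>, \<xi>)) (0, 1) * h"
        by (simp add: mult.commute)
    qed
    ultimately show ?thesis by (simp only: has_field_derivative_def)
  qed
  show 3: "d_tau \<Psi> = (\<lambda>z. frechet_derivative \<Psi> (at z) (1, 0))"
    using DERIV_imp_deriv[OF 1] by (auto simp: d_tau_def fun_eq_iff)
  show 4: "d_xi \<Psi> = (\<lambda>z. frechet_derivative \<Psi> (at z) (0, 1))"
    using DERIV_imp_deriv[OF 2] by (auto simp: d_xi_def fun_eq_iff)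
  show "((\<lambda>t. \<Psi> (t, \<xi>)) has_real_derivative d_tau \<Psi> (\<tau>, \<xi>)) (at \<tau>)" using 1 3 by simp
  show "((\<lambda>x. \<Psi> (\<tau>, x)) has_real_derivative d_xi \<Psi> (\<tau>, \<xi>)) (at \<xi>)" using 2 4 by simp
qed

lemma test_function_d_tau: "test_function A \<Psi> \<Longrightarrow> test_function A (d_tau \<Psi>)"
  using test_function_directional_derivative d_tau_eq by (metis test_function_def)

lemma test_function_d_xi: "test_function A \<Psi> \<Longrightarrow> test_function A (d_xi \<Psi>)"
  using test_function_directional_derivative d_xi_eq by (metis test_function_def)

section \<open>Weak derivatives on the line\<close>

text \<open>The errors on the cells of a partition add up to at most \<open>\<epsilon>\<close> times the integral of \<open>w\<close>
  over the whole interval, and \<open>\<epsilon>\<close> is arbitrary. This replaces differentiation under the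
  integral sign when the functions involved are merely absolutely continuous.\<close>
lemma increment_eq_integral_by_refinement:
  fixes D k w :: "real \<Rightarrow> real"
  assumes ab: "a \<le> b" and k: "k integrable_on {a..b}" and w: "w integrable_on {a..b}"
    and small: "\<And>\<epsilon>. 0 < \<epsilon> \<Longrightarrow> \<exists>d>0. \<forall>x y. a \<le> x \<and> x \<le> y \<and> y \<le> b \<and> y - x < d \<longrightarrow>
        \<bar>D y - D x - integral {x..y} k\<bar> \<le> \<epsilon> * integral {x..y} w"
  shows "D b - D a = integral {a..b} k"
proof -
  define H where "H x = D x - integral {a..x} k" for x
  define W where "W x = integral {a..x} w" for x
  have split: "integral {a..y} h = integral {a..x} h + integral {x..y} h"
    if "h integrable_on {a..b}" "a \<le> x" "x \<le> y" "y \<le> b" for x y and h :: "real \<Rightarrow> real"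
  proof -
    have "h integrable_on {a..y}"
      using that integrable_subinterval_real[of h a b a y] by auto
    from Henstock_Kurzweil_Integration.integral_combine[OF that(2,3) this] show ?thesis by simp
  qed
  have bound: "\<bar>H b - H a\<bar> \<le> \<epsilon> * W b" if "0 < \<epsilon>" for \<epsilon>
  proof -
    obtain d where d: "d > 0" "\<And>x y. a \<le> x \<Longrightarrow> x \<le> y \<Longrightarrow> y \<le> b \<Longrightarrow> y - x < d \<Longrightarrow>
        \<bar>D y - D x - integral {x..y} k\<bar> \<le> \<epsilon> * integral {x..y} w"
      using small[OF \<open>0 < \<epsilon>\<close>] by metis
    obtain n where n: "(b - a) / d < real n" using reals_Archimedean2 by blast
    have n0: "0 < n" 
    proof (rule ccontr)
      assume "\<not> 0 < n" then have "(b - a) / d < 0" using n by simp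
      moreover have "0 \<le> (b - a) / d" using ab d by simp
      ultimately show False by linarith
    qed
    define h where "h = (b - a) / real n"
    have h: "0 \<le> h" "h < d" "real n * h = b - a"
      using n n0 d ab by (auto simp: h_def field_simps)
    have "\<bar>H (a + real i * h) - H a\<bar> \<le> \<epsilon> * W (a + real i * h)" if "i \<le> n" for i
      using that
    proof (induction i)
      case 0
      then show ?case by (simp add: W_def)
    next
      case (Suc i)
      let ?x = "a + real i * h" and ?y = "a + real (Suc i) * h"
      have "real (Suc i) * h \<le> real n * h" using Suc.prems h by (intro mult_right_mono) simp_all
      then have xy: "a \<le> ?x" "?x \<le> ?y" "?y \<le> b" "?y - ?x < d" using h by (auto simp: field_simps)
      have "H ?y - H ?x = D ?y - D ?x - integral {?x..?y} k"
        using split[OF k xy(1-3)] by (simp add: H_def)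
      moreover have "W ?y = W ?x + integral {?x..?y} w"
        unfolding W_def using split[OF w xy(1-3)] .
      ultimately show ?case using d(2)[OF xy] Suc by (simp add: distrib_left)
    qed
    from this[of n] h show ?thesis by simp
  qed
  have "H b - H a = 0"
  proof (rule ccontr)
    assume ne: "H b - H a \<noteq> 0"
    define \<epsilon> where "\<epsilon> = \<bar>H b - H a\<bar> / 2 / (\<bar>W b\<bar> + 1)"
    have W: "0 < \<bar>W b\<bar> + 1" by simp
    have "0 < \<epsilon>" using ne W by (simp add: \<epsilon>_def)
    have "\<bar>H b - H a\<bar> \<le> \<epsilon> * W b" by (rule bound) fact
    also have "\<dots> \<le> \<epsilon> * (\<bar>W b\<bar> + 1)" using \<open>0 < \<epsilon>\<close> by (intro mult_left_mono) auto
    also have "\<dots> = \<bar>H b - H a\<bar> / 2"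
      by (rule iffD1[OF nonzero_eq_divide_eq, OF _ \<epsilon>_def]) (use W in linarith)
    finally show False using ne by simp
  qed
  then show ?thesis by (simp add: H_def)
qed

text \<open>Chain and product rule for an absolutely continuous \<open>f\<close> with density \<open>g\<close>. On a short
  interval the increment of \<open>N \<circ> f\<close> is a value of \<open>\<mu> \<circ> f\<close> times the integral of \<open>g\<close>; replacing
  that value, and the values of \<open>\<phi>\<close> and \<open>N \<circ> f\<close>, by those at the integration variable costs a
  small multiple of the integral of \<open>\<bar>g\<bar> + \<bar>\<phi>'\<bar>\<close> by uniform continuity.\<close>
lemma chain_rule_increment:
  fixes f g N \<mu> \<phi> \<phi>' :: "real \<Rightarrow> real"
  assumes ab: "a \<le> b" and f: "continuous_on {a..b} f" and g: "g absolutely_integrable_on {a..b}"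
    and fg: "\<And>x y. a \<le> x \<Longrightarrow> x \<le> y \<Longrightarrow> y \<le> b \<Longrightarrow> f y - f x = integral {x..y} g"
    and N: "\<And>x. (N has_real_derivative \<mu> x) (at x)" and \<mu>: "continuous_on UNIV \<mu>"
    and \<phi>: "\<And>x. (\<phi> has_real_derivative \<phi>' x) (at x)" and \<phi>': "continuous_on UNIV \<phi>'"
  shows "(\<lambda>x. \<mu> (f x) * \<phi> x * g x) absolutely_integrable_on {a..b}"
    and "N (f b) * \<phi> b - N (f a) * \<phi> a =
      integral {a..b} (\<lambda>x. \<mu> (f x) * \<phi> x * g x + N (f x) * \<phi>' x)"
proof -
  define G where "G x = \<mu> (f x)" for x
  define F where "F x = N (f x)" for x
  have cN: "continuous_on UNIV N" using N DERIV_isCont by (blast intro: continuous_at_imp_continuous_on)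
  have c\<phi>: "continuous_on A \<phi>" for A using \<phi> DERIV_isCont by (blast intro: continuous_at_imp_continuous_on)
  have c\<phi>': "continuous_on A \<phi>'" for A using \<phi>' continuous_on_subset by blast
  have cG: "continuous_on {a..b} G" unfolding G_def
    by (rule continuous_on_compose2[OF \<mu> f]) simp
  have cF: "continuous_on {a..b} F" unfolding F_def
    by (rule continuous_on_compose2[OF cN f]) simp
  have mult_abs: "(\<lambda>x. h x * g x) absolutely_integrable_on {x..y}"
    if "continuous_on {a..b} h" "a \<le> x" "y \<le> b" for h x y
  proof -
    have sub: "{x..y} \<subseteq> {a..b}" using that by auto
    have c: "continuous_on {x..y} h" using that(1) sub continuous_on_subset by blast
    have "g absolutely_integrable_on {x..y}"
      by (rule set_integrable_subset[OF g _ sub]) simp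
    moreover have "h \<in> borel_measurable (lebesgue_on {x..y})"
      using c by (intro continuous_imp_measurable_on_sets_lebesgue) auto
    moreover have "bounded (h ` {x..y})"
      using compact_continuous_image[OF c compact_Icc] compact_imp_bounded by blast
    ultimately show ?thesis
      by (intro absolutely_integrable_bounded_measurable_product_real) simp_all
  qed
  show A: "(\<lambda>x. \<mu> (f x) * \<phi> x * g x) absolutely_integrable_on {a..b}"
    using mult_abs[OF continuous_on_mult[OF cG c\<phi>], of a b] by (simp add: G_def)
  have B: "(\<lambda>x. N (f x) * \<phi>' x) integrable_on {a..b}"
    using cF c\<phi>' unfolding F_def[symmetric] by (intro integrable_continuous_real continuous_intros)
  have absg: "(\<lambda>x. \<bar>g x\<bar>) integrable_on {a..b}"
    using g by (auto simp: absolutely_integrable_on_def)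
  have abs\<phi>: "(\<lambda>x. \<bar>\<phi>' x\<bar>) integrable_on {a..b}"
    using c\<phi>' by (intro integrable_continuous_real continuous_intros)
  show "N (f b) * \<phi> b - N (f a) * \<phi> a =
      integral {a..b} (\<lambda>x. \<mu> (f x) * \<phi> x * g x + N (f x) * \<phi>' x)"
  proof (rule increment_eq_integral_by_refinement[OF ab _ integrable_add[OF absg abs\<phi>]])
    show "(\<lambda>x. \<mu> (f x) * \<phi> x * g x + N (f x) * \<phi>' x) integrable_on {a..b}"
      using A B by (intro integrable_add) (auto simp: absolutely_integrable_on_def)
    fix \<epsilon> :: real assume \<epsilon>: "0 < \<epsilon>"
    obtain C where C: "C > 0" "\<And>x. x \<in> {a..b} \<Longrightarrow> \<bar>G x\<bar> \<le> C" "\<And>x. x \<in> {a..b} \<Longrightarrow> \<bar>\<phi> x\<bar> \<le> C"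
    proof -
      have "bounded (G ` {a..b} \<union> \<phi> ` {a..b})"
        using compact_continuous_image[OF cG compact_Icc] compact_continuous_image[OF c\<phi> compact_Icc]
        by (simp add: compact_imp_bounded)
      then obtain C where "C > 0" "\<forall>x\<in>G ` {a..b} \<union> \<phi> ` {a..b}. norm x \<le> C"
        using bounded_pos by blast
      then show ?thesis using that[of C] by auto
    qed
    define \<delta> where "\<delta> = min \<epsilon> (\<epsilon> / (2 * C))"
    have \<delta>: "0 < \<delta>" "\<delta> \<le> \<epsilon>" "2 * C * \<delta> \<le> \<epsilon>"
    proof -
      show "0 < \<delta>" "\<delta> \<le> \<epsilon>" using \<epsilon> C by (auto simp: \<delta>_def)
      have "\<delta> \<le> \<epsilon> / (2 * C)" by (simp add: \<delta>_def)
      then show "2 * C * \<delta> \<le> \<epsilon>" using C(1) by (simp add: field_simps)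
    qed
    have uc: "\<exists>d>0. \<forall>x\<in>{a..b}. \<forall>y\<in>{a..b}. \<bar>y - x\<bar> < d \<longrightarrow> \<bar>h y - h x\<bar> < \<delta>"
      if "continuous_on {a..b} h" for h :: "real \<Rightarrow> real"
      using compact_uniformly_continuous[OF that compact_Icc] \<delta>(1)
      unfolding uniformly_continuous_on_def dist_real_def by blast
    obtain d1 where d1: "d1 > 0" "\<And>x y. x \<in> {a..b} \<Longrightarrow> y \<in> {a..b} \<Longrightarrow> \<bar>y - x\<bar> < d1 \<Longrightarrow> \<bar>G y - G x\<bar> < \<delta>"
      using uc[OF cG] by blast
    obtain d2 where d2: "d2 > 0" "\<And>x y. x \<in> {a..b} \<Longrightarrow> y \<in> {a..b} \<Longrightarrow> \<bar>y - x\<bar> < d2 \<Longrightarrow> \<bar>F y - F x\<bar> < \<delta>"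
      using uc[OF cF] by blast
    obtain d3 where d3: "d3 > 0" "\<And>x y. x \<in> {a..b} \<Longrightarrow> y \<in> {a..b} \<Longrightarrow> \<bar>y - x\<bar> < d3 \<Longrightarrow> \<bar>\<phi> y - \<phi> x\<bar> < \<delta>"
      using uc[OF c\<phi>] by blast
    show "\<exists>d>0. \<forall>x y. a \<le> x \<and> x \<le> y \<and> y \<le> b \<and> y - x < d \<longrightarrow>
      \<bar>N (f y) * \<phi> y - N (f x) * \<phi> x - integral {x..y} (\<lambda>x. \<mu> (f x) * \<phi> x * g x + N (f x) * \<phi>' x)\<bar>
        \<le> \<epsilon> * integral {x..y} (\<lambda>x. \<bar>g x\<bar> + \<bar>\<phi>' x\<bar>)"
    proof (intro exI[of _ "min d1 (min d2 d3)"] conjI allI impI)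
      show "0 < min d1 (min d2 d3)" using d1 d2 d3 by simp
      fix x y assume "a \<le> x \<and> x \<le> y \<and> y \<le> b \<and> y - x < min d1 (min d2 d3)"
      then have xy: "a \<le> x" "x \<le> y" "y \<le> b" "y - x < d1" "y - x < d2" "y - x < d3" by auto
      have sub: "{x..y} \<subseteq> {a..b}" using xy by auto
      \<comment> \<open>the mean value of \<open>\<mu>\<close> between \<open>f x\<close> and \<open>f y\<close> is taken at some \<open>f \<zeta>\<close>, by the intermediate value theorem\<close>
      obtain \<zeta> where \<zeta>: "\<zeta> \<in> {x..y}" "F y - F x = G \<zeta> * (f y - f x)"
      proof -
        have "\<exists>c\<in>closed_segment (f x) (f y). N (f y) - N (f x) = \<mu> c * (f y - f x)"
        proof (cases "f x = f y")
          case True then show ?thesis by auto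
        next
          case False
          then consider "f x < f y" | "f y < f x" by linarith
          then show ?thesis
          proof cases
            case 1
            obtain c where "f x < c" "c < f y" "N (f y) - N (f x) = (f y - f x) * \<mu> c"
              using MVT2[OF 1, of N \<mu>] N by blast
            then show ?thesis using 1 by (intro bexI[of _ c]) (auto simp: closed_segment_eq_real_ivl)
          next
            case 2
            obtain c where "f y < c" "c < f x" "N (f x) - N (f y) = (f x - f y) * \<mu> c"
              using MVT2[OF 2, of N \<mu>] N by blast
            then show ?thesis using 2 by (intro bexI[of _ c]) (auto simp: closed_segment_eq_real_ivl algebra_simps)
          qed
        qed
        then obtain c where c: "c \<in> closed_segment (f x) (f y)" "N (f y) - N (f x) = \<mu> c * (f y - f x)" by blast
        have "connected (f ` {x..y})"
          by (rule connected_continuous_image[OF continuous_on_subset[OF f sub] connected_Icc])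
        then have "convex (f ` {x..y})" by (simp add: connected_convex_1)
        then have "closed_segment (f x) (f y) \<subseteq> f ` {x..y}"
          by (intro closed_segment_subset) (use xy in auto)
        with c obtain \<zeta> where "\<zeta> \<in> {x..y}" "c = f \<zeta>" by blast
        with c show ?thesis using that[of \<zeta>] by (simp add: F_def G_def)
      qed
      have ig: "g integrable_on {x..y}" "(\<lambda>z. \<bar>g z\<bar>) integrable_on {x..y}"
        using g set_integrable_subset[OF g _ sub] by (auto simp: absolutely_integrable_on_def)
      have i\<phi>: "\<phi>' integrable_on {x..y}" "(\<lambda>z. \<bar>\<phi>' z\<bar>) integrable_on {x..y}"
        using c\<phi>' by (auto intro!: integrable_continuous_real continuous_intros)
      have \<phi>xy: "\<phi> y - \<phi> x = integral {x..y} \<phi>'"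
        using fundamental_theorem_of_calculus[OF xy(2), of \<phi> \<phi>'] \<phi>
        by (metis has_field_derivative_at_within has_real_derivative_iff_has_vector_derivative integral_unique)
      have iA: "(\<lambda>z. G z * \<phi> z * g z) integrable_on {x..y}"
        using mult_abs[OF continuous_on_mult[OF cG c\<phi>] xy(1,3)] by (simp add: absolutely_integrable_on_def)
      have iB: "(\<lambda>z. F z * \<phi>' z) integrable_on {x..y}"
        using continuous_on_subset[OF cF sub] c\<phi>' by (intro integrable_continuous_real continuous_intros)
      have e1: "F y * \<phi> y - F x * \<phi> x - integral {x..y} (\<lambda>z. G z * \<phi> z * g z + F z * \<phi>' z)
         = integral {x..y} (\<lambda>z. (G \<zeta> * \<phi> y * g z - G z * \<phi> z * g z) + (F x * \<phi>' z - F z * \<phi>' z))"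
      proof -
        have "integral {x..y} (\<lambda>z. (G \<zeta> * \<phi> y * g z - G z * \<phi> z * g z) + (F x * \<phi>' z - F z * \<phi>' z))
          = (G \<zeta> * \<phi> y * integral {x..y} g - integral {x..y} (\<lambda>z. G z * \<phi> z * g z)) +
            (F x * integral {x..y} \<phi>' - integral {x..y} (\<lambda>z. F z * \<phi>' z))"
          by (intro integral_unique has_integral_add has_integral_diff has_integral_mult_right
              integrable_integral ig i\<phi> iA iB)
        moreover have "F y * \<phi> y - F x * \<phi> x = G \<zeta> * (f y - f x) * \<phi> y + F x * (\<phi> y - \<phi> x)"
          unfolding \<zeta>(2)[symmetric] by (simp add: algebra_simps)
        moreover have "integral {x..y} (\<lambda>z. G z * \<phi> z * g z + F z * \<phi>' z) =
           integral {x..y} (\<lambda>z. G z * \<phi> z * g z) + integral {x..y} (\<lambda>z. F z * \<phi>' z)"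
          by (rule Henstock_Kurzweil_Integration.integral_add[OF iA iB])
        ultimately show ?thesis using fg[OF xy(1-3)] \<phi>xy by (simp add: algebra_simps)
      qed
      have pw: "\<bar>(G \<zeta> * \<phi> y * g z - G z * \<phi> z * g z) + (F x * \<phi>' z - F z * \<phi>' z)\<bar>
          \<le> \<epsilon> * (\<bar>g z\<bar> + \<bar>\<phi>' z\<bar>)" if "z \<in> {x..y}" for z
      proof -
        have z: "z \<in> {a..b}" "\<zeta> \<in> {a..b}" "y \<in> {a..b}" "x \<in> {a..b}" using that \<zeta> sub xy by auto
        have "\<bar>G \<zeta> * \<phi> y - G z * \<phi> z\<bar> = \<bar>(G \<zeta> - G z) * \<phi> y + G z * (\<phi> y - \<phi> z)\<bar>" by (simp add: algebra_simps)
        also have "\<dots> \<le> \<bar>G \<zeta> - G z\<bar> * \<bar>\<phi> y\<bar> + \<bar>G z\<bar> * \<bar>\<phi> y - \<phi> z\<bar>"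
          by (metis abs_mult abs_triangle_ineq)
        also have "\<dots> \<le> \<delta> * C + C * \<delta>"
          using z C d1(2)[of z \<zeta>] d3(2)[of z y] that \<zeta> xy \<delta>(1)
          by (intro add_mono mult_mono) (auto simp: abs_less_iff abs_le_iff intro: less_imp_le)
        also have "\<dots> \<le> \<epsilon>" using \<delta> by simp
        finally have 1: "\<bar>G \<zeta> * \<phi> y - G z * \<phi> z\<bar> \<le> \<epsilon>" .
        have 2: "\<bar>F x - F z\<bar> \<le> \<epsilon>" using d2(2)[of z x] z that xy \<delta> by auto
        have "\<bar>(G \<zeta> * \<phi> y * g z - G z * \<phi> z * g z) + (F x * \<phi>' z - F z * \<phi>' z)\<bar>
          = \<bar>(G \<zeta> * \<phi> y - G z * \<phi> z) * g z + (F x - F z) * \<phi>' z\<bar>" by (simp add: algebra_simps)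
        also have "\<dots> \<le> \<bar>G \<zeta> * \<phi> y - G z * \<phi> z\<bar> * \<bar>g z\<bar> + \<bar>F x - F z\<bar> * \<bar>\<phi>' z\<bar>"
          by (metis abs_mult abs_triangle_ineq)
        also have "\<dots> \<le> \<epsilon> * \<bar>g z\<bar> + \<epsilon> * \<bar>\<phi>' z\<bar>"
          using 1 2 by (intro add_mono mult_right_mono) auto
        finally show ?thesis by (simp add: algebra_simps)
      qed
      have "\<bar>integral {x..y} (\<lambda>z. (G \<zeta> * \<phi> y * g z - G z * \<phi> z * g z) + (F x * \<phi>' z - F z * \<phi>' z))\<bar>
          \<le> integral {x..y} (\<lambda>z. \<epsilon> * (\<bar>g z\<bar> + \<bar>\<phi>' z\<bar>))"
        unfolding real_norm_def[symmetric]
        by (rule Henstock_Kurzweil_Integration.integral_norm_bound_integral)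
           (use pw ig i\<phi> iA iB in \<open>auto intro!: integrable_add integrable_diff integrable_on_mult_right\<close>)
      then show "\<bar>N (f y) * \<phi> y - N (f x) * \<phi> x - integral {x..y} (\<lambda>x. \<mu> (f x) * \<phi> x * g x + N (f x) * \<phi>' x)\<bar>
        \<le> \<epsilon> * integral {x..y} (\<lambda>x. \<bar>g x\<bar> + \<bar>\<phi>' x\<bar>)"
        using e1 by (simp add: F_def G_def)
    qed
  qed
qed

lemma Ls_loc_measurable_on:
  "Ls_loc s A f \<Longrightarrow> B \<subseteq> A \<Longrightarrow> f \<in> borel_measurable (lebesgue_on B)"
  unfolding Ls_loc_def by (elim conjE, rule measurable_restrict_mono)

lemma Ls_loc_1_integrable:
  assumes "Ls_loc 1 A f" "compact K" "K \<subseteq> A"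
  shows "integrable (lebesgue_on K) f"
proof (rule integrableI_bounded)
  show "f \<in> borel_measurable (lebesgue_on K)"
    by (rule Ls_loc_measurable_on[OF assms(1,3)])
  have "(\<integral>\<^sup>+x. ennreal (\<bar>f x\<bar> powr 1) \<partial>lebesgue_on K) < \<infinity>"
    using assms by (simp add: Ls_loc_def)
  then show "(\<integral>\<^sup>+x. ennreal (norm (f x)) \<partial>lebesgue_on K) < \<infinity>" by simp
qed

lemma smooth_step_deriv_eq_0:
  assumes "x \<notin> {0..1::real}"
  shows "deriv smooth_step x = 0"
proof -
  obtain c where c: "open c" "x \<in> c" "(\<forall>y\<in>c. smooth_step y = 0) \<or> (\<forall>y\<in>c. smooth_step y = 1)"
  proof (cases "x < 0")
    case True
    then show ?thesis using that[of "{..<0}"] smooth_step_eq_0 by auto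
  next
    case False
    then show ?thesis using that[of "{1<..}"] smooth_step_eq_1 assms by auto
  qed
  then obtain k where k: "\<And>y. y \<in> c \<Longrightarrow> k = smooth_step y" by metis
  have "((\<lambda>_. k) has_real_derivative 0) (at x)" by simp
  then have "(smooth_step has_real_derivative 0) (at x)"
    by (rule has_field_derivative_transform_within_open[OF _ c(1,2) k])
  then show ?thesis by (rule DERIV_imp_deriv)
qed

text \<open>The derivative of the step has integral 1 and is supported in the unit interval, so its
  rescalings form an approximate identity concentrated to the right of \<open>c\<close>.\<close>
lemma smooth_step_mollifies:
  assumes f: "continuous_on UNIV (f :: real \<Rightarrow> real)"
  shows "(\<lambda>n. LINT x|lebesgue. f x * (real (Suc n) * deriv smooth_step (real (Suc n) * (x - c)))) \<longlonglongrightarrow> f c"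
proof -
  let ?S' = "deriv smooth_step"
  have S: "(smooth_step has_real_derivative ?S' x) (at x)" for x
    using smooth_real_deriv(1)[OF smooth_smooth_step] .
  have cS: "continuous_on A ?S'" for A
    using smooth_continuous_on[OF smooth_real_deriv(2)[OF smooth_smooth_step]] .
  have S0: "?S' x = 0" if "x \<notin> {0..1}" for x
    by (rule smooth_step_deriv_eq_0) fact
  have cf: "continuous_on A f" for A using f continuous_on_subset by blast
  have [measurable]: "f \<in> borel_measurable borel" "?S' \<in> borel_measurable borel"
    using f cS by (auto intro: borel_measurable_continuous_onI)
  have eq: "(LINT x|lebesgue. f x * (real (Suc n) * ?S' (real (Suc n) * (x - c))))
      = (LINT s|lborel. f (c + s / real (Suc n)) * ?S' s)" for n
  proof -
    have "(LINT x|lebesgue. f x * (real (Suc n) * ?S' (real (Suc n) * (x - c)))) =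
      (LINT x|lborel. f x * (real (Suc n) * ?S' (real (Suc n) * (x - c))))"
      by (rule integral_completion) measurable
    also have "\<dots> = \<bar>1 / real (Suc n)\<bar> * (LINT s|lborel. f (c + (1 / real (Suc n)) * s) * (real (Suc n) * ?S' (real (Suc n) * ((c + (1 / real (Suc n)) * s) - c))))"
      by (subst lborel_integral_real_affine[where c="1 / real (Suc n)" and t=c]) simp_all
    also have "\<dots> = (LINT s|lborel. f (c + s / real (Suc n)) * ?S' s)"
      by (subst integral_mult_right_zero[symmetric]) (simp add: mult.left_commute)
    finally show ?thesis .
  qed
  have "bounded (f ` {c..c + 1} \<union> ?S' ` {0..1})"
    using compact_continuous_image[OF cf compact_Icc] compact_continuous_image[OF cS compact_Icc]
    by (simp add: compact_imp_bounded)
  then obtain C where C: "C > 0" "\<And>x. x \<in> {c..c + 1} \<Longrightarrow> \<bar>f x\<bar> \<le> C" "\<And>x. x \<in> {0..1} \<Longrightarrow> \<bar>?S' x\<bar> \<le> C"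
    unfolding bounded_pos by auto
  have "(\<lambda>n. LINT s|lborel. f (c + s / real (Suc n)) * ?S' s) \<longlonglongrightarrow> (LINT s|lborel. f c * ?S' s)"
  proof (rule integral_dominated_convergence[where w="\<lambda>s. C * C * indicator {0..1} s"])
    show "integrable lborel (\<lambda>s. C * C * indicator {0..1::real} s)"
      by (intro integrable_mult_right integrable_real_indicator) auto
    show "AE s in lborel. (\<lambda>n. f (c + s / real (Suc n)) * ?S' s) \<longlonglongrightarrow> f c * ?S' s"
    proof (intro AE_I2 tendsto_mult tendsto_const)
      fix s
      have "(\<lambda>n. c + s / real (Suc n)) \<longlonglongrightarrow> c + 0"
        by (intro tendsto_add tendsto_const LIMSEQ_Suc lim_const_over_n)
      moreover have "isCont f c" using f continuous_on_eq_continuous_at[OF open_UNIV] by blast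
      ultimately show "(\<lambda>n. f (c + s / real (Suc n))) \<longlonglongrightarrow> f c"
        using isCont_tendsto_compose by force
    qed
    fix n
    show "AE s in lborel. norm (f (c + s / real (Suc n)) * ?S' s) \<le> C * C * indicator {0..1} s"
    proof (rule AE_I2)
      fix s :: real
      show "norm (f (c + s / real (Suc n)) * ?S' s) \<le> C * C * indicator {0..1} s"
      proof (cases "s \<in> {0..1}")
        case True
        then have "c + s / real (Suc n) \<in> {c..c + 1}" by (auto simp: field_simps)
        with True C show ?thesis by (simp add: abs_mult mult_mono)
      qed (simp add: S0)
    qed
  qed measurable
  moreover have "(LINT s|lborel. f c * ?S' s) = f c"
  proof -
    have "(LINT s|lborel. ?S' s) = (LINT s|lborel. ?S' s * indicator {0..1} s)"
      by (rule Bochner_Integration.integral_cong) (simp_all add: S0 split: split_indicator)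
    also have "\<dots> = smooth_step 1 - smooth_step 0"
      by (rule integral_FTC_Icc_real) (use S cS continuous_on_eq_continuous_at[OF open_UNIV] in auto)
    finally show ?thesis by (simp add: smooth_step_eq_0 smooth_step_eq_1)
  qed
  ultimately show ?thesis by (simp only: eq)
qed

lemma weak_derivative_integrable:
  assumes "weak_derivative f g"
  shows "g absolutely_integrable_on {a..b}"
proof -
  have "Ls_loc 1 UNIV g" using assms by (simp add: weak_derivative_def)
  then have "integrable (lebesgue_on {a..b}) g" by (rule Ls_loc_1_integrable) simp_all
  then show ?thesis by (simp add: set_integrable_def integrable_restrict_space)
qed

text \<open>The lemma of du Bois-Reymond, for a continuous \<open>f\<close>: the differences of two steps, steepened
  around \<open>a\<close> and \<open>b\<close>, are test functions that converge to the indicator of \<open>{a<..b}\<close>, while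
  their derivatives converge to the difference of the point masses at \<open>a\<close> and \<open>b\<close>.\<close>
lemma weak_derivative_imp_increment_less:
  assumes f: "continuous_on UNIV f" and fg: "weak_derivative f g" and ab: "a < b"
  shows "f b - f a = integral {a..b} g"
proof -
  let ?S = smooth_step
  define \<phi> where "\<phi> n x = ?S (real (Suc n) * (x - a)) - ?S (real (Suc n) * (x - b))" for n x
  have S: "(?S has_real_derivative deriv ?S x) (at x)" for x
    using smooth_real_deriv(1)[OF smooth_smooth_step] .
  have d\<phi>: "deriv (\<phi> n) x = real (Suc n) * deriv ?S (real (Suc n) * (x - a)) - real (Suc n) * deriv ?S (real (Suc n) * (x - b))" for n x
  proof -
    have "((\<lambda>x. ?S (real (Suc n) * (x - c))) has_real_derivative deriv ?S (real (Suc n) * (x - c)) * real (Suc n)) (at x)" for c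
      by (rule DERIV_chain2[OF S]) (auto intro!: derivative_eq_intros)
    then have "(\<phi> n has_real_derivative deriv ?S (real (Suc n) * (x - a)) * real (Suc n) - deriv ?S (real (Suc n) * (x - b)) * real (Suc n)) (at x)"
      unfolding \<phi>_def by (intro DERIV_diff)
    from DERIV_imp_deriv[OF this] show ?thesis by (simp only: mult.commute)
  qed
  have smooth\<phi>: "smooth (\<phi> n)" for n
  proof -
    have "smooth (\<lambda>x. ?S (real (Suc n) * x + - (real (Suc n) * a)) - ?S (real (Suc n) * x + - (real (Suc n) * b)))"
      by (intro smooth_diff smooth_compose_real_affine smooth_smooth_step)
    then show ?thesis by (simp add: \<phi>_def[abs_def] right_diff_distrib)
  qed
  have supp: "\<phi> n x = 0" if "x \<notin> {a..b + 1}" for n x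
  proof (cases "x < a")
    case True
    then show ?thesis using ab by (simp add: \<phi>_def smooth_step_eq_0 mult_nonneg_nonpos)
  next
    case False
    with that have x: "1 \<le> x - b" "1 \<le> x - a" using ab by auto
    have "1 * 1 \<le> real (Suc n) * y" if "1 \<le> y" for y using that by (intro mult_mono) auto
    with x show ?thesis by (simp add: \<phi>_def smooth_step_eq_1)
  qed
  have test: "test_function UNIV (\<phi> n)" for n
    unfolding test_function_def using smooth\<phi> supp by (intro conjI exI[of _ "{a..b + 1}"]) auto
  have wd: "(LINT x|lebesgue. f x * deriv (\<phi> n) x) = - (LINT x|lebesgue. g x * \<phi> n x)" for n
    using fg test by (simp add: weak_derivative_def)
  have cS: "continuous_on A (deriv ?S)" for A
    using smooth_continuous_on[OF smooth_real_deriv(2)[OF smooth_smooth_step]] .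
  have S0: "deriv ?S x = 0" if "x \<notin> {0..1}" for x
    by (rule smooth_step_deriv_eq_0) fact
  have int: "integrable lebesgue (\<lambda>x. f x * (real (Suc n) * deriv ?S (real (Suc n) * (x - c))))" for n c
  proof -
    have "continuous_on {c..c + 1} (\<lambda>x. f x * (real (Suc n) * deriv ?S (real (Suc n) * (x - c))))"
      by (intro continuous_intros continuous_on_compose2[OF cS[of UNIV]] continuous_on_subset[OF f]) auto
    then have "set_integrable lborel {c..c + 1} (\<lambda>x. f x * (real (Suc n) * deriv ?S (real (Suc n) * (x - c))))"
      by (rule borel_integrable_atLeastAtMost')
    then have "integrable lebesgue (\<lambda>x. indicator {c..c + 1} x *\<^sub>R (f x * (real (Suc n) * deriv ?S (real (Suc n) * (x - c)))))"
      unfolding set_integrable_def by (subst integrable_completion) (auto dest: borel_measurable_integrable)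
    moreover have "(\<lambda>x. indicator {c..c + 1} x *\<^sub>R (f x * (real (Suc n) * deriv ?S (real (Suc n) * (x - c))))) =
       (\<lambda>x. f x * (real (Suc n) * deriv ?S (real (Suc n) * (x - c))))"
    proof
      fix x
      show "indicator {c..c + 1} x *\<^sub>R (f x * (real (Suc n) * deriv ?S (real (Suc n) * (x - c)))) =
       f x * (real (Suc n) * deriv ?S (real (Suc n) * (x - c)))"
      proof (cases "x \<in> {c..c + 1}")
        case False
        have "real (Suc n) * (x - c) \<notin> {0..1}"
        proof (cases "x < c")
          case True
          then have "real (Suc n) * (x - c) < 0" by (intro mult_pos_neg) auto
          then show ?thesis by simp
        next
          case 2: False
          then have "1 < x - c" using False by auto
          then have "1 * 1 < real (Suc n) * (x - c)" by (intro mult_le_less_imp_less) auto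
          then show ?thesis by simp
        qed
        then show ?thesis by (simp add: S0)
      qed simp
    qed
    ultimately show ?thesis by simp
  qed
  have lim_f: "(\<lambda>n. LINT x|lebesgue. f x * deriv (\<phi> n) x) \<longlonglongrightarrow> f a - f b"
    using tendsto_diff[OF smooth_step_mollifies[OF f, of a] smooth_step_mollifies[OF f, of b]] int
    by (simp only: d\<phi> right_diff_distrib Bochner_Integration.integral_diff)
  have "(\<lambda>n. LINT x|lebesgue. g x * \<phi> n x) \<longlonglongrightarrow> (LINT x|lebesgue. g x * indicator {a<..b} x)"
  proof (rule integral_dominated_convergence[where w="\<lambda>x. indicator {a..b + 1} x *\<^sub>R \<bar>g x\<bar>"])
    have gm: "g \<in> borel_measurable lebesgue"
      using fg by (simp add: weak_derivative_def Ls_loc_def lebesgue_on_UNIV_eq)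
    then show "(\<lambda>x. g x * indicator {a<..b} x) \<in> borel_measurable lebesgue"
      by (intro borel_measurable_times borel_measurable_indicator) auto
    show "(\<lambda>x. g x * \<phi> n x) \<in> borel_measurable lebesgue" for n
    proof (rule borel_measurable_times[OF gm])
      have "\<phi> n \<in> borel_measurable borel"
        using smooth_continuous_on[OF smooth\<phi>] by (rule borel_measurable_continuous_onI)
      then show "\<phi> n \<in> borel_measurable lebesgue" by (simp add: measurable_completion)
    qed
    show "integrable lebesgue (\<lambda>x. indicator {a..b + 1} x *\<^sub>R \<bar>g x\<bar>)"
      using weak_derivative_integrable[OF fg, of a "b + 1", THEN set_integrable_abs]
      by (simp add: set_integrable_def)
    show "AE x in lebesgue. (\<lambda>n. g x * \<phi> n x) \<longlonglongrightarrow> g x * indicator {a<..b} x"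
    proof (intro AE_I2 tendsto_mult tendsto_const)
      fix x
      have ev: "\<forall>\<^sub>F n in sequentially. ?S (real (Suc n) * y) = (if y \<le> 0 then 0 else 1)" for y
      proof (cases "y \<le> 0")
        case True
        then show ?thesis by (simp add: smooth_step_eq_0 mult_nonneg_nonpos)
      next
        case False
        obtain N where N: "1 / y < real N" using reals_Archimedean2 by blast
        have "1 \<le> real (Suc n) * y" if "n \<ge> N" for n
        proof -
          have "1 / y \<le> real (Suc n)" using N that by simp
          then show ?thesis using False by (simp add: field_simps)
        qed
        then show ?thesis
          using False by (auto simp: eventually_sequentially intro!: exI[of _ N] smooth_step_eq_1)
      qed
      show "(\<lambda>n. \<phi> n x) \<longlonglongrightarrow> indicator {a<..b} x"
        by (rule tendsto_eventually, rule eventually_mono[OF eventually_conj[OF ev[of "x - a"] ev[of "x - b"]]])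
           (use ab in \<open>auto simp: \<phi>_def indicator_def\<close>)
    qed
    fix n
    show "AE x in lebesgue. norm (g x * \<phi> n x) \<le> indicator {a..b + 1} x *\<^sub>R \<bar>g x\<bar>"
    proof (rule AE_I2)
      fix x
      have "\<bar>\<phi> n x\<bar> \<le> 1"
        using smooth_step_bounds[of "real (Suc n) * (x - a)"] smooth_step_bounds[of "real (Suc n) * (x - b)"]
        unfolding \<phi>_def by linarith
      then have "\<bar>g x\<bar> * \<bar>\<phi> n x\<bar> \<le> \<bar>g x\<bar> * 1" by (intro mult_left_mono) auto
      then show "norm (g x * \<phi> n x) \<le> indicator {a..b + 1} x *\<^sub>R \<bar>g x\<bar>"
        by (cases "x \<in> {a..b + 1}") (auto simp: abs_mult supp)
    qed
  qed
  from LIMSEQ_unique[OF lim_f[unfolded wd] tendsto_minus[OF this]]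
  have "f a - f b = - (LINT x|lebesgue. g x * indicator {a<..b} x)" .
  moreover have "(LINT x|lebesgue. g x * indicator {a<..b} x) = (LINT x|lebesgue. indicator {a..b} x *\<^sub>R g x)"
  proof (rule integral_cong_AE)
    have gm: "g \<in> borel_measurable lebesgue"
      using fg by (simp add: weak_derivative_def Ls_loc_def lebesgue_on_UNIV_eq)
    then show "(\<lambda>x. g x * indicator {a<..b} x) \<in> borel_measurable lebesgue"
      by (intro borel_measurable_times borel_measurable_indicator) auto
    show "(\<lambda>x. indicator {a..b} x *\<^sub>R g x) \<in> borel_measurable lebesgue"
      using gm by (intro borel_measurable_scaleR borel_measurable_indicator) auto
    have "AE x in lebesgue. x \<noteq> a" by (rule AE_completion[OF AE_lborel_singleton])
    then show "AE x in lebesgue. g x * indicator {a<..b} x = indicator {a..b} x *\<^sub>R g x"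
      by eventually_elim (auto simp: indicator_def)
  qed
  moreover have "(LINT x|lebesgue. indicator {a..b} x *\<^sub>R g x) = integral {a..b} g"
    using set_lebesgue_integral_eq_integral(2)[OF weak_derivative_integrable[OF fg, of a b]]
    by (simp add: set_lebesgue_integral_def)
  ultimately show ?thesis by simp
qed

lemma weak_derivative_imp_increment:
  assumes "continuous_on UNIV f" "weak_derivative f g" "a \<le> b"
  shows "f b - f a = integral {a..b} g"
  using weak_derivative_imp_increment_less[OF assms(1,2), of a b] assms(3) by (cases "a = b") auto

text \<open>The chain rule \<open>\<partial>\<^sub>\<xi> N(f) = \<mu>(f) \<partial>\<^sub>\<xi> f\<close> in the weak sense, which turns the limit of the
  discrete Laplacian of \<open>N(p)\<close> into the entropy flux.\<close>
lemma weak_chain_rule: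
  fixes f g N \<mu> \<phi> \<phi>' :: "real \<Rightarrow> real"
  assumes f: "continuous_on UNIV f" and fg: "weak_derivative f g"
    and N: "\<And>x. (N has_real_derivative \<mu> x) (at x)" and \<mu>: "continuous_on UNIV \<mu>"
    and \<phi>: "\<And>x. (\<phi> has_real_derivative \<phi>' x) (at x)" and \<phi>': "continuous_on UNIV \<phi>'"
    and supp: "\<And>x. x \<notin> {a<..<b} \<Longrightarrow> \<phi> x = 0" "\<And>x. x \<notin> {a<..<b} \<Longrightarrow> \<phi>' x = 0" and ab: "a \<le> b"
  shows "(LINT x|lebesgue. N (f x) * \<phi>' x) = - (LINT x|lebesgue. \<mu> (f x) * g x * \<phi> x)"
proof -
  have chain: "(\<lambda>x. \<mu> (f x) * \<phi> x * g x) absolutely_integrable_on {a..b}"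
    "N (f b) * \<phi> b - N (f a) * \<phi> a = integral {a..b} (\<lambda>x. \<mu> (f x) * \<phi> x * g x + N (f x) * \<phi>' x)"
    by (rule chain_rule_increment[OF ab continuous_on_subset[OF f subset_UNIV]
          weak_derivative_integrable[OF fg] weak_derivative_imp_increment[OF f fg] N \<mu> \<phi> \<phi>'], assumption)+
  have supp': "\<phi> x = 0" "\<phi>' x = 0" if "x \<notin> {a..b}" for x
    by (rule supp, use that in auto)+
  have cN: "continuous_on UNIV N" using N DERIV_isCont by (blast intro: continuous_at_imp_continuous_on)
  have A2: "(\<lambda>x. N (f x) * \<phi>' x) absolutely_integrable_on {a..b}"
    by (intro absolutely_integrable_continuous_real continuous_intros continuous_on_compose2[OF cN continuous_on_subset[OF f]]
        continuous_on_subset[OF \<phi>']) auto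
  have "(LINT x|lebesgue. N (f x) * \<phi>' x) = integral {a..b} (\<lambda>x. N (f x) * \<phi>' x)"
    unfolding set_lebesgue_integral_eq_integral(2)[OF A2, symmetric] set_lebesgue_integral_def
    by (rule Bochner_Integration.integral_cong) (simp_all add: supp' split: split_indicator)
  moreover have "(LINT x|lebesgue. \<mu> (f x) * g x * \<phi> x) = integral {a..b} (\<lambda>x. \<mu> (f x) * \<phi> x * g x)"
    unfolding set_lebesgue_integral_eq_integral(2)[OF chain(1), symmetric] set_lebesgue_integral_def
    by (rule Bochner_Integration.integral_cong) (simp_all add: supp' split: split_indicator)
  moreover have "integral {a..b} (\<lambda>x. \<mu> (f x) * \<phi> x * g x + N (f x) * \<phi>' x) =
      integral {a..b} (\<lambda>x. \<mu> (f x) * \<phi> x * g x) + integral {a..b} (\<lambda>x. N (f x) * \<phi>' x)"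
    using chain(1) A2 by (intro Henstock_Kurzweil_Integration.integral_add) (auto simp: absolutely_integrable_on_def)
  ultimately show ?thesis using chain(2) supp by simp
qed

section \<open>Differentiability of monotone Lipschitz functions\<close>

text \<open>Vitali's covering theorem, restated for intervals that have the point \<open>x\<close> as one of their
  end points and that satisfy a condition \<open>Q\<close> at arbitrarily small scales.\<close>
lemma vitali_intervals:
  fixes E V :: "real set" and Q :: "real \<Rightarrow> real \<Rightarrow> bool"
  assumes V: "open V" "E \<subseteq> V"
    and near: "\<And>x d. x \<in> E \<Longrightarrow> 0 < d \<Longrightarrow> \<exists>y. y \<noteq> x \<and> \<bar>y - x\<bar> < d \<and> Q (min x y) (max x y)"
  obtains C :: "(real \<times> real) set" where "countable C"
    "\<And>p q. (p, q) \<in> C \<Longrightarrow> p < q \<and> {p..q} \<subseteq> V \<and> Q p q"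
    "disjoint_family_on (\<lambda>(p, q). {p..q}) C"
    "negligible (E - (\<Union>(p, q)\<in>C. {p..q}))"
proof -
  define K where "K = {(p, q). p < q \<and> {p..q} \<subseteq> V \<and> Q p q}"
  define c where "c = (\<lambda>(p, q). (p + q) / 2 :: real)"
  define \<rho> where "\<rho> = (\<lambda>(p, q). (q - p) / 2 :: real)"
  have cb: "cball (c i) (\<rho> i) = (case i of (p, q) \<Rightarrow> {p..q})" for i
    by (cases i) (auto simp: c_def \<rho>_def cball_def dist_real_def field_simps abs_le_iff)
  obtain C where C: "countable C" "C \<subseteq> K"
    "pairwise (\<lambda>i j. disjnt (cball (c i) (\<rho> i)) (cball (c j) (\<rho> j))) C"
    "negligible (E - (\<Union>i\<in>C. cball (c i) (\<rho> i)))"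
  proof (rule Vitali_covering_theorem_cballs[of K \<rho> E c])
    show "0 < \<rho> i" if "i \<in> K" for i using that by (auto simp: K_def \<rho>_def)
    fix x d :: real assume x: "x \<in> E" "0 < d"
    obtain e where e: "e > 0" "ball x e \<subseteq> V" using V x open_contains_ball by blast
    obtain y where y: "y \<noteq> x" "\<bar>y - x\<bar> < min d e" "Q (min x y) (max x y)"
      using near[of x "min d e"] x e by auto
    have "{min x y..max x y} \<subseteq> ball x e" using y by (auto simp: dist_real_def)
    then have "(min x y, max x y) \<in> K" using y e by (auto simp: K_def)
    moreover have "x \<in> cball (c (min x y, max x y)) (\<rho> (min x y, max x y))" by (simp add: cb)
    moreover have "\<rho> (min x y, max x y) < d" using y x by (auto simp: \<rho>_def min_def max_def abs_if split: if_splits)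
    ultimately show "\<exists>i. i \<in> K \<and> x \<in> cball (c i) (\<rho> i) \<and> \<rho> i < d" by blast
  qed
  show thesis
  proof (rule that[OF C(1)])
    show "p < q \<and> {p..q} \<subseteq> V \<and> Q p q" if "(p, q) \<in> C" for p q using that C(2) by (auto simp: K_def)
    show "disjoint_family_on (\<lambda>(p, q). {p..q}) C"
      using C(3) by (simp add: disjoint_family_on_def pairwise_def disjnt_def cb)
    show "negligible (E - (\<Union>(p, q)\<in>C. {p..q}))" using C(4) by (simp add: cb)
  qed
qed

text \<open>Both sides are sums over the disjoint intervals: the Stieltjes measure of \<open>{p..q}\<close> is
  \<open>F q - F p\<close> by continuity, its Lebesgue measure is \<open>q - p\<close>.\<close>
lemma interval_family_measure:
  fixes C :: "(real \<times> real) set"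
  assumes F: "mono F" "\<And>x. isCont F x" and C: "countable C" "disjoint_family_on (\<lambda>(p, q). {p..q}) C"
    and pq: "\<And>p q. (p, q) \<in> C \<Longrightarrow> p < q"
  shows "\<lbrakk>\<And>p q. (p, q) \<in> C \<Longrightarrow> F q - F p \<le> r * (q - p); 0 \<le> r\<rbrakk> \<Longrightarrow>
      emeasure (interval_measure F) (\<Union>(p, q)\<in>C. {p..q}) \<le> ennreal r * emeasure lborel (\<Union>(p, q)\<in>C. {p..q})"
    and "\<lbrakk>\<And>p q. (p, q) \<in> C \<Longrightarrow> s * (q - p) \<le> F q - F p; 0 \<le> s\<rbrakk> \<Longrightarrow>
      ennreal s * emeasure lborel (\<Union>(p, q)\<in>C. {p..q}) \<le> emeasure (interval_measure F) (\<Union>(p, q)\<in>C. {p..q})"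
proof -
  have 1: "emeasure (interval_measure F) (\<Union>(p, q)\<in>C. {p..q}) =
      (\<integral>\<^sup>+i. ennreal (F (snd i) - F (fst i)) \<partial>count_space C)"
  proof -
    have "emeasure (interval_measure F) (\<Union>i\<in>C. case i of (p, q) \<Rightarrow> {p..q}) =
       (\<integral>\<^sup>+i. emeasure (interval_measure F) (case i of (p, q) \<Rightarrow> {p..q}) \<partial>count_space C)"
      using C by (intro emeasure_UN_countable) auto
    also have "\<dots> = (\<integral>\<^sup>+i. ennreal (F (snd i) - F (fst i)) \<partial>count_space C)"
    proof (rule nn_integral_cong)
      fix i assume "i \<in> space (count_space C)"
      then have "fst i < snd i" using pq[of "fst i" "snd i"] by simp
      then show "emeasure (interval_measure F) (case i of (p, q) \<Rightarrow> {p..q}) = ennreal (F (snd i) - F (fst i))"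
        using F by (simp add: case_prod_beta, intro emeasure_interval_measure_Icc)
          (auto simp: monoD continuous_at_imp_continuous_on)
    qed
    finally show ?thesis .
  qed
  have 2: "emeasure lborel (\<Union>(p, q)\<in>C. {p..q}) = (\<integral>\<^sup>+i. ennreal (snd i - fst i) \<partial>count_space C)"
  proof -
    have "emeasure lborel (\<Union>i\<in>C. case i of (p, q) \<Rightarrow> {p..q}) =
       (\<integral>\<^sup>+i. emeasure lborel (case i of (p, q) \<Rightarrow> {p..q}) \<partial>count_space C)"
      using C by (intro emeasure_UN_countable) auto
    also have "\<dots> = (\<integral>\<^sup>+i. ennreal (snd i - fst i) \<partial>count_space C)"
    proof (rule nn_integral_cong)
      fix i assume "i \<in> space (count_space C)"
      then have "fst i < snd i" using pq[of "fst i" "snd i"] by simp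
      then show "emeasure lborel (case i of (p, q) \<Rightarrow> {p..q}) = ennreal (snd i - fst i)"
        by (simp add: case_prod_beta)
    qed
    finally show ?thesis .
  qed
  have mult: "ennreal k * (\<integral>\<^sup>+i. ennreal (snd i - fst i) \<partial>count_space C) =
      (\<integral>\<^sup>+i. ennreal (k * (snd i - fst i)) \<partial>count_space C)" if "0 \<le> k" for k
  proof -
    have "ennreal k * (\<integral>\<^sup>+i. ennreal (snd i - fst i) \<partial>count_space C) =
       (\<integral>\<^sup>+i. ennreal k * ennreal (snd i - fst i) \<partial>count_space C)"
      by (rule nn_integral_cmult[symmetric]) simp
    also have "\<dots> = (\<integral>\<^sup>+i. ennreal (k * (snd i - fst i)) \<partial>count_space C)"
    proof (rule nn_integral_cong)
      fix i assume "i \<in> space (count_space C)"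
      then have "fst i < snd i" using pq[of "fst i" "snd i"] by simp
      then show "ennreal k * ennreal (snd i - fst i) = ennreal (k * (snd i - fst i))"
        using that by (intro ennreal_mult[symmetric]) auto
    qed
    finally show ?thesis .
  qed
  show "emeasure (interval_measure F) (\<Union>(p, q)\<in>C. {p..q}) \<le> ennreal r * emeasure lborel (\<Union>(p, q)\<in>C. {p..q})"
    if "\<And>p q. (p, q) \<in> C \<Longrightarrow> F q - F p \<le> r * (q - p)" "0 \<le> r"
    unfolding 1 2 mult[OF that(2)] by (intro nn_integral_mono ennreal_leI) (use that(1) in auto)
  show "ennreal s * emeasure lborel (\<Union>(p, q)\<in>C. {p..q}) \<le> emeasure (interval_measure F) (\<Union>(p, q)\<in>C. {p..q})"
    if "\<And>p q. (p, q) \<in> C \<Longrightarrow> s * (q - p) \<le> F q - F p" "0 \<le> s"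
    unfolding 1 2 mult[OF that(2)] by (intro nn_integral_mono ennreal_leI) (use that(1) in auto)
qed

lemma difference_quotient_swap:
  fixes F :: "real \<Rightarrow> real"
  assumes "y \<noteq> x"
  shows "(F (max x y) - F (min x y)) = ((F y - F x) / (y - x)) * (max x y - min x y)"
  using assms by (auto simp: min_def max_def field_simps)

text \<open>Lebesgue's argument with two nested Vitali coverings. Choose an open \<open>V\<close> that contains \<open>E\<close> and
  is hardly larger. Intervals of slope at most \<open>r\<close> inside \<open>V\<close> cover almost all of \<open>E\<close>; inside
  their union, intervals of slope at least \<open>s\<close> still cover almost all of \<open>E\<close>. Monotonicity of the
  Stieltjes measure then gives \<open>s \<bar>E\<bar> \<le> r \<bar>V\<bar>\<close>, and \<open>r < s\<close> forces \<open>\<bar>E\<bar> = 0\<close>.\<close>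
lemma dini_gap_negligible:
  fixes F :: "real \<Rightarrow> real"
  assumes F: "mono F" "\<And>x. isCont F x" and rs: "0 \<le> r" "r < s"
    and E: "E \<in> sets borel" "bounded E"
    and low: "\<And>x d. x \<in> E \<Longrightarrow> 0 < d \<Longrightarrow> \<exists>y. y \<noteq> x \<and> \<bar>y - x\<bar> < d \<and> (F y - F x) / (y - x) < r"
    and high: "\<And>x d. x \<in> E \<Longrightarrow> 0 < d \<Longrightarrow> \<exists>y. y \<noteq> x \<and> \<bar>y - x\<bar> < d \<and> s < (F y - F x) / (y - x)"
  shows "negligible E"
proof -
  have El: "E \<in> sets lebesgue" using E(1) by simp
  have Em: "E \<in> lmeasurable" using E El by (simp add: bounded_set_imp_lmeasurable)
  let ?m = "measure lebesgue E"
  have main: "s * ?m \<le> r * (?m + \<epsilon>)" if "0 < \<epsilon>" for \<epsilon>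
  proof -
    obtain V where V: "open V" "E \<subseteq> V" "V \<in> lmeasurable" "measure lebesgue V < ?m + \<epsilon>"
    proof -
      obtain V where V: "open V" "E \<subseteq> V" "V - E \<in> lmeasurable" "emeasure lebesgue (V - E) < ennreal \<epsilon>"
        using sets_lebesgue_outer_open[OF El \<open>0 < \<epsilon>\<close>] by metis
      have VE: "V = E \<union> (V - E)" using V(2) by blast
      have "V \<in> lmeasurable" using fmeasurable.Un[OF Em V(3)] VE by simp
      moreover have "measure lebesgue (V - E) < \<epsilon>"
        using V(3,4) \<open>0 < \<epsilon>\<close> by (simp add: emeasure_eq_measure2 ennreal_less_iff)
      then have "measure lebesgue V < ?m + \<epsilon>"
        using measure_Un_le[of E lebesgue "V - E"] El V(3) VE by (simp add: fmeasurableD)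
      ultimately show ?thesis using that[of V] V by blast
    qed
    obtain C where C: "countable C" "\<And>p q. (p, q) \<in> C \<Longrightarrow> p < q \<and> {p..q} \<subseteq> V \<and> F q - F p \<le> r * (q - p)"
      "disjoint_family_on (\<lambda>(p, q). {p..q}) C" "negligible (E - (\<Union>(p, q)\<in>C. {p..q}))"
    proof (rule vitali_intervals[OF V(1,2), of "\<lambda>p q. F q - F p \<le> r * (q - p)"])
      fix x d :: real assume "x \<in> E" "0 < d"
      from low[OF this] obtain y where y: "y \<noteq> x" "\<bar>y - x\<bar> < d" "(F y - F x) / (y - x) < r" by blast
      have "F (max x y) - F (min x y) \<le> r * (max x y - min x y)"
        unfolding difference_quotient_swap[OF y(1)] using y by (intro mult_right_mono) auto
      with y show "\<exists>y. y \<noteq> x \<and> \<bar>y - x\<bar> < d \<and> F (max x y) - F (min x y) \<le> r * (max x y - min x y)" by blast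
    qed (rule that)
    let ?A = "\<Union>(p, q)\<in>C. {p..q}"
    \<comment> \<open>open intervals, so that the second covering can be carried out inside \<open>W\<close>; only countably many end points are lost\<close>
    define W where "W = (\<Union>(p, q)\<in>C. {p<..<q})"
    have W: "open W" unfolding W_def by auto
    have WI: "x \<in> W" if "(p, q) \<in> C" "p < x" "x < q" for x p q
      unfolding W_def using that by (intro UN_I[of "(p, q)"]) auto
    have WA: "W \<subseteq> ?A"
    proof
      fix x assume "x \<in> W"
      then obtain p q where "(p, q) \<in> C" "p < x" "x < q" by (auto simp: W_def)
      then show "x \<in> ?A" by (intro UN_I[of "(p, q)"]) auto
    qed
    have negW: "negligible (E - W)"
    proof (rule negligible_subset)
      have "countable (fst ` C \<union> snd ` C)" using C(1) by simp
      then show "negligible ((E - ?A) \<union> (fst ` C \<union> snd ` C))"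
        using C(4) by (intro negligible_Un)
          (auto simp: negligible_iff_null_sets intro!: null_sets_completionI countable_imp_null_set_lborel)
      show "E - W \<subseteq> (E - ?A) \<union> (fst ` C \<union> snd ` C)"
      proof
        fix x assume x: "x \<in> E - W"
        show "x \<in> (E - ?A) \<union> (fst ` C \<union> snd ` C)"
        proof (cases "x \<in> ?A")
          case True
          then obtain p q where pq: "(p, q) \<in> C" "p \<le> x" "x \<le> q" by auto
          have "\<not> (p < x \<and> x < q)" using WI[OF pq(1)] x by blast
          then have "x = p \<or> x = q" using pq by linarith
          then have "x \<in> fst ` C \<union> snd ` C" using pq(1) by (metis UnI1 UnI2 fst_conv snd_conv image_eqI)
          then show ?thesis by simp
        qed (use x in auto)
      qed
    qed
    obtain D where D: "countable D" "\<And>p q. (p, q) \<in> D \<Longrightarrow> p < q \<and> {p..q} \<subseteq> W \<and> s * (q - p) \<le> F q - F p"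
      "disjoint_family_on (\<lambda>(p, q). {p..q}) D" "negligible (E \<inter> W - (\<Union>(p, q)\<in>D. {p..q}))"
    proof (rule vitali_intervals[OF W Int_lower2[of E W], of "\<lambda>p q. s * (q - p) \<le> F q - F p"])
      fix x d :: real assume "x \<in> E \<inter> W" "0 < d"
      then obtain y where y: "y \<noteq> x" "\<bar>y - x\<bar> < d" "s < (F y - F x) / (y - x)" using high by blast
      have "s * (max x y - min x y) \<le> F (max x y) - F (min x y)"
        unfolding difference_quotient_swap[OF y(1)] using y by (intro mult_right_mono) auto
      with y show "\<exists>y. y \<noteq> x \<and> \<bar>y - x\<bar> < d \<and> s * (max x y - min x y) \<le> F (max x y) - F (min x y)" by blast
    qed (rule that)
    let ?B = "\<Union>(p, q)\<in>D. {p..q}"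
    have meas: "?A \<in> sets borel" "?B \<in> sets borel" using C(1) D(1) by (auto intro!: sets.countable_UN')
    have "?B \<subseteq> W" using D(2) by (intro UN_least) auto
    then have BA: "?B \<subseteq> ?A" using WA by simp
    have AV: "?A \<subseteq> V" using C(2) by (intro UN_least) auto
    have "negligible ((E - W) \<union> (E \<inter> W - ?B))" using negW D(4) by simp
    then have negB: "negligible (E - ?B)" by (rule negligible_subset) auto
    have "ennreal s * emeasure lebesgue E \<le> ennreal s * emeasure lborel ?B"
    proof (rule mult_left_mono)
      have "emeasure lebesgue E \<le> emeasure lebesgue (?B \<union> (E - ?B))"
        using El negB meas by (intro emeasure_mono) (auto simp: negligible_iff_null_sets)
      also have "\<dots> = emeasure lebesgue ?B"
        using negB meas by (intro emeasure_Un_null_set) (auto simp: negligible_iff_null_sets)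
      finally show "emeasure lebesgue E \<le> emeasure lborel ?B" using meas by simp
    qed simp
    also have "\<dots> \<le> emeasure (interval_measure F) ?B"
      by (rule interval_family_measure(2)[OF F D(1,3)]) (use D(2) rs in auto)
    also have "\<dots> \<le> emeasure (interval_measure F) ?A"
      using BA meas by (intro emeasure_mono) auto
    also have "\<dots> \<le> ennreal r * emeasure lborel ?A"
      by (rule interval_family_measure(1)[OF F C(1,3)]) (use C(2) rs in auto)
    also have "\<dots> \<le> ennreal r * emeasure lebesgue V"
      using AV meas V(1) by (intro mult_left_mono) (auto intro: emeasure_mono)
    finally have "ennreal s * emeasure lebesgue E \<le> ennreal r * emeasure lebesgue V" .
    then have "s * ?m \<le> r * measure lebesgue V"
      using Em V(3) rs by (simp add: emeasure_eq_measure2 ennreal_mult[symmetric])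
    also have "\<dots> \<le> r * (?m + \<epsilon>)" using V(4) rs by (intro mult_left_mono) auto
    finally show ?thesis .
  qed
  have "?m = 0"
  proof (rule ccontr)
    assume "?m \<noteq> 0"
    then have m: "0 < ?m" by (simp add: zero_less_measure_iff)
    define \<epsilon> where "\<epsilon> = (s - r) * ?m / (2 * (r + 1))"
    have "0 < \<epsilon>" using m rs by (simp add: \<epsilon>_def)
    have "(s - r) * ?m \<le> r * \<epsilon>" using main[OF \<open>0 < \<epsilon>\<close>] by (simp add: algebra_simps)
    also have "\<dots> \<le> (r + 1) * \<epsilon>" using \<open>0 < \<epsilon>\<close> by (intro mult_right_mono) auto
    also have "\<dots> = (s - r) * ?m / 2" using rs by (simp add: \<epsilon>_def field_simps)
    finally show False using m rs by simp
  qed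
  then show ?thesis using Em by (simp add: negligible_iff_measure)
qed

text \<open>Rational increments suffice by continuity. They make the exceptional sets of the next theorem
  countable combinations of Borel sets.\<close>
lemma rational_difference_quotient:
  fixes F :: "real \<Rightarrow> real"
  assumes F: "\<And>x. isCont F x" and A: "open A"
    and fr: "\<exists>\<^sub>F h in at 0. (F (x + h) - F x) / h \<in> A" and d: "0 < d"
  shows "\<exists>k::rat. of_rat k \<noteq> (0::real) \<and> \<bar>of_rat k\<bar> < (d::real) \<and> (F (x + of_rat k) - F x) / of_rat k \<in> A"
proof -
  obtain h where h: "h \<noteq> 0" "\<bar>h\<bar> < d" "(F (x + h) - F x) / h \<in> A"
    using fr d unfolding frequently_at by (auto simp: dist_real_def)
  have "isCont (\<lambda>h. (F (x + h) - F x) / h) h"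
    using h by (intro continuous_intros isCont_o2[OF _ F]) auto
  then have "\<forall>\<^sub>F k in at h. (F (x + k) - F x) / k \<in> A"
    using h(3) A by (simp add: isCont_def tendsto_def)
  then have "\<forall>\<^sub>F k in nhds h. (F (x + k) - F x) / k \<in> A"
    using h(3) by (simp add: eventually_nhds_conv_at)
  moreover have "\<forall>\<^sub>F k in nhds h. k \<noteq> 0" by (rule t1_space_nhds) fact
  moreover have "\<forall>\<^sub>F k in nhds h. k \<in> {-d<..<d}"
    by (rule eventually_nhds_in_open) (use h in auto)
  ultimately have "\<forall>\<^sub>F k in nhds h. (F (x + k) - F x) / k \<in> A \<and> k \<noteq> 0 \<and> k \<in> {-d<..<d}"
    by (intro eventually_conj)
  then obtain e where e: "e > 0" "\<And>k. dist k h < e \<Longrightarrow> (F (x + k) - F x) / k \<in> A \<and> k \<noteq> 0 \<and> k \<in> {-d<..<d}"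
    unfolding eventually_nhds_metric by blast
  obtain k where k: "k \<in> \<rat>" "h < k" "k < h + e" using Rats_dense_in_real[of h "h + e"] e by auto
  then obtain q where q: "k = of_rat q" by (auto elim: Rats_cases)
  have "dist k h < e" using k by (simp add: dist_real_def)
  from e(2)[OF this] have "k \<noteq> 0 \<and> \<bar>k\<bar> < d \<and> (F (x + k) - F x) / k \<in> A" by auto
  then show ?thesis unfolding q by blast
qed

text \<open>The difference quotients lie in \<open>[0, L]\<close>, so differentiability fails at \<open>x\<close> only if their lower
  and upper limits are separated by two rationals \<open>r < s\<close>. Each pair of rationals contributes a
  negligible set.\<close>
theorem mono_lipschitz_differentiable_AE:
  fixes F :: "real \<Rightarrow> real"
  assumes mono: "mono F" and lip: "L-lipschitz_on UNIV F"
  shows "AE x in lebesgue. F differentiable at x"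
proof -
  have cont: "isCont F x" for x
    using lipschitz_on_continuous_on[OF lip] continuous_on_eq_continuous_at[OF open_UNIV] by blast
  have [measurable]: "F \<in> borel_measurable borel"
    using lipschitz_on_continuous_on[OF lip] by (rule borel_measurable_continuous_onI)
  define dq where "dq x h = (F (x + h) - F x) / h" for x h :: real
  define E where "E r s N = {x. \<bar>x\<bar> < real N \<and>
      (\<forall>n. \<exists>k::rat. of_rat k \<noteq> (0::real) \<and> \<bar>of_rat k\<bar> < 1 / real (Suc n) \<and> dq x (of_rat k) < r) \<and>
      (\<forall>n. \<exists>k::rat. of_rat k \<noteq> (0::real) \<and> \<bar>of_rat k\<bar> < 1 / real (Suc n) \<and> s < dq x (of_rat k))}" for r s :: real and N
  have negE: "negligible (E r s N)" if "0 \<le> r" "r < s" for r s N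
  proof (rule dini_gap_negligible[OF mono cont that])
    show "E r s N \<in> sets borel" unfolding E_def dq_def by measurable
    show "bounded (E r s N)" unfolding bounded_iff by (rule exI[of _ "real N"]) (auto simp: E_def)
    fix x d :: real assume x: "x \<in> E r s N" and "0 < d"
    obtain n where n: "1 / real (Suc n) < d" using \<open>0 < d\<close> nat_approx_posE by blast
    obtain k where k: "of_rat k \<noteq> (0::real)" "\<bar>of_rat k\<bar> < 1 / real (Suc n)" "dq x (of_rat k) < r"
      using x by (auto simp: E_def)
    show "\<exists>y. y \<noteq> x \<and> \<bar>y - x\<bar> < d \<and> (F y - F x) / (y - x) < r"
      using k n by (intro exI[of _ "x + of_rat k"]) (auto simp: dq_def)
    obtain k where k: "of_rat k \<noteq> (0::real)" "\<bar>of_rat k\<bar> < 1 / real (Suc n)" "s < dq x (of_rat k)"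
      using x by (auto simp: E_def)
    show "\<exists>y. y \<noteq> x \<and> \<bar>y - x\<bar> < d \<and> s < (F y - F x) / (y - x)"
      using k n by (intro exI[of _ "x + of_rat k"]) (auto simp: dq_def)
  qed
  define Z where "Z = (\<Union>(r, s, N)\<in>{(r, s, N). 0 \<le> r \<and> r < s} . E (of_rat r) (of_rat s) N)"
  have "negligible Z" unfolding Z_def
    by (rule negligible_countable_Union) (auto intro!: negE simp: of_rat_less)
  have diff: "F differentiable at x" if "x \<notin> Z" for x
  proof -
    have bd: "0 \<le> dq x h" "dq x h \<le> L" if "h \<noteq> 0" for h
    proof -
      have F1: "\<bar>F (x + h) - F x\<bar> \<le> L * \<bar>h\<bar>"
        using lipschitz_onD[OF lip, of "x + h" x] by (simp add: dist_real_def)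
      show "0 \<le> dq x h"
        using monoD[OF mono, of x "x + h"] monoD[OF mono, of "x + h" x] that
        by (cases "h > 0") (auto simp: dq_def divide_nonpos_neg)
      show "dq x h \<le> L" using F1 that unfolding dq_def
        by (cases "h > 0") (auto simp: field_simps abs_le_iff)
    qed
    let ?X = "\<lambda>h. ereal (dq x h)"
    have nb: "at (0::real) \<noteq> bot" by simp
    have ev: "\<forall>\<^sub>F h in at 0. h \<noteq> (0::real)" by (simp add: eventually_at_filter)
    have L0: "0 \<le> Liminf (at 0) ?X"
      using ev by (intro Liminf_bounded) (auto elim!: eventually_mono simp: bd)
    have LL: "Limsup (at 0) ?X \<le> ereal L"
      using ev by (intro Limsup_bounded) (auto elim!: eventually_mono simp: bd)
    have le: "Liminf (at 0) ?X \<le> Limsup (at 0) ?X" by (rule Liminf_le_Limsup[OF nb])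
    have "Liminf (at 0) ?X = Limsup (at 0) ?X"
    proof (rule ccontr)
      assume "Liminf (at 0) ?X \<noteq> Limsup (at 0) ?X"
      with le have lt: "Liminf (at 0) ?X < Limsup (at 0) ?X" by simp
      obtain s' where s': "Liminf (at 0) ?X < ereal s'" "ereal s' < Limsup (at 0) ?X"
        using ereal_dense2[OF lt] by blast
      obtain r' where r': "Liminf (at 0) ?X < ereal r'" "ereal r' < ereal s'"
        using ereal_dense2[OF s'(1)] by blast
      obtain t' where t': "Liminf (at 0) ?X < ereal t'" "ereal t' < ereal r'"
        using ereal_dense2[OF r'(1)] by blast
      obtain s where s: "s \<in> \<rat>" "r' < s" "s < s'" using Rats_dense_in_real[of r' s'] r' by auto
      obtain r where r: "r \<in> \<rat>" "t' < r" "r < r'" using Rats_dense_in_real[of t' r'] t' by auto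
      obtain rq sq where q: "r = of_rat rq" "s = of_rat sq" using r s by (auto elim!: Rats_cases)
      have "0 < ereal r" using L0 t'(1) r(2) by (metis ereal_less(2) le_less_trans less_ereal.simps(1) less_trans zero_ereal_def)
      then have "0 < r" by simp
      have f1: "\<exists>\<^sub>F h in at 0. dq x h \<in> {..<r}"
      proof (rule ccontr)
        assume "\<not> ?thesis"
        then have "\<forall>\<^sub>F h in at 0. ereal r \<le> ?X h" by (simp add: frequently_def not_less)
        then have "ereal r \<le> Liminf (at 0) ?X" by (rule Liminf_bounded)
        then show False using t' r by (metis ereal_less_eq(3) less_le_not_le order_trans)
      qed
      have f2: "\<exists>\<^sub>F h in at 0. dq x h \<in> {s<..}"
      proof (rule ccontr)
        assume "\<not> ?thesis"
        then have "\<forall>\<^sub>F h in at 0. ?X h \<le> ereal s" by (simp add: frequently_def not_less)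
        then have "Limsup (at 0) ?X \<le> ereal s" by (rule Limsup_bounded)
        then show False using s' s by (metis ereal_less_eq(3) less_le_not_le order_trans)
      qed
      obtain N where N: "\<bar>x\<bar> < real N" using reals_Archimedean2 by blast
      have "x \<in> E r s N"
        unfolding E_def mem_Collect_eq
      proof (intro conjI allI N)
        fix n
        have n: "0 < 1 / real (Suc n)" by simp
        show "\<exists>k::rat. of_rat k \<noteq> (0::real) \<and> \<bar>of_rat k\<bar> < 1 / real (Suc n) \<and> dq x (of_rat k) < r"
          using rational_difference_quotient[OF cont open_lessThan f1[unfolded dq_def] n]
          unfolding dq_def lessThan_iff .
        show "\<exists>k::rat. of_rat k \<noteq> (0::real) \<and> \<bar>of_rat k\<bar> < 1 / real (Suc n) \<and> s < dq x (of_rat k)"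
          using rational_difference_quotient[OF cont open_greaterThan f2[unfolded dq_def] n]
          unfolding dq_def greaterThan_iff .
      qed
      moreover have "0 \<le> rq" using \<open>0 < r\<close> unfolding q by simp
      moreover have "r < s" using r s by linarith
      then have "rq < sq" unfolding q by (simp add: of_rat_less)
      ultimately show False using \<open>x \<notin> Z\<close> unfolding Z_def q by auto
    qed
    moreover obtain l where l: "Liminf (at 0) ?X = ereal l"
      using L0 le LL by (cases "Liminf (at 0) ?X") auto
    ultimately have "(?X \<longlongrightarrow> ereal l) (at 0)" using tendsto_iff_Liminf_eq_Limsup[OF nb, of ?X "ereal l"] by simp
    then have "(dq x \<longlongrightarrow> l) (at 0)" by simp
    moreover have "dq x = (\<lambda>h. (F (x + h) - F x) / h)" by (simp add: dq_def fun_eq_iff)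
    ultimately have "(F has_real_derivative l) (at x)" by (simp only: DERIV_def)
    then show ?thesis using real_differentiable_def by blast
  qed
  show ?thesis
    by (rule AE_I'[of Z]) (use \<open>negligible Z\<close> diff in \<open>auto simp: negligible_iff_null_sets\<close>)
qed

section \<open>Phases and interface of a lattice solution\<close>

lemma bounded_linear_apply_bcontfun: "bounded_linear (\<lambda>f :: 'a::topological_space \<Rightarrow>\<^sub>C real. apply_bcontfun f x)"
  by (rule bounded_linear_intro[where K=1])
     (simp_all only: plus_bcontfun.rep_eq scaleR_bcontfun.rep_eq mult_1_right norm_bounded)

lemma lattice_has_derivative:
  assumes "solves_lattice \<kappa> u" "0 \<le> t"
  shows "((\<lambda>t. apply_bcontfun (u t) j) has_real_derivative Lap (pressure \<kappa> (u t)) j) (at t within {0..})"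
proof -
  obtain D where D: "(u has_vector_derivative D) (at t within {0..})"
    "apply_bcontfun D j = Lap (pressure \<kappa> (u t)) j"
    using assms unfolding solves_lattice_def by blast
  from bounded_linear.has_vector_derivative[OF bounded_linear_apply_bcontfun D(1), of j] D(2)
  show ?thesis by (simp add: has_real_derivative_iff_has_vector_derivative)
qed

lemma lattice_continuous_on:
  assumes "solves_lattice \<kappa> u"
  shows "continuous_on {0..} u" "continuous_on {0..} (\<lambda>t. apply_bcontfun (u t) j)"
proof -
  show "continuous_on {0..} u"
    using assms has_vector_derivative_continuous
    unfolding solves_lattice_def continuous_on_eq_continuous_within by blast
  show "continuous_on {0..} (\<lambda>t. apply_bcontfun (u t) j)"
    unfolding continuous_on_eq_continuous_within
    using DERIV_continuous[OF lattice_has_derivative[OF assms]] by simp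
qed

lemma u_star_pos: "0 < \<kappa> \<Longrightarrow> 0 < u_star \<kappa>"
  by (simp add: u_star_def)

lemma X_set_left_phase:
  assumes "w \<in> X_set \<kappa> k" "j < k"
  shows "u_star \<kappa> < apply_bcontfun w j"
proof -
  have "bdd_below (range (apply_bcontfun w))"
    by (rule bounded_imp_bdd_below[OF bounded_apply_bcontfun])
  then have "(INF j\<in>{..<k}. apply_bcontfun w j) \<le> apply_bcontfun w j"
    using assms(2) by (intro cINF_lower) (auto intro: bdd_below_mono)
  then show ?thesis using assms(1) by (simp add: X_set_def)
qed

lemma X_set_right_phase:
  assumes "w \<in> X_set \<kappa> k" "k < j"
  shows "- u_dstar \<kappa> < apply_bcontfun w j" "apply_bcontfun w j < - u_star \<kappa>"
proof -
  have "bdd_below (range (apply_bcontfun w))" "bdd_above (range (apply_bcontfun w))"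
    by (rule bounded_imp_bdd_below[OF bounded_apply_bcontfun] bounded_imp_bdd_above[OF bounded_apply_bcontfun])+
  then have "(INF j\<in>{k<..}. apply_bcontfun w j) \<le> apply_bcontfun w j"
    "apply_bcontfun w j \<le> (SUP j\<in>{k<..}. apply_bcontfun w j)"
    using assms(2) by (auto intro!: cINF_lower cSUP_upper intro: bdd_below_mono bdd_above_mono)
  then show "- u_dstar \<kappa> < apply_bcontfun w j" "apply_bcontfun w j < - u_star \<kappa>"
    using assms(1) by (auto simp: X_set_def)
qed

lemma transition_times_mono:
  assumes "single_interface_solution \<kappa> u ts"
  shows "mono ts"
proof (rule incseq_SucI)
  fix k
  show "ts k \<le> ts (Suc k)"
  proof (cases k)
    case 0
    have "0 < ts 1" "ts 0 = 0" using assms by (auto simp: single_interface_solution_def)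
    then show ?thesis using 0 by simp
  next
    case (Suc n)
    then have "ts k \<le> ts (k + 1)" using assms unfolding single_interface_solution_def by auto
    then show ?thesis by simp
  qed
qed

lemma single_interface_X_set:
  assumes "single_interface_solution \<kappa> u ts" "ts k < ereal t" "ereal t < ts (Suc k)"
  shows "u t \<in> X_set \<kappa> (int (Suc k))"
proof -
  have "1 \<le> Suc k" "ts (Suc k - 1) < \<infinity>" "ts (Suc k - 1) < ereal t"
    using assms(2) by (auto intro: less_trans[where y="ereal t"])
  with assms(1,3) show ?thesis unfolding single_interface_solution_def by blast
qed

text \<open>Transition times cannot accumulate: the particle \<open>k\<close> crosses from below \<open>-u\<^sub>*\<close> to above \<open>u\<^sub>*\<close> around
  the \<open>k\<close>-th transition, so a finite accumulation point \<open>T\<close> would contradict the continuity of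
  \<open>u\<close> in the supremum norm at \<open>T\<close>.\<close>
lemma transition_times_cover:
  assumes sol: "single_interface_solution \<kappa> u ts" and \<kappa>: "0 < \<kappa>" and t: "0 \<le> t"
  obtains k where "ts k \<le> ereal t" "ereal t < ts (Suc k)"
proof -
  have "\<exists>k. ereal t < ts k"
  proof (rule ccontr)
    assume "\<nexists>k. ereal t < ts k"
    then have le: "ts k \<le> ereal t" for k by (simp add: not_less)
    have ts0: "ts 0 = 0" using sol by (simp add: single_interface_solution_def)
    have ge: "0 \<le> ts k" for k using monoD[OF transition_times_mono[OF sol], of 0 k] ts0 by simp
    define a where "a k = real_of_ereal (ts k)" for k
    have ts: "ts k = ereal (a k)" for k
      unfolding a_def using le[of k] ge[of k] by (cases "ts k") auto
    have inc: "incseq a" using transition_times_mono[OF sol] unfolding ts by (simp add: mono_def)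
    have a: "0 \<le> a k" "a k \<le> t" for k using le[of k] ge[of k] unfolding ts by auto
    have strict: "a k < a (Suc k)" if "1 \<le> k" for k
    proof -
      have "ts k = \<infinity> \<or> ts k < ts (k + 1)"
        using sol that unfolding single_interface_solution_def by blast
      then show ?thesis unfolding ts by simp
    qed
    obtain T where T: "a \<longlonglongrightarrow> T" "\<And>k. a k \<le> T"
      using incseq_convergent[OF inc, of t] a by metis
    have T0: "0 \<le> T" using a(1)[of 0] T(2)[of 0] by simp
    have us: "0 < u_star \<kappa>" using \<kappa> by (rule u_star_pos)
    obtain \<delta> where \<delta>: "\<delta> > 0" "\<And>s. s \<in> {0..} \<Longrightarrow> dist s T < \<delta> \<Longrightarrow> dist (u s) (u T) < u_star \<kappa>"
      using lattice_continuous_on(1)[of \<kappa> u] sol T0 us unfolding continuous_on_iff single_interface_solution_def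
      by (metis atLeast_iff)
    have "\<forall>\<^sub>F k in sequentially. T - \<delta> < a k" using order_tendstoD(1)[OF T(1)] \<delta>(1) by simp
    then obtain N0 where N0: "\<And>k. k \<ge> N0 \<Longrightarrow> T - \<delta> < a k" unfolding eventually_sequentially by blast
    define N where "N = Suc N0"
    have N: "1 \<le> N" "T - \<delta> < a N" using N0[of N] by (auto simp: N_def)
    obtain s1 where s1: "a N < s1" "s1 < a (Suc N)" using strict[OF N(1)] dense by blast
    obtain s2 where s2: "a (Suc (Suc N)) < s2" "s2 < a (Suc (Suc (Suc N)))" using strict[of "Suc (Suc N)"] dense by auto
    have X1: "u s1 \<in> X_set \<kappa> (int (Suc N))"
      by (rule single_interface_X_set[OF sol]) (use s1 ts in auto)
    have X2: "u s2 \<in> X_set \<kappa> (int (Suc (Suc (Suc N))))"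
      by (rule single_interface_X_set[OF sol]) (use s2 ts in auto)
    let ?j = "int (Suc (Suc N))"
    have w: "apply_bcontfun (u s1) ?j < - u_star \<kappa>" "u_star \<kappa> < apply_bcontfun (u s2) ?j"
      using X_set_right_phase(2)[OF X1, of ?j] X_set_left_phase[OF X2, of ?j] by auto
    have "a N \<le> a (Suc N)" "a (Suc N) \<le> a (Suc (Suc N))" using inc by (auto simp: incseq_SucD)
    then have "dist s1 T < \<delta>" "dist s2 T < \<delta>" "0 \<le> s1" "0 \<le> s2"
      using s1 s2 N(2) T(2)[of "Suc N"] T(2)[of "Suc (Suc (Suc N))"] a(1)[of N] \<delta>(1)
      by (auto simp: dist_real_def abs_less_iff)
    then have "dist (u s1) (u T) < u_star \<kappa>" "dist (u s2) (u T) < u_star \<kappa>"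
      by (simp_all add: \<delta>(2))
    then have "dist (u s1) (u s2) < 2 * u_star \<kappa>"
      using dist_triangle2[of "u s1" "u s2" "u T"] by linarith
    moreover have "dist (apply_bcontfun (u s1) ?j) (apply_bcontfun (u s2) ?j) \<le> dist (u s1) (u s2)"
      by (rule dist_bounded)
    ultimately show False using w by (simp add: dist_real_def)
  qed
  then obtain k where k: "ereal t < ts k" "\<And>l. l < k \<Longrightarrow> \<not> ereal t < ts l"
    using exists_least_iff[of "\<lambda>k. ereal t < ts k"] by blast
  have "ts 0 = 0" using sol by (simp add: single_interface_solution_def)
  then have "k \<noteq> 0" using k(1) t by (cases "k = 0") auto
  then obtain l where "k = Suc l" using not0_implies_Suc by blast
  then show thesis using that[of l] k(1) k(2)[of l] by (simp add: not_less)
qed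

text \<open>The strict inequalities are known inside the time interval only; as limits from the right they
  survive, with equality permitted, at the transition time itself.\<close>
lemma single_interface_phases:
  assumes sol: "single_interface_solution \<kappa> u ts" and t: "0 \<le> t" "ts k \<le> ereal t" "ereal t < ts (Suc k)"
  shows "j < int (Suc k) \<Longrightarrow> u_star \<kappa> \<le> apply_bcontfun (u t) j"
    and "int (Suc k) < j \<Longrightarrow> - u_dstar \<kappa> \<le> apply_bcontfun (u t) j"
    and "int (Suc k) < j \<Longrightarrow> apply_bcontfun (u t) j \<le> - u_star \<kappa>"
proof -
  have lim: "((\<lambda>t. apply_bcontfun (u t) j) \<longlongrightarrow> apply_bcontfun (u t) j) (at_right t)" for j
  proof -
    have "((\<lambda>t. apply_bcontfun (u t) j) \<longlongrightarrow> apply_bcontfun (u t) j) (at t within {0..})"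
      using lattice_continuous_on(2)[of \<kappa> u j] sol t(1)
      by (simp add: continuous_on_def single_interface_solution_def)
    then show ?thesis by (rule tendsto_within_subset) (use t(1) in auto)
  qed
  obtain t' where t': "t < t'" "\<And>s. s < t' \<Longrightarrow> ereal s < ts (Suc k)"
  proof -
    obtain t' where "ereal t < ereal t'" "ereal t' < ts (Suc k)" using ereal_dense2[OF t(3)] by blast
    moreover have "ereal s < ts (Suc k)" if "s < t'" for s
      using less_trans[of "ereal s" "ereal t'"] that calculation(2) by simp
    ultimately show ?thesis using that[of t'] by simp
  qed
  have ev: "\<forall>\<^sub>F s in at_right t. u s \<in> X_set \<kappa> (int (Suc k))"
    unfolding eventually_at_right_field
  proof (intro exI[of _ t'] conjI allI impI t'(1))
    fix s assume s: "t < s" "s < t'"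
    then have "ts k < ereal s" using t(2) by (auto intro: le_less_trans)
    then show "u s \<in> X_set \<kappa> (int (Suc k))" by (rule single_interface_X_set[OF sol _ t'(2)[OF s(2)]])
  qed
  have nt: "at_right t \<noteq> bot" by simp
  show "u_star \<kappa> \<le> apply_bcontfun (u t) j" if "j < int (Suc k)"
    by (rule tendsto_lowerbound[OF lim _ nt], rule eventually_mono[OF ev])
       (use X_set_left_phase that in \<open>force intro: less_imp_le\<close>)
  show "- u_dstar \<kappa> \<le> apply_bcontfun (u t) j" if "int (Suc k) < j"
    by (rule tendsto_lowerbound[OF lim _ nt], rule eventually_mono[OF ev])
       (use X_set_right_phase that in \<open>force intro: less_imp_le\<close>)
  show "apply_bcontfun (u t) j \<le> - u_star \<kappa>" if "int (Suc k) < j"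
    by (rule tendsto_upperbound[OF lim _ nt], rule eventually_mono[OF ev])
       (use X_set_right_phase that in \<open>force intro: less_imp_le\<close>)
qed

text \<open>The half-open time intervals are disjoint, so a single term of the series is nonzero.\<close>
lemma interface_eq:
  assumes "mono ts" "ts k \<le> ereal (\<tau> / \<epsilon>\<^sup>2)" "ereal (\<tau> / \<epsilon>\<^sup>2) < ts (Suc k)"
  shows "interface \<epsilon> ts \<tau> = \<epsilon> * real (Suc k)"
proof -
  let ?x = "ereal (\<tau> / \<epsilon>\<^sup>2)"
  have "real (l + 1) * indicator {ts l..<ts (l + 1)} ?x = 0" if "l \<noteq> k" for l
  proof -
    consider "l < k" | "k < l" using \<open>l \<noteq> k\<close> by (rule linorder_neqE_nat)
    then have "?x \<notin> {ts l..<ts (l + 1)}"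
    proof cases
      case 1
      then have "ts (l + 1) \<le> ts k" by (intro monoD[OF assms(1)]) simp
      then show ?thesis using order_trans[OF _ assms(2), of "ts (l + 1)"] by (simp add: not_less)
    next
      case 2
      then have "ts (Suc k) \<le> ts l" by (intro monoD[OF assms(1)]) simp
      then show ?thesis using less_le_trans[OF assms(3)] by (simp add: not_le)
    qed
    then show ?thesis by simp
  qed
  then have "(\<Sum>l. real (l + 1) * indicator {ts l..<ts (l + 1)} ?x) =
      (\<Sum>l\<in>{k}. real (l + 1) * indicator {ts l..<ts (l + 1)} ?x)"
    by (intro suminf_finite) auto
  also have "\<dots> = real (Suc k)" using assms(2,3) by simp
  finally show ?thesis by (simp add: interface_def)
qed

lemma Xi_star_cases:
  assumes "single_interface_solution \<kappa> u ts" "0 < \<kappa>" "0 \<le> \<tau>"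
  obtains k where "ts k \<le> ereal (\<tau> / \<epsilon>\<^sup>2)" "ereal (\<tau> / \<epsilon>\<^sup>2) < ts (Suc k)"
    "Xi_star \<epsilon> ts \<tau> = \<epsilon> * real (Suc k)"
proof -
  have "0 \<le> \<tau> / \<epsilon>\<^sup>2" using assms(3) by simp
  from transition_times_cover[OF assms(1,2) this]
  obtain k where k: "ts k \<le> ereal (\<tau> / \<epsilon>\<^sup>2)" "ereal (\<tau> / \<epsilon>\<^sup>2) < ts (Suc k)" by blast
  show thesis
    by (rule that[OF k]) (simp only: Xi_star_def interface_eq[OF transition_times_mono[OF assms(1)] k])
qed

lemma Xi_star_nonneg:
  assumes "single_interface_solution \<kappa> u ts" "0 < \<kappa>" "0 \<le> \<tau>" "0 < \<epsilon>"
  shows "0 \<le> Xi_star \<epsilon> ts \<tau>"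
proof -
  obtain k where "ts k \<le> ereal (\<tau> / \<epsilon>\<^sup>2)" "ereal (\<tau> / \<epsilon>\<^sup>2) < ts (Suc k)"
    "Xi_star \<epsilon> ts \<tau> = \<epsilon> * real (Suc k)"
    by (rule Xi_star_cases[OF assms(1-3)])
  then show ?thesis using assms(4) by simp
qed

lemma Xi_star_mono:
  assumes sol: "single_interface_solution \<kappa> u ts" and "0 < \<kappa>" "0 < \<epsilon>" "0 \<le> \<tau>" "\<tau> \<le> \<tau>'"
  shows "Xi_star \<epsilon> ts \<tau> \<le> Xi_star \<epsilon> ts \<tau>'"
proof -
  obtain k where k: "ts k \<le> ereal (\<tau> / \<epsilon>\<^sup>2)" "ereal (\<tau> / \<epsilon>\<^sup>2) < ts (Suc k)"
    "Xi_star \<epsilon> ts \<tau> = \<epsilon> * real (Suc k)"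
    by (rule Xi_star_cases[OF sol assms(2,4)])
  have "0 \<le> \<tau>'" using assms(4,5) by simp
  obtain l where l: "ts l \<le> ereal (\<tau>' / \<epsilon>\<^sup>2)" "ereal (\<tau>' / \<epsilon>\<^sup>2) < ts (Suc l)"
    "Xi_star \<epsilon> ts \<tau>' = \<epsilon> * real (Suc l)"
    by (rule Xi_star_cases[OF sol assms(2) \<open>0 \<le> \<tau>'\<close>])
  have "ereal (\<tau> / \<epsilon>\<^sup>2) \<le> ereal (\<tau>' / \<epsilon>\<^sup>2)" using assms(5) by (simp add: divide_right_mono)
  then have "ts k < ts (Suc l)" using le_less_trans[OF order_trans[OF k(1)] l(2)] by simp
  then have "\<not> Suc l \<le> k" using monoD[OF transition_times_mono[OF sol], of "Suc l" k] by auto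
  then show ?thesis unfolding k(3) l(3) using assms(3) by (intro mult_left_mono) auto
qed

text \<open>The margin \<open>\<epsilon>\<close> keeps the cell of \<open>\<xi>\<close>, which is off by up to half a lattice spacing, away from the
  particle at the interface, whose phase is undetermined.\<close>
lemma U_eps_phases:
  assumes sol: "single_interface_solution \<kappa> u ts" and \<kappa>: "0 < \<kappa>" and \<epsilon>: "0 < \<epsilon>" and \<tau>: "0 \<le> \<tau>"
  shows "\<xi> < Xi_star \<epsilon> ts \<tau> - \<epsilon> \<Longrightarrow> u_star \<kappa> \<le> U_eps \<epsilon> u (\<tau>, \<xi>)"
    and "Xi_star \<epsilon> ts \<tau> + \<epsilon> < \<xi> \<Longrightarrow> - u_dstar \<kappa> \<le> U_eps \<epsilon> u (\<tau>, \<xi>) \<and> U_eps \<epsilon> u (\<tau>, \<xi>) \<le> - u_star \<kappa>"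
proof -
  obtain k where k: "ts k \<le> ereal (\<tau> / \<epsilon>\<^sup>2)" "ereal (\<tau> / \<epsilon>\<^sup>2) < ts (Suc k)"
    "Xi_star \<epsilon> ts \<tau> = \<epsilon> * real (Suc k)"
    by (rule Xi_star_cases[OF sol \<kappa> \<tau>])
  have t: "0 \<le> \<tau> / \<epsilon>\<^sup>2" using \<tau> by simp
  obtain \<zeta> where \<zeta>: "\<xi> = \<epsilon> * (real_of_int (cell \<epsilon> \<xi>) + \<zeta>)" "- 1 / 2 < \<zeta>" "\<zeta> \<le> 1 / 2"
    using cell_iff[OF \<epsilon>, of \<xi> "cell \<epsilon> \<xi>"] by auto
  show "u_star \<kappa> \<le> U_eps \<epsilon> u (\<tau>, \<xi>)" if "\<xi> < Xi_star \<epsilon> ts \<tau> - \<epsilon>"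
  proof -
    have "\<epsilon> * (real_of_int (cell \<epsilon> \<xi>) + \<zeta>) < \<epsilon> * real k"
      using that \<zeta>(1) by (simp add: k(3) algebra_simps)
    then have "real_of_int (cell \<epsilon> \<xi>) + \<zeta> < real k" using \<epsilon> by simp
    then have "cell \<epsilon> \<xi> < int (Suc k)" using \<zeta> by linarith
    then show ?thesis using single_interface_phases(1)[OF sol t k(1,2)] by (simp add: U_eps_def)
  qed
  show "- u_dstar \<kappa> \<le> U_eps \<epsilon> u (\<tau>, \<xi>) \<and> U_eps \<epsilon> u (\<tau>, \<xi>) \<le> - u_star \<kappa>"
    if "Xi_star \<epsilon> ts \<tau> + \<epsilon> < \<xi>"
  proof -
    have "\<epsilon> * (real k + 2) < \<epsilon> * (real_of_int (cell \<epsilon> \<xi>) + \<zeta>)"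
      using that \<zeta>(1) by (simp add: k(3) algebra_simps)
    then have "real k + 2 < real_of_int (cell \<epsilon> \<xi>) + \<zeta>" using \<epsilon> by simp
    then have "int (Suc k) < cell \<epsilon> \<xi>" using \<zeta> by linarith
    then show ?thesis using single_interface_phases(2,3)[OF sol t k(1,2)] by (simp add: U_eps_def)
  qed
qed

section \<open>Integrals, L1 convergence and test functions in the plane\<close>

lemma lborel_integral_translate:
  fixes f :: "'a::euclidean_space \<Rightarrow> real"
  assumes f: "f \<in> borel_measurable borel"
  shows "(LINT x|lborel. f (c + x)) = (LINT x|lborel. f x)"
proof -
  have "(LINT x|lborel. f x) = (LINT x|distr lborel borel ((+) c). f x)"
    by (simp only: lborel_distr_plus)
  also have "\<dots> = (LINT x|lborel. f (c + x))"
    by (rule integral_distr) (use f in measurable)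
  finally show ?thesis by simp
qed

text \<open>Fubini's theorem for functions that are only Lebesgue measurable: each of them agrees almost
  everywhere, hence on almost every slice, with a Borel function.\<close>
lemma lebesgue_integral_eq_by_slices:
  fixes f1 f2 :: "real \<times> real \<Rightarrow> real"
  assumes int: "integrable lebesgue f1" "integrable lebesgue f2"
    and slices: "\<And>x. (LINT y|lebesgue. f1 (x, y)) = (LINT y|lebesgue. f2 (x, y))"
  shows "integral\<^sup>L lebesgue f1 = integral\<^sup>L lebesgue f2"
proof -
  have rep: "\<exists>g :: real \<times> real \<Rightarrow> real. integrable lborel g \<and> integral\<^sup>L lebesgue f = integral\<^sup>L lborel g \<and>
      (AE x in lborel. (LINT y|lebesgue. f (x, y)) = (LINT y|lborel. g (x, y)))"
    if f: "integrable lebesgue f" for f :: "real \<times> real \<Rightarrow> real"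
  proof -
    obtain g where g: "g \<in> borel_measurable lborel" "AE z in lborel. f z = g z"
      using completion_ex_borel_measurable_real[OF borel_measurable_integrable[OF f]] by blast
    have fm: "f \<in> borel_measurable lebesgue" using f by (rule borel_measurable_integrable)
    have gm: "g \<in> borel_measurable lebesgue" using g(1) by (rule measurable_completion)
    have ae: "AE z in lebesgue. f z = g z" using g(2) by (rule AE_completion)
    have "integrable lebesgue g" using integrable_cong_AE[OF fm gm ae] f by simp
    then have ig: "integrable lborel g" using g(1) by (simp add: integrable_completion)
    have eqI: "integral\<^sup>L lebesgue f = integral\<^sup>L lborel g"
      using integral_cong_AE[OF fm gm ae] integral_completion[OF g(1)] by simp
    have "AE x in lborel. AE y in lborel. f (x, y) = g (x, y)"
      by (rule lborel_pair.AE_pair[unfolded lborel_prod, OF g(2)])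
    then have aeI: "AE x in lborel. (LINT y|lebesgue. f (x, y)) = (LINT y|lborel. g (x, y))"
    proof eventually_elim
      fix x assume "AE y in lborel. f (x, y) = g (x, y)"
      then have a: "AE y in lebesgue. g (x, y) = f (x, y)" by (intro AE_completion) (auto elim: eventually_mono)
      have "(\<lambda>y. g (x, y)) \<in> borel_measurable lborel"
        using g(1) by (auto intro: measurable_compose[OF measurable_Pair1'] simp: lborel_prod[symmetric])
      then have b: "(\<lambda>y. g (x, y)) \<in> borel_measurable lebesgue" by (rule measurable_completion)
      have c: "(\<lambda>y. f (x, y)) \<in> borel_measurable lebesgue" by (rule borel_measurable_AE[OF b a])
      show "(LINT y|lebesgue. f (x, y)) = (LINT y|lborel. g (x, y))"
        using integral_cong_AE[OF b c a] integral_completion[OF \<open>(\<lambda>y. g (x, y)) \<in> borel_measurable lborel\<close>] by simp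
    qed
    show ?thesis by (rule exI[of _ g], rule conjI[OF ig conjI[OF eqI aeI]])
  qed
  obtain g1 :: "real \<times> real \<Rightarrow> real" where g1: "integrable lborel g1" "integral\<^sup>L lebesgue f1 = integral\<^sup>L lborel g1"
    "AE x in lborel. (LINT y|lebesgue. f1 (x, y)) = (LINT y|lborel. g1 (x, y))" using rep[OF int(1)] by blast
  obtain g2 :: "real \<times> real \<Rightarrow> real" where g2: "integrable lborel g2" "integral\<^sup>L lebesgue f2 = integral\<^sup>L lborel g2"
    "AE x in lborel. (LINT y|lebesgue. f2 (x, y)) = (LINT y|lborel. g2 (x, y))" using rep[OF int(2)] by blast
  have fub: "integral\<^sup>L lborel g = (LINT x|lborel. LINT y|lborel. g (x, y))"
    "integrable lborel (\<lambda>x. LINT y|lborel. g (x, y))"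
    if "integrable lborel g" for g :: "real \<times> real \<Rightarrow> real"
    using lborel_pair.integral_fst'[of g] lborel_pair.integrable_fst'[of g] that by (simp_all add: lborel_prod)
  have "(LINT x|lborel. LINT y|lborel. g1 (x, y)) = (LINT x|lborel. LINT y|lborel. g2 (x, y))"
  proof (rule integral_cong_AE)
    show "AE x in lborel. (LINT y|lborel. g1 (x, y)) = (LINT y|lborel. g2 (x, y))"
      using g1(3) g2(3) by eventually_elim (simp add: slices)
  qed (use fub(2) g1(1) g2(1) borel_measurable_integrable in blast)+
  then show ?thesis using g1(2) g2(2) fub(1)[OF g1(1)] fub(1)[OF g2(1)] by simp
qed

lemma integrable_mult_bounded:
  fixes h k :: "'a \<Rightarrow> real"
  assumes h: "integrable M h" and k: "k \<in> borel_measurable M" and D: "\<And>x. x \<in> space M \<Longrightarrow> \<bar>k x\<bar> \<le> D"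
  shows "integrable M (\<lambda>x. h x * k x)"
proof (rule Bochner_Integration.integrable_bound)
  show "integrable M (\<lambda>x. D * \<bar>h x\<bar>)" using h by simp
  show "(\<lambda>x. h x * k x) \<in> borel_measurable M" using borel_measurable_integrable[OF h] k by measurable
  show "AE x in M. norm (h x * k x) \<le> norm (D * \<bar>h x\<bar>)"
  proof (rule AE_I2)
    fix x assume "x \<in> space M"
    then have "\<bar>k x\<bar> \<le> \<bar>D\<bar>" using D[of x] by linarith
    then have "\<bar>k x\<bar> * \<bar>h x\<bar> \<le> \<bar>D\<bar> * \<bar>h x\<bar>" by (intro mult_right_mono) auto
    then show "norm (h x * k x) \<le> norm (D * \<bar>h x\<bar>)" by (simp add: abs_mult mult.commute)
  qed
qed

lemma tendsto_integral_mult_L1_uniform: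
  fixes f g :: "'a \<Rightarrow> real"
  assumes int: "\<And>n. integrable M (fn n)" "integrable M f"
    and L1: "(\<lambda>n. LINT x|M. \<bar>fn n x - f x\<bar>) \<longlonglongrightarrow> 0"
    and meas: "\<And>n. gn n \<in> borel_measurable M" "g \<in> borel_measurable M"
    and bound: "\<And>x. x \<in> space M \<Longrightarrow> \<bar>g x\<bar> \<le> C"
    and unif: "\<And>\<delta>. 0 < \<delta> \<Longrightarrow> \<forall>\<^sub>F n in sequentially. \<forall>x\<in>space M. \<bar>gn n x - g x\<bar> \<le> \<delta>"
  shows "(\<lambda>n. LINT x|M. fn n x * gn n x) \<longlonglongrightarrow> (LINT x|M. f x * g x)"
proof -
  define I where "I = (LINT x|M. \<bar>f x\<bar>)"
  have I0: "0 \<le> I" by (simp add: I_def)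
  show ?thesis
  proof (rule LIMSEQ_I)
    fix r :: real assume r: "0 < r"
    define \<delta> where "\<delta> = min 1 (r / (2 * (I + 1)))"
    have \<delta>: "0 < \<delta>" "\<delta> \<le> 1" "\<delta> * I < r"
    proof -
      show "0 < \<delta>" "\<delta> \<le> 1" using r I0 by (auto simp: \<delta>_def)
      have "\<delta> * I \<le> r / (2 * (I + 1)) * I" using I0 by (intro mult_right_mono) (auto simp: \<delta>_def)
      also have "\<dots> < r" using r I0 by (simp add: field_simps add_nonneg_pos)
      finally show "\<delta> * I < r" .
    qed
    have lim: "(\<lambda>n. (\<bar>C\<bar> + 1) * (LINT x|M. \<bar>fn n x - f x\<bar>) + \<delta> * I) \<longlonglongrightarrow> (\<bar>C\<bar> + 1) * 0 + \<delta> * I"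
      by (intro tendsto_intros L1)
    have "\<forall>\<^sub>F n in sequentially. (\<bar>C\<bar> + 1) * (LINT x|M. \<bar>fn n x - f x\<bar>) + \<delta> * I < r"
      using order_tendstoD(2)[OF lim] \<delta>(3) by simp
    then have "\<forall>\<^sub>F n in sequentially. norm ((LINT x|M. fn n x * gn n x) - (LINT x|M. f x * g x)) < r"
      using unif[OF \<delta>(1)]
    proof eventually_elim
      fix n assume small: "(\<bar>C\<bar> + 1) * (LINT x|M. \<bar>fn n x - f x\<bar>) + \<delta> * I < r"
        and u: "\<forall>x\<in>space M. \<bar>gn n x - g x\<bar> \<le> \<delta>"
      have gb: "\<bar>gn n x\<bar> \<le> \<bar>C\<bar> + 1" if "x \<in> space M" for x
        using bound[OF that] u[rule_format, OF that] \<delta>(2) by linarith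
      have 1: "integrable M (\<lambda>x. fn n x * gn n x)" "integrable M (\<lambda>x. f x * g x)"
        by (rule integrable_mult_bounded[OF int(1) meas(1) gb] integrable_mult_bounded[OF int(2) meas(2) bound], assumption)+
      have "norm ((LINT x|M. fn n x * gn n x) - (LINT x|M. f x * g x)) = \<bar>LINT x|M. fn n x * gn n x - f x * g x\<bar>"
        using 1 by simp
      also have "\<dots> \<le> (LINT x|M. (\<bar>C\<bar> + 1) * \<bar>fn n x - f x\<bar> + \<delta> * \<bar>f x\<bar>)"
      proof (rule order_trans[OF integral_abs_bound], rule integral_mono)
        show "integrable M (\<lambda>x. \<bar>fn n x * gn n x - f x * g x\<bar>)" using 1 by simp
        show "integrable M (\<lambda>x. (\<bar>C\<bar> + 1) * \<bar>fn n x - f x\<bar> + \<delta> * \<bar>f x\<bar>)" using int by simp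
        fix x assume x: "x \<in> space M"
        have "\<bar>fn n x * gn n x - f x * g x\<bar> = \<bar>(fn n x - f x) * gn n x + f x * (gn n x - g x)\<bar>"
          by (simp add: algebra_simps)
        also have "\<dots> \<le> \<bar>fn n x - f x\<bar> * \<bar>gn n x\<bar> + \<bar>f x\<bar> * \<bar>gn n x - g x\<bar>"
          by (metis abs_mult abs_triangle_ineq)
        also have "\<dots> \<le> \<bar>fn n x - f x\<bar> * (\<bar>C\<bar> + 1) + \<bar>f x\<bar> * \<delta>"
          using gb[OF x] u x by (intro add_mono mult_left_mono) auto
        finally show "\<bar>fn n x * gn n x - f x * g x\<bar> \<le> (\<bar>C\<bar> + 1) * \<bar>fn n x - f x\<bar> + \<delta> * \<bar>f x\<bar>"
          by (simp add: mult.commute)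
      qed
      also have "\<dots> = (\<bar>C\<bar> + 1) * (LINT x|M. \<bar>fn n x - f x\<bar>) + \<delta> * I"
        unfolding I_def using int by (subst Bochner_Integration.integral_add) auto
      finally show "norm ((LINT x|M. fn n x * gn n x) - (LINT x|M. f x * g x)) < r" using small by simp
    qed
    then show "\<exists>no. \<forall>n\<ge>no. norm ((LINT x|M. fn n x * gn n x) - (LINT x|M. f x * g x)) < r"
      by (simp add: eventually_sequentially)
  qed
qed

lemma Ls_loc_1_tendsto_L1:
  assumes "Ls_loc_tendsto 1 A f g" "compact K" "K \<subseteq> A"
  shows "(\<lambda>n. LINT x|lebesgue_on K. \<bar>f n x - g x\<bar>) \<longlonglongrightarrow> 0"
    and "integrable (lebesgue_on K) (f n)" and "integrable (lebesgue_on K) g"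
proof -
  have i: "integrable (lebesgue_on K) (f n)" "integrable (lebesgue_on K) g" for n
    using assms(1) unfolding Ls_loc_tendsto_def by (auto intro: Ls_loc_1_integrable[OF _ assms(2,3)])
  then show "integrable (lebesgue_on K) (f n)" "integrable (lebesgue_on K) g" .
  have "(\<lambda>n. \<integral>\<^sup>+x. ennreal (\<bar>f n x - g x\<bar> powr 1) \<partial>lebesgue_on K) \<longlonglongrightarrow> 0"
    using assms unfolding Ls_loc_tendsto_def by blast
  moreover have "(\<integral>\<^sup>+x. ennreal (\<bar>f n x - g x\<bar> powr 1) \<partial>lebesgue_on K) = ennreal (LINT x|lebesgue_on K. \<bar>f n x - g x\<bar>)" for n
    using nn_integral_eq_integral[of "lebesgue_on K" "\<lambda>x. \<bar>f n x - g x\<bar>"] i by simp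
  ultimately have "(\<lambda>n. ennreal (LINT x|lebesgue_on K. \<bar>f n x - g x\<bar>)) \<longlonglongrightarrow> ennreal 0" by simp
  then show "(\<lambda>n. LINT x|lebesgue_on K. \<bar>f n x - g x\<bar>) \<longlonglongrightarrow> 0"
    by (rule tendsto_ennrealD) auto
qed

lemma Lipschitz_compose_L1:
  fixes F :: "real \<Rightarrow> real"
  assumes F: "L-lipschitz_on UNIV F" and fin: "finite_measure M"
    and int: "\<And>n. integrable M (fn n)" "integrable M f"
    and L1: "(\<lambda>n. LINT x|M. \<bar>fn n x - f x\<bar>) \<longlonglongrightarrow> 0"
  shows "integrable M (\<lambda>x. F (f x))" "\<And>n. integrable M (\<lambda>x. F (fn n x))"
    and "(\<lambda>n. LINT x|M. \<bar>F (fn n x) - F (f x)\<bar>) \<longlonglongrightarrow> 0"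
proof -
  have L0: "0 \<le> L" using F by (rule lipschitz_on_nonneg)
  have FL: "\<bar>F a - F b\<bar> \<le> L * \<bar>a - b\<bar>" for a b
    using lipschitz_onD[OF F, of a b] by (simp add: dist_real_def)
  have mF: "F \<in> borel_measurable borel"
    using lipschitz_on_continuous_on[OF F] by (rule borel_measurable_continuous_onI)
  have i: "integrable M (\<lambda>x. F (h x))" if "integrable M h" for h
  proof (rule Bochner_Integration.integrable_bound)
    show "integrable M (\<lambda>x. L * \<bar>h x\<bar> + \<bar>F 0\<bar>)"
      by (intro Bochner_Integration.integrable_add integrable_mult_right integrable_abs that
          finite_measure.integrable_const[OF fin])
    show "(\<lambda>x. F (h x)) \<in> borel_measurable M"
      using borel_measurable_integrable[OF that] mF by measurable
    have "\<bar>F a\<bar> \<le> L * \<bar>a\<bar> + \<bar>F 0\<bar>" for a using FL[of a 0] by simp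
    moreover have "0 \<le> L * \<bar>a\<bar> + \<bar>F 0\<bar>" for a using L0 by simp
    ultimately show "AE x in M. norm (F (h x)) \<le> norm (L * \<bar>h x\<bar> + \<bar>F 0\<bar>)" by simp
  qed
  show 1: "integrable M (\<lambda>x. F (f x))" "\<And>n. integrable M (\<lambda>x. F (fn n x))" using i int by auto
  show "(\<lambda>n. LINT x|M. \<bar>F (fn n x) - F (f x)\<bar>) \<longlonglongrightarrow> 0"
  proof (rule tendsto_sandwich[where f="\<lambda>_. 0" and h="\<lambda>n. L * (LINT x|M. \<bar>fn n x - f x\<bar>)"])
    show "(\<lambda>n. L * (LINT x|M. \<bar>fn n x - f x\<bar>)) \<longlonglongrightarrow> 0" using tendsto_mult_right_zero[OF L1] .
    show "\<forall>\<^sub>F n in sequentially. (LINT x|M. \<bar>F (fn n x) - F (f x)\<bar>) \<le> L * (LINT x|M. \<bar>fn n x - f x\<bar>)"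
    proof (rule always_eventually, rule allI)
      fix n
      have "(LINT x|M. \<bar>F (fn n x) - F (f x)\<bar>) \<le> (LINT x|M. L * \<bar>fn n x - f x\<bar>)"
        using 1 int FL by (intro integral_mono) auto
      then show "(LINT x|M. \<bar>F (fn n x) - F (f x)\<bar>) \<le> L * (LINT x|M. \<bar>fn n x - f x\<bar>)" by simp
    qed
  qed auto
qed

lemma test_function_uniformly_continuous:
  fixes h :: "'a::euclidean_space \<Rightarrow> real"
  assumes "test_function A h"
  shows "uniformly_continuous_on UNIV h"
proof -
  obtain K where K: "compact K" "\<And>x. x \<notin> K \<Longrightarrow> h x = 0" and s: "smooth h"
    using assms by (auto simp: test_function_def)
  define K' where "K' = {x + y | x y. x \<in> K \<and> y \<in> cball (0::'a) 1}"
  have "compact K'" unfolding K'_def using K(1) by (rule compact_sums) simp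
  then have uc: "uniformly_continuous_on K' h"
    using compact_uniformly_continuous smooth_continuous_on[OF s] by blast
  have near: "y \<in> K'" if "x \<in> K" "dist y x < 1" for x y
    unfolding K'_def using that
    by - (rule CollectI, rule exI[of _ x], rule exI[of _ "y - x"], simp add: dist_norm norm_minus_commute)
  show ?thesis
    unfolding uniformly_continuous_on_def
  proof (intro allI impI)
    fix e :: real assume e: "0 < e"
    obtain d where d: "d > 0" "\<And>x x'. x \<in> K' \<Longrightarrow> x' \<in> K' \<Longrightarrow> dist x' x < d \<Longrightarrow> dist (h x') (h x) < e"
      using uc e unfolding uniformly_continuous_on_def by metis
    have "dist (h x') (h x) < e" if "dist x' x < min d 1" for x x'
    proof (cases "x \<in> K \<or> x' \<in> K")
      case True
      then have "x \<in> K'" "x' \<in> K'"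
        using near[of x x'] near[of x' x] near[of x x] near[of x' x'] that by (auto simp: dist_commute)
      then show ?thesis using d(2) that by simp
    next
      case False
      then show ?thesis using K(2) e by simp
    qed
    then show "\<exists>d>0. \<forall>x\<in>UNIV. \<forall>x'\<in>UNIV. dist x' x < d \<longrightarrow> dist (h x') (h x) < e"
      using d(1) by (intro exI[of _ "min d 1"]) auto
  qed
qed

text \<open>By Taylor's formula the quotient is the mean of two values of \<open>\<partial>\<^sub>\<xi>\<^sup>2\<Psi>\<close> at distance less than \<open>\<epsilon>\<close>
  from \<open>\<xi>\<close>, and \<open>\<partial>\<^sub>\<xi>\<^sup>2\<Psi>\<close> is uniformly continuous.\<close>
lemma second_difference_uniform:
  assumes test: "test_function A \<Psi>" and \<delta>: "0 < \<delta>"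
  shows "\<exists>\<epsilon>0>0. \<forall>\<epsilon> \<tau> \<xi>. 0 < \<epsilon> \<and> \<epsilon> < \<epsilon>0 \<longrightarrow>
    \<bar>(\<Psi> (\<tau>, \<xi> + \<epsilon>) + \<Psi> (\<tau>, \<xi> - \<epsilon>) - 2 * \<Psi> (\<tau>, \<xi>)) / \<epsilon>\<^sup>2 - d_xi (d_xi \<Psi>) (\<tau>, \<xi>)\<bar> \<le> \<delta>"
proof -
  let ?D = "d_xi \<Psi>" and ?H = "d_xi (d_xi \<Psi>)"
  have s: "smooth \<Psi>" "smooth ?D"
    using test test_function_d_xi[OF test] by (auto simp: test_function_def)
  have "uniformly_continuous_on UNIV ?H"
    by (rule test_function_uniformly_continuous[OF test_function_d_xi[OF test_function_d_xi[OF test]]])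
  then obtain d where d: "d > 0" "\<And>z z'. dist z' z < d \<Longrightarrow> dist (?H z') (?H z) < \<delta>"
    using \<delta> unfolding uniformly_continuous_on_def by (metis UNIV_I)
  have "\<bar>(\<Psi> (\<tau>, \<xi> + \<epsilon>) + \<Psi> (\<tau>, \<xi> - \<epsilon>) - 2 * \<Psi> (\<tau>, \<xi>)) / \<epsilon>\<^sup>2 - ?H (\<tau>, \<xi>)\<bar> \<le> \<delta>"
    if \<epsilon>: "0 < \<epsilon>" "\<epsilon> < d" for \<epsilon> \<tau> \<xi>
  proof -
    define diff where "diff m s = (if m = (0::nat) then \<Psi> (\<tau>, \<xi> + s) + \<Psi> (\<tau>, \<xi> - s) - 2 * \<Psi> (\<tau>, \<xi>)
      else if m = 1 then ?D (\<tau>, \<xi> + s) - ?D (\<tau>, \<xi> - s) else ?H (\<tau>, \<xi> + s) + ?H (\<tau>, \<xi> - s))" for m s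
    have ch: "((\<lambda>s. f (\<tau>, \<xi> + s)) has_real_derivative d_xi f (\<tau>, \<xi> + t)) (at t)"
      "((\<lambda>s. f (\<tau>, \<xi> - s)) has_real_derivative - d_xi f (\<tau>, \<xi> - t)) (at t)" if "smooth f" for f t
    proof -
      have "((\<lambda>s. f (\<tau>, \<xi> + s)) has_real_derivative d_xi f (\<tau>, \<xi> + t) * 1) (at t)"
        by (rule DERIV_chain2[OF smooth_has_xi_derivative[OF that]]) (auto intro!: derivative_eq_intros)
      then show "((\<lambda>s. f (\<tau>, \<xi> + s)) has_real_derivative d_xi f (\<tau>, \<xi> + t)) (at t)" by simp
      have "((\<lambda>s. f (\<tau>, \<xi> - s)) has_real_derivative d_xi f (\<tau>, \<xi> - t) * (- 1)) (at t)"
        by (rule DERIV_chain2[OF smooth_has_xi_derivative[OF that]]) (auto intro!: derivative_eq_intros)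
      then show "((\<lambda>s. f (\<tau>, \<xi> - s)) has_real_derivative - d_xi f (\<tau>, \<xi> - t)) (at t)" by simp
    qed
    have D0: "(diff 0 has_real_derivative diff (Suc 0) t) (at t)" for t
    proof -
      have "((\<lambda>s. \<Psi> (\<tau>, \<xi> + s) + \<Psi> (\<tau>, \<xi> - s) - 2 * \<Psi> (\<tau>, \<xi>)) has_real_derivative
          ?D (\<tau>, \<xi> + t) + - ?D (\<tau>, \<xi> - t) - 0) (at t)"
        by (intro DERIV_add DERIV_diff ch s DERIV_const)
      then show ?thesis by (simp add: diff_def[abs_def])
    qed
    have D1: "(diff (Suc 0) has_real_derivative diff (Suc (Suc 0)) t) (at t)" for t
    proof -
      have "((\<lambda>s. ?D (\<tau>, \<xi> + s) - ?D (\<tau>, \<xi> - s)) has_real_derivative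
          ?H (\<tau>, \<xi> + t) - - ?H (\<tau>, \<xi> - t)) (at t)"
        by (intro DERIV_diff ch s)
      then show ?thesis by (simp add: diff_def[abs_def])
    qed
    have "\<exists>t. 0 < t \<and> t < \<epsilon> \<and> diff 0 \<epsilon> = (\<Sum>m<2. diff m 0 / fact m * \<epsilon> ^ m) + diff 2 t / fact 2 * \<epsilon> ^ 2"
      by (rule Maclaurin[OF \<epsilon>(1)]) (use D0 D1 in \<open>auto simp: less_2_cases_iff\<close>)
    then obtain t where t: "0 < t" "t < \<epsilon>"
      "diff 0 \<epsilon> = (\<Sum>m<2. diff m 0 / fact m * \<epsilon> ^ m) + diff 2 t / fact 2 * \<epsilon> ^ 2" by blast
    have "diff 0 \<epsilon> = diff 2 t / 2 * \<epsilon>\<^sup>2"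
      using t(3) by (simp add: numeral_2_eq_2 diff_def)
    then have e: "(\<Psi> (\<tau>, \<xi> + \<epsilon>) + \<Psi> (\<tau>, \<xi> - \<epsilon>) - 2 * \<Psi> (\<tau>, \<xi>)) / \<epsilon>\<^sup>2 = (?H (\<tau>, \<xi> + t) + ?H (\<tau>, \<xi> - t)) / 2"
      using \<epsilon>(1) by (simp add: diff_def)
    have "dist (\<tau>, \<xi> + t) (\<tau>, \<xi>) < d" "dist (\<tau>, \<xi> - t) (\<tau>, \<xi>) < d"
      using t \<epsilon> by (simp_all add: dist_Pair_Pair dist_real_def)
    then have "\<bar>?H (\<tau>, \<xi> + t) - ?H (\<tau>, \<xi>)\<bar> < \<delta>" "\<bar>?H (\<tau>, \<xi> - t) - ?H (\<tau>, \<xi>)\<bar> < \<delta>"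
      using d(2) by (auto simp: dist_real_def)
    moreover have "\<bar>(a + b) / 2 - c\<bar> \<le> \<delta>" if "\<bar>a - c\<bar> < \<delta>" "\<bar>b - c\<bar> < \<delta>" for a b c :: real
      using that by (simp add: abs_less_iff abs_le_iff field_simps)
    ultimately show ?thesis unfolding e by blast
  qed
  then show ?thesis using d(1) by blast
qed

lemma test_function_support_box:
  fixes \<Psi> :: "real \<times> real \<Rightarrow> real"
  assumes "test_function A \<Psi>"
  obtains R where "0 < R" "\<And>\<tau> \<xi>. R \<le> \<bar>\<tau>\<bar> \<or> R \<le> \<bar>\<xi>\<bar> \<Longrightarrow> \<Psi> (\<tau>, \<xi>) = 0"
proof -
  obtain K where K: "compact K" "\<And>x. x \<notin> K \<Longrightarrow> \<Psi> x = 0"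
    using assms by (auto simp: test_function_def)
  obtain R where R: "0 < R" "\<And>z. z \<in> K \<Longrightarrow> norm z < R"
    using compact_imp_bounded[OF K(1)] bounded_pos_less by metis
  have "\<Psi> (\<tau>, \<xi>) = 0" if "R \<le> \<bar>\<tau>\<bar> \<or> R \<le> \<bar>\<xi>\<bar>" for \<tau> \<xi>
  proof (rule K(2), rule notI)
    assume "(\<tau>, \<xi>) \<in> K"
    then have "norm (\<tau>, \<xi>) < R" by (rule R(2))
    then show False using that norm_fst_le[of \<tau> \<xi>] norm_snd_le[of \<xi> \<tau>] by auto
  qed
  then show thesis using that[of R] R(1) by blast
qed

lemma test_function_bounded:
  fixes \<Psi> :: "'a::euclidean_space \<Rightarrow> real"
  assumes "test_function A \<Psi>"
  obtains C where "0 < C" "\<And>z. \<bar>\<Psi> z\<bar> \<le> C"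
proof -
  obtain K where K: "compact K" "\<And>x. x \<notin> K \<Longrightarrow> \<Psi> x = 0" and s: "smooth \<Psi>"
    using assms by (auto simp: test_function_def)
  have "bounded (\<Psi> ` K)"
    using compact_continuous_image[OF smooth_continuous_on[OF s] K(1)] by (rule compact_imp_bounded)
  then obtain C where C: "0 < C" "\<And>z. z \<in> K \<Longrightarrow> norm (\<Psi> z) \<le> C" unfolding bounded_pos by auto
  have "\<bar>\<Psi> z\<bar> \<le> C" for z using C K(2)[of z] by (cases "z \<in> K") auto
  then show thesis using that C(1) by blast
qed

lemma test_function_borel: "test_function A \<Psi> \<Longrightarrow> \<Psi> \<in> borel_measurable borel"
  using smooth_continuous_on borel_measurable_continuous_onI unfolding test_function_def by blast

section \<open>The lattice entropy inequality and its limit\<close>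

text \<open>Subtracting a multiple of a clamped argument makes the continuity and the linear growth of
  the trilinear function evident.\<close>
lemma Phi'_eq:
  assumes "0 < \<kappa>"
  shows "Phi' \<kappa> v = v - (1 + \<kappa>) * max (- u_star \<kappa>) (min (u_star \<kappa>) v)"
proof -
  have "0 < u_star \<kappa>" "(1 + \<kappa>) * u_star \<kappa> = 1" using assms by (auto simp: u_star_def)
  then show ?thesis by (auto simp: Phi'_def min_def max_def algebra_simps)
qed

lemma continuous_on_Phi':
  assumes "0 < \<kappa>" shows "continuous_on A (Phi' \<kappa>)"
proof -
  have "continuous_on A (\<lambda>v. v - (1 + \<kappa>) * max (- u_star \<kappa>) (min (u_star \<kappa>) v))"
    by (intro continuous_intros)
  then show ?thesis using Phi'_eq[OF assms] by (simp add: fun_eq_iff)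
qed

lemma cell_shift: "0 < \<epsilon> \<Longrightarrow> cell \<epsilon> (\<xi> + \<epsilon>) = cell \<epsilon> \<xi> + 1" "0 < \<epsilon> \<Longrightarrow> cell \<epsilon> (\<xi> - \<epsilon>) = cell \<epsilon> \<xi> - 1"
  by (auto simp: cell_def add_divide_distrib diff_divide_distrib ceiling_eq_iff le_of_int_ceiling) linarith+

lemma cell_measurable: "cell \<epsilon> \<in> borel \<rightarrow>\<^sub>M count_space UNIV"
  unfolding cell_def by measurable

text \<open>The entropy inequality at a single particle: \<open>\<eta>(u\<^sub>j)\<close> has the derivative \<open>\<mu>(p\<^sub>j) \<Delta>p\<^sub>j\<close>, and the
  tangent condition on \<open>N\<close>, applied to the two neighbours, bounds \<open>\<mu>(p\<^sub>j) \<Delta>p\<^sub>j\<close> by \<open>\<Delta>N(p)\<^sub>j\<close>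
  after multiplication with the test function. The rest is the fundamental theorem of calculus.\<close>
lemma lattice_entropy_slice:
  fixes N \<mu> \<eta> \<psi> \<psi>' :: "real \<Rightarrow> real"
  assumes \<kappa>: "0 < \<kappa>" and sol: "solves_lattice \<kappa> u" and \<epsilon>: "0 < \<epsilon>" and T: "0 < T"
    and N: "continuous_on UNIV N" and \<mu>: "continuous_on UNIV \<mu>"
    and \<eta>: "\<And>v. (\<eta> has_real_derivative \<mu> (Phi' \<kappa> v)) (at v)"
    and \<psi>: "\<And>\<tau>. (\<psi> has_real_derivative \<psi>' \<tau>) (at \<tau>)" "continuous_on UNIV \<psi>'" "\<psi> T = 0"
    and conv: "\<And>\<tau> a b. 0 \<le> \<psi> \<tau> * (N b - N a - \<mu> a * (b - a))"
  defines "w \<equiv> \<lambda>j \<tau>. apply_bcontfun (u (\<tau> / \<epsilon>\<^sup>2)) j"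
  defines "p \<equiv> \<lambda>j \<tau>. Phi' \<kappa> (w j \<tau>)"
  shows "- \<eta> (w j 0) * \<psi> 0 \<le> (LINT \<tau>|lborel. indicator {0..T} \<tau> *\<^sub>R
    (\<eta> (w j \<tau>) * \<psi>' \<tau> + (N (p (j + 1) \<tau>) + N (p (j - 1) \<tau>) - 2 * N (p j \<tau>)) / \<epsilon>\<^sup>2 * \<psi> \<tau>))"
proof -
  define Lp where "Lp \<tau> = p (j + 1) \<tau> + p (j - 1) \<tau> - 2 * p j \<tau>" for \<tau>
  define g where "g \<tau> = \<eta> (w j \<tau>) * \<psi>' \<tau> + \<mu> (p j \<tau>) * Lp \<tau> / \<epsilon>\<^sup>2 * \<psi> \<tau>" for \<tau>
  define G where "G \<tau> = \<eta> (w j \<tau>) * \<psi>' \<tau> + (N (p (j + 1) \<tau>) + N (p (j - 1) \<tau>) - 2 * N (p j \<tau>)) / \<epsilon>\<^sup>2 * \<psi> \<tau>" for \<tau>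
  have cw: "continuous_on {0..T} (w j)" for j
    unfolding w_def
    by (rule continuous_on_compose2[OF lattice_continuous_on(2)[OF sol, of j]]) (use \<epsilon> in \<open>auto intro!: continuous_intros\<close>)
  have c\<eta>: "continuous_on UNIV \<eta>"
    using \<eta> DERIV_isCont by (blast intro: continuous_at_imp_continuous_on)
  have c\<psi>: "continuous_on {0..T} \<psi>" "continuous_on {0..T} \<psi>'"
    using \<psi>(1) DERIV_isCont \<psi>(2) continuous_on_subset by (blast intro: continuous_at_imp_continuous_on)+
  have cp: "continuous_on {0..T} (p j)" for j
    unfolding p_def by (rule continuous_on_compose2[OF continuous_on_Phi'[OF \<kappa>] cw subset_UNIV])
  have cN: "continuous_on {0..T} (\<lambda>\<tau>. N (p j \<tau>))" "continuous_on {0..T} (\<lambda>\<tau>. \<mu> (p j \<tau>))"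
    "continuous_on {0..T} (\<lambda>\<tau>. \<eta> (w j \<tau>))" for j
    by (rule continuous_on_compose2[OF N cp subset_UNIV] continuous_on_compose2[OF \<mu> cp subset_UNIV]
        continuous_on_compose2[OF c\<eta> cw subset_UNIV])+
  have cg: "continuous_on {0..T} g" "continuous_on {0..T} G"
    unfolding g_def G_def Lp_def using \<epsilon> by (auto intro!: continuous_intros c\<psi> cp cN)
  have "(LINT \<tau>|lborel. indicator {0..T} \<tau> *\<^sub>R g \<tau>) = \<eta> (w j T) * \<psi> T - \<eta> (w j 0) * \<psi> 0"
  proof (rule integral_FTC_Icc)
    show "0 \<le> T" using T by simp
    fix \<tau> assume \<tau>: "0 \<le> \<tau>" "\<tau> \<le> T"
    have d1: "((\<lambda>\<tau>. \<tau> / \<epsilon>\<^sup>2) has_real_derivative 1 / \<epsilon>\<^sup>2) (at \<tau> within {0..T})"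
      by (rule DERIV_cdivide[OF DERIV_ident])
    have d2: "((\<lambda>t. apply_bcontfun (u t) j) has_real_derivative Lap (pressure \<kappa> (u (\<tau> / \<epsilon>\<^sup>2))) j)
        (at (\<tau> / \<epsilon>\<^sup>2) within (\<lambda>\<tau>. \<tau> / \<epsilon>\<^sup>2) ` {0..T})"
      by (rule has_field_derivative_subset[OF lattice_has_derivative[OF sol]]) (use \<tau> \<epsilon> in auto)
    have "(w j has_real_derivative Lap (pressure \<kappa> (u (\<tau> / \<epsilon>\<^sup>2))) j * (1 / \<epsilon>\<^sup>2)) (at \<tau> within {0..T})"
      unfolding w_def by (rule DERIV_image_chain[OF d2 d1, unfolded o_def])
    moreover have "Lap (pressure \<kappa> (u (\<tau> / \<epsilon>\<^sup>2))) j = Lp \<tau>"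
      by (simp add: Lap_def pressure_def Lp_def p_def w_def)
    ultimately have dw: "(w j has_real_derivative Lp \<tau> / \<epsilon>\<^sup>2) (at \<tau> within {0..T})" by simp
    have "((\<lambda>\<tau>. \<eta> (w j \<tau>)) has_real_derivative \<mu> (p j \<tau>) * (Lp \<tau> / \<epsilon>\<^sup>2)) (at \<tau> within {0..T})"
      unfolding p_def by (rule DERIV_chain2[OF \<eta> dw])
    then have "((\<lambda>\<tau>. \<eta> (w j \<tau>) * \<psi> \<tau>) has_real_derivative
        \<mu> (p j \<tau>) * (Lp \<tau> / \<epsilon>\<^sup>2) * \<psi> \<tau> + \<psi>' \<tau> * \<eta> (w j \<tau>)) (at \<tau> within {0..T})"
      by (rule DERIV_mult[OF _ has_field_derivative_at_within[OF \<psi>(1)]])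
    then show "((\<lambda>\<tau>. \<eta> (w j \<tau>) * \<psi> \<tau>) has_vector_derivative g \<tau>) (at \<tau> within {0..T})"
      by (simp add: g_def has_real_derivative_iff_has_vector_derivative[symmetric] mult.commute add.commute)
  qed (rule cg(1))
  then have "- \<eta> (w j 0) * \<psi> 0 = (LINT \<tau>|lborel. indicator {0..T} \<tau> *\<^sub>R g \<tau>)" by (simp add: \<psi>(3))
  also have "\<dots> \<le> (LINT \<tau>|lborel. indicator {0..T} \<tau> *\<^sub>R G \<tau>)"
  proof (rule integral_mono)
    show "integrable lborel (\<lambda>\<tau>. indicator {0..T} \<tau> *\<^sub>R g \<tau>)" "integrable lborel (\<lambda>\<tau>. indicator {0..T} \<tau> *\<^sub>R G \<tau>)"
      using borel_integrable_compact[OF compact_Icc] cg by blast+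
    fix \<tau>
    have "\<psi> \<tau> * (N b - N (p j \<tau>) - \<mu> (p j \<tau>) * (b - p j \<tau>)) \<ge> 0" for b by (rule conv)
    from add_nonneg_nonneg[OF this[of "p (j + 1) \<tau>"] this[of "p (j - 1) \<tau>"]]
    have "0 \<le> ((N (p (j + 1) \<tau>) + N (p (j - 1) \<tau>) - 2 * N (p j \<tau>)) - \<mu> (p j \<tau>) * Lp \<tau>) * \<psi> \<tau>"
      by (simp add: Lp_def algebra_simps)
    then have "0 \<le> ((N (p (j + 1) \<tau>) + N (p (j - 1) \<tau>) - 2 * N (p j \<tau>)) - \<mu> (p j \<tau>) * Lp \<tau>) * \<psi> \<tau> / \<epsilon>\<^sup>2"
      by simp
    also have "\<dots> = G \<tau> - g \<tau>" by (simp add: G_def g_def diff_divide_distrib left_diff_distrib)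
    finally show "indicator {0..T} \<tau> *\<^sub>R g \<tau> \<le> indicator {0..T} \<tau> *\<^sub>R G \<tau>"
      by (simp add: indicator_def)
  qed
  finally show ?thesis by (simp add: G_def)
qed

text \<open>The scaled lattice data, with the initial values at negative times, where the lattice
  solution is unspecified; this makes them Borel functions on the plane.\<close>

definition U_ext :: "real \<Rightarrow> (real \<Rightarrow> linf) \<Rightarrow> real \<times> real \<Rightarrow> real" where
  "U_ext \<epsilon> u z = apply_bcontfun (u (max 0 (fst z) / \<epsilon>\<^sup>2)) (cell \<epsilon> (snd z))"

lemma U_ext_eq: "0 \<le> \<tau> \<Longrightarrow> U_ext \<epsilon> u (\<tau>, \<xi>) = U_eps \<epsilon> u (\<tau>, \<xi>)"
  by (simp add: U_ext_def U_eps_def)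

lemma P_eps_eq: "P_eps \<kappa> \<epsilon> u z = Phi' \<kappa> (U_eps \<epsilon> u z)"
  by (cases z) (simp add: P_eps_def U_eps_def pressure_def)

lemma U_ext_borel:
  assumes "solves_lattice \<kappa> u"
  shows "U_ext \<epsilon> u \<in> borel_measurable borel"
proof -
  have "(\<lambda>z :: real \<times> real. apply_bcontfun (u (max 0 (fst z) / \<epsilon>\<^sup>2)) (cell \<epsilon> (snd z))) \<in> borel \<rightarrow>\<^sub>M borel"
  proof (rule measurable_compose_countable)
    fix j
    have "continuous_on UNIV (\<lambda>z :: real \<times> real. apply_bcontfun (u (max 0 (fst z) / \<epsilon>\<^sup>2)) j)"
      by (rule continuous_on_compose2[OF lattice_continuous_on(2)[OF assms, of j]])
         (cases "\<epsilon> = 0"; auto intro!: continuous_intros)+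
    then show "(\<lambda>z :: real \<times> real. apply_bcontfun (u (max 0 (fst z) / \<epsilon>\<^sup>2)) j) \<in> borel \<rightarrow>\<^sub>M borel"
      by (rule borel_measurable_continuous_onI)
    show "(\<lambda>z :: real \<times> real. cell \<epsilon> (snd z)) \<in> borel \<rightarrow>\<^sub>M count_space UNIV"
      by (rule measurable_compose[OF _ cell_measurable]) (intro borel_measurable_continuous_onI continuous_intros)
  qed
  then show ?thesis by (simp add: U_ext_def[abs_def])
qed

lemma U_ext_bounded:
  assumes "solves_lattice \<kappa> u"
  obtains C where "\<And>\<tau> \<xi>. \<tau> \<le> T \<Longrightarrow> \<bar>U_ext \<epsilon> u (\<tau>, \<xi>)\<bar> \<le> C"
proof -
  have "compact (u ` {0..max 0 T / \<epsilon>\<^sup>2})"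
    by (rule compact_continuous_image[OF continuous_on_subset[OF lattice_continuous_on(1)[OF assms]] compact_Icc]) auto
  then have "bounded (u ` {0..max 0 T / \<epsilon>\<^sup>2})" by (rule compact_imp_bounded)
  then obtain C where "\<forall>x\<in>u ` {0..max 0 T / \<epsilon>\<^sup>2}. norm x \<le> C" unfolding bounded_iff by blast
  then have C: "norm (u t) \<le> C" if "t \<in> {0..max 0 T / \<epsilon>\<^sup>2}" for t using that by blast
  have "\<bar>U_ext \<epsilon> u (\<tau>, \<xi>)\<bar> \<le> C" if "\<tau> \<le> T" for \<tau> \<xi>
  proof -
    have "max 0 \<tau> / \<epsilon>\<^sup>2 \<in> {0..max 0 T / \<epsilon>\<^sup>2}" using that by (auto intro!: divide_right_mono)
    then have "norm (u (max 0 \<tau> / \<epsilon>\<^sup>2)) \<le> C" by (rule C)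
    then show ?thesis using norm_bounded[of "u (max 0 \<tau> / \<epsilon>\<^sup>2)" "cell \<epsilon> \<xi>"] by (simp add: U_ext_def)
  qed
  then show thesis by (rule that)
qed

lemma U_ext_integrable:
  fixes F :: "real \<Rightarrow> real" and h :: "real \<times> real \<Rightarrow> real"
  assumes sol: "solves_lattice \<kappa> u" and F: "continuous_on UNIV F" and h: "test_function A h"
  shows "integrable lborel (\<lambda>z. indicator {0..T} (fst z) * (F (U_ext \<epsilon> u (fst z, snd z + c)) * h z))"
proof -
  obtain K where K: "compact K" "\<And>x. x \<notin> K \<Longrightarrow> h x = 0" and s: "smooth h"
    using h by (auto simp: test_function_def)
  obtain C where C: "\<And>\<tau> \<xi>. \<tau> \<le> T \<Longrightarrow> \<bar>U_ext \<epsilon> u (\<tau>, \<xi>)\<bar> \<le> C"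
    using U_ext_bounded[OF sol] by blast
  have "compact (F ` {-C..C})"
    using compact_continuous_image[OF continuous_on_subset[OF F subset_UNIV] compact_Icc] .
  then have "bounded (F ` {-C..C})" by (rule compact_imp_bounded)
  then obtain B where "\<forall>x\<in>F ` {-C..C}. norm x \<le> B" unfolding bounded_iff by blast
  then have B: "\<bar>F v\<bar> \<le> B" if "v \<in> {-C..C}" for v using that by auto
  have [measurable]: "F \<in> borel_measurable borel" "h \<in> borel_measurable borel" "U_ext \<epsilon> u \<in> borel_measurable borel"
    using F borel_measurable_continuous_onI test_function_borel[OF h] U_ext_borel[OF sol] by blast+
  have [measurable]: "(\<lambda>z :: real \<times> real. (fst z, snd z + c)) \<in> borel_measurable borel"
    by (intro borel_measurable_continuous_onI continuous_intros)
  have [measurable]: "fst \<in> borel_measurable (borel :: (real \<times> real) measure)"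
    by (intro borel_measurable_continuous_onI continuous_intros)
  show ?thesis
  proof (rule Bochner_Integration.integrable_bound)
    have "integrable lborel (\<lambda>z. indicator K z *\<^sub>R h z)"
      using borel_integrable_compact[OF K(1)] smooth_continuous_on[OF s] by blast
    moreover have "(\<lambda>z. indicator K z *\<^sub>R h z) = h" using K(2) by (auto simp: indicator_def fun_eq_iff)
    ultimately show "integrable lborel (\<lambda>z. B * h z)" by simp
    show "(\<lambda>z. indicator {0..T} (fst z) * (F (U_ext \<epsilon> u (fst z, snd z + c)) * h z)) \<in> borel_measurable lborel"
      by measurable
    show "AE z in lborel. norm (indicator {0..T} (fst z) * (F (U_ext \<epsilon> u (fst z, snd z + c)) * h z)) \<le> norm (B * h z)"
    proof (rule AE_I2)
      fix z :: "real \<times> real"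
      show "norm (indicator {0..T} (fst z) * (F (U_ext \<epsilon> u (fst z, snd z + c)) * h z)) \<le> norm (B * h z)"
      proof (cases "fst z \<in> {0..T}")
        case True
        then have "\<bar>F (U_ext \<epsilon> u (fst z, snd z + c))\<bar> \<le> B"
          using C[of "fst z" "snd z + c"] by (intro B) (auto simp: abs_le_iff)
        then have "\<bar>F (U_ext \<epsilon> u (fst z, snd z + c))\<bar> * \<bar>h z\<bar> \<le> \<bar>B\<bar> * \<bar>h z\<bar>" by (intro mult_right_mono) auto
        then show ?thesis using True by (simp add: abs_mult)
      qed simp
    qed
  qed
qed

lemma test_function_translate:
  fixes \<Psi> :: "'a::euclidean_space \<Rightarrow> real"
  assumes "test_function A \<Psi>"
  shows "test_function UNIV (\<lambda>z. \<Psi> (z + c))"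
proof -
  obtain K where K: "compact K" "\<And>x. x \<notin> K \<Longrightarrow> \<Psi> x = 0" and s: "smooth \<Psi>"
    using assms by (auto simp: test_function_def)
  have "smooth (\<lambda>z. \<Psi> (id z + c))"
    by (rule smooth_compose_affine[OF bounded_linear_ident[folded id_def] s])
  moreover have "\<Psi> (z + c) = 0" if "z \<notin> (\<lambda>x. x - c) ` K" for z
  proof (rule K(2), rule notI)
    assume "z + c \<in> K"
    then have "z \<in> (\<lambda>x. x - c) ` K" by (intro image_eqI[of _ _ "z + c"]) auto
    with that show False by simp
  qed
  ultimately show ?thesis
    unfolding test_function_def using compact_translation_subtract[OF K(1), of c] by auto
qed

lemma test_function_integrable:
  fixes \<Psi> :: "'a::euclidean_space \<Rightarrow> real"
  assumes "test_function A \<Psi>"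
  shows "integrable lborel \<Psi>"
proof -
  obtain K where K: "compact K" "\<And>x. x \<notin> K \<Longrightarrow> \<Psi> x = 0" and s: "smooth \<Psi>"
    using assms by (auto simp: test_function_def)
  have "integrable lborel (\<lambda>z. indicator K z *\<^sub>R \<Psi> z)"
    using borel_integrable_compact[OF K(1)] smooth_continuous_on[OF s] by blast
  moreover have "(\<lambda>z. indicator K z *\<^sub>R \<Psi> z) = \<Psi>" using K(2) by (auto simp: indicator_def fun_eq_iff)
  ultimately show ?thesis by simp
qed

lemma test_function_slice:
  fixes \<Psi> :: "real \<times> real \<Rightarrow> real"
  assumes "test_function A \<Psi>"
  shows "test_function UNIV (\<lambda>\<xi>. \<Psi> (\<tau>, \<xi>))"
proof -
  obtain K where K: "compact K" "\<And>x. x \<notin> K \<Longrightarrow> \<Psi> x = 0" and s: "smooth \<Psi>"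
    using assms by (auto simp: test_function_def)
  have "bounded_linear (\<lambda>\<xi>::real. (0::real, \<xi>))" by (intro bounded_linear_Pair bounded_linear_zero bounded_linear_ident)
  from smooth_compose_affine[OF this s, of "(\<tau>, 0)"] have "smooth (\<lambda>\<xi>. \<Psi> (\<tau>, \<xi>))" by simp
  moreover have "compact (snd ` K)" using K(1) by (intro compact_continuous_image continuous_intros)
  moreover have "\<Psi> (\<tau>, \<xi>) = 0" if "\<xi> \<notin> snd ` K" for \<xi>
    using that K(2)[of "(\<tau>, \<xi>)"] by force
  ultimately show ?thesis unfolding test_function_def by blast
qed

text \<open>Integration of the inequality for single particles over \<open>\<xi>\<close>. Since a shift of \<open>\<xi>\<close> by \<open>\<epsilon>\<close> moves the
  cell by one, the discrete Laplacian is transferred to the test function by translation invariance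
  of the Lebesgue measure.\<close>
lemma lattice_entropy_weak:
  fixes N \<mu> \<eta> :: "real \<Rightarrow> real" and \<Psi> :: "real \<times> real \<Rightarrow> real"
  assumes \<kappa>: "0 < \<kappa>" and sol: "solves_lattice \<kappa> u" and \<epsilon>: "0 < \<epsilon>" and T: "0 < T"
    and N: "continuous_on UNIV N" and \<mu>: "continuous_on UNIV \<mu>"
    and \<eta>: "\<And>v. (\<eta> has_real_derivative \<mu> (Phi' \<kappa> v)) (at v)"
    and \<Psi>: "test_function ({..<T} \<times> UNIV) \<Psi>"
    and conv: "\<And>z a b. 0 \<le> \<Psi> z * (N b - N a - \<mu> a * (b - a))"
    and bdry: "\<And>\<xi>. c * \<Psi> (0, \<xi>) \<le> - \<eta> (U_eps \<epsilon> u (0, \<xi>)) * \<Psi> (0, \<xi>)"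
  shows "c * (LINT \<xi>|lborel. \<Psi> (0, \<xi>)) \<le> (LINT z|lborel. indicator {0..T} (fst z) *
     (\<eta> (U_ext \<epsilon> u z) * d_tau \<Psi> z + N (Phi' \<kappa> (U_ext \<epsilon> u z)) *
        ((\<Psi> (fst z, snd z + \<epsilon>) + \<Psi> (fst z, snd z - \<epsilon>) - 2 * \<Psi> (fst z, snd z)) / \<epsilon>\<^sup>2)))"
proof -
  let ?I = "indicator {0..T} :: real \<Rightarrow> real"
  define NP where "NP v = N (Phi' \<kappa> v)" for v
  have cNP: "continuous_on UNIV NP"
    unfolding NP_def by (rule continuous_on_compose2[OF N continuous_on_Phi'[OF \<kappa>]]) simp
  have c\<eta>: "continuous_on UNIV \<eta>"
    using \<eta> DERIV_isCont by (blast intro: continuous_at_imp_continuous_on)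
  have s\<Psi>: "smooth \<Psi>" "smooth (d_tau \<Psi>)"
    using \<Psi> test_function_d_tau[OF \<Psi>] by (auto simp: test_function_def)
  define A where "A z = ?I (fst z) * (\<eta> (U_ext \<epsilon> u z) * d_tau \<Psi> z)" for z
  define B where "B c z = ?I (fst z) * (NP (U_ext \<epsilon> u (fst z, snd z + c)) * \<Psi> z)" for c z
  define B' where "B' c z = ?I (fst z) * (NP (U_ext \<epsilon> u z) * \<Psi> (fst z, snd z + c))" for c z
  have iA: "integrable lborel A"
    using U_ext_integrable[OF sol c\<eta> test_function_d_tau[OF \<Psi>], of T \<epsilon> 0] by (simp add: A_def[abs_def])
  have iB: "integrable lborel (B c)" for c
    using U_ext_integrable[OF sol cNP \<Psi>, of T \<epsilon> c] by (simp add: B_def[abs_def])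
  have iB': "integrable lborel (B' c)" for c
  proof -
    have "B' c = (\<lambda>z. ?I (fst z) * (NP (U_ext \<epsilon> u (fst z, snd z + 0)) * \<Psi> (z + (0, c))))"
      by (auto simp: B'_def fun_eq_iff)
    then show ?thesis using U_ext_integrable[OF sol cNP test_function_translate[OF \<Psi>, of "(0, c)"], of T \<epsilon> 0] by simp
  qed
  have shift: "integral\<^sup>L lborel (B c) = integral\<^sup>L lborel (B' (- c))" for c
  proof -
    have "B c \<in> borel_measurable borel" using borel_measurable_integrable[OF iB] by simp
    from lborel_integral_translate[OF this, of "(0, - c)"]
    have "integral\<^sup>L lborel (B c) = (LINT z|lborel. B c ((0, - c) + z))" by simp
    also have "\<dots> = integral\<^sup>L lborel (B' (- c))"
      by (rule Bochner_Integration.integral_cong) (auto simp: B_def B'_def)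
    finally show ?thesis .
  qed
  define G where "G z = A z + (B \<epsilon> z + B (- \<epsilon>) z - 2 * B 0 z) / \<epsilon>\<^sup>2" for z
  have iG: "integrable lborel G" unfolding G_def[abs_def] using iA iB by simp
  have "c * (LINT \<xi>|lborel. \<Psi> (0, \<xi>)) = (LINT \<xi>|lborel. c * \<Psi> (0, \<xi>))" by simp
  also have "\<dots> \<le> (LINT \<xi>|lborel. LINT \<tau>|lborel. G (\<tau>, \<xi>))"
  proof (rule integral_mono)
    show "integrable lborel (\<lambda>\<xi>. c * \<Psi> (0, \<xi>))"
      using test_function_integrable[OF test_function_slice[OF \<Psi>]] by simp
    show "integrable lborel (\<lambda>\<xi>. LINT \<tau>|lborel. G (\<tau>, \<xi>))"
      using lborel_pair.integrable_snd[of "\<lambda>x y. G (x, y)"] iG by (simp add: lborel_prod)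
    fix \<xi>
    let ?j = "cell \<epsilon> \<xi>"
    have \<psi>T: "\<Psi> (T, \<xi>) = 0" using \<Psi> unfolding test_function_def by fastforce
    have c\<psi>': "continuous_on UNIV (\<lambda>\<tau>. d_tau \<Psi> (\<tau>, \<xi>))"
      by (rule continuous_on_compose2[OF smooth_continuous_on[OF s\<Psi>(2), of UNIV]]) (auto intro!: continuous_intros)
    have "c * \<Psi> (0, \<xi>) \<le> - \<eta> (apply_bcontfun (u (0 / \<epsilon>\<^sup>2)) ?j) * \<Psi> (0, \<xi>)"
      using bdry[of \<xi>] by (simp add: U_eps_def)
    also have "\<dots> \<le> (LINT \<tau>|lborel. indicator {0..T} \<tau> *\<^sub>R
      (\<eta> (apply_bcontfun (u (\<tau> / \<epsilon>\<^sup>2)) ?j) * d_tau \<Psi> (\<tau>, \<xi>) +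
       (N (Phi' \<kappa> (apply_bcontfun (u (\<tau> / \<epsilon>\<^sup>2)) (?j + 1))) + N (Phi' \<kappa> (apply_bcontfun (u (\<tau> / \<epsilon>\<^sup>2)) (?j - 1)))
        - 2 * N (Phi' \<kappa> (apply_bcontfun (u (\<tau> / \<epsilon>\<^sup>2)) ?j))) / \<epsilon>\<^sup>2 * \<Psi> (\<tau>, \<xi>)))"
      by (rule lattice_entropy_slice[OF \<kappa> sol \<epsilon> T N \<mu> \<eta> smooth_has_tau_derivative[OF s\<Psi>(1)] c\<psi>' \<psi>T conv])
    also have "\<dots> = (LINT \<tau>|lborel. G (\<tau>, \<xi>))"
    proof (rule Bochner_Integration.integral_cong[OF refl])
      fix \<tau> :: real
      show "indicator {0..T} \<tau> *\<^sub>R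
        (\<eta> (apply_bcontfun (u (\<tau> / \<epsilon>\<^sup>2)) ?j) * d_tau \<Psi> (\<tau>, \<xi>) +
         (N (Phi' \<kappa> (apply_bcontfun (u (\<tau> / \<epsilon>\<^sup>2)) (?j + 1))) + N (Phi' \<kappa> (apply_bcontfun (u (\<tau> / \<epsilon>\<^sup>2)) (?j - 1)))
          - 2 * N (Phi' \<kappa> (apply_bcontfun (u (\<tau> / \<epsilon>\<^sup>2)) ?j))) / \<epsilon>\<^sup>2 * \<Psi> (\<tau>, \<xi>)) = G (\<tau>, \<xi>)"
        by (cases "\<tau> \<in> {0..T}"; simp add: G_def A_def B_def NP_def U_ext_def cell_shift[OF \<epsilon>];
            simp add: algebra_simps)
    qed
    finally show "c * \<Psi> (0, \<xi>) \<le> (LINT \<tau>|lborel. G (\<tau>, \<xi>))" .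
  qed
  also have "\<dots> = integral\<^sup>L lborel G"
    using lborel_pair.integral_snd[of "\<lambda>x y. G (x, y)"] iG by (simp add: lborel_prod)
  also have "\<dots> = integral\<^sup>L lborel A + (integral\<^sup>L lborel (B \<epsilon>) + integral\<^sup>L lborel (B (- \<epsilon>)) - 2 * integral\<^sup>L lborel (B 0)) / \<epsilon>\<^sup>2"
    unfolding G_def[abs_def] using iA iB by simp
  also have "\<dots> = integral\<^sup>L lborel A + (integral\<^sup>L lborel (B' (- \<epsilon>)) + integral\<^sup>L lborel (B' \<epsilon>) - 2 * integral\<^sup>L lborel (B' 0)) / \<epsilon>\<^sup>2"
    by (simp add: shift)
  also have "\<dots> = (LINT z|lborel. A z + (B' (- \<epsilon>) z + B' \<epsilon> z - 2 * B' 0 z) / \<epsilon>\<^sup>2)"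
    using iA iB' by simp
  also have "\<dots> = (LINT z|lborel. indicator {0..T} (fst z) *
     (\<eta> (U_ext \<epsilon> u z) * d_tau \<Psi> z + N (Phi' \<kappa> (U_ext \<epsilon> u z)) *
        ((\<Psi> (fst z, snd z + \<epsilon>) + \<Psi> (fst z, snd z - \<epsilon>) - 2 * \<Psi> (fst z, snd z)) / \<epsilon>\<^sup>2)))"
  proof (rule Bochner_Integration.integral_cong[OF refl])
    fix z :: "real \<times> real"
    show "A z + (B' (- \<epsilon>) z + B' \<epsilon> z - 2 * B' 0 z) / \<epsilon>\<^sup>2 = indicator {0..T} (fst z) *
     (\<eta> (U_ext \<epsilon> u z) * d_tau \<Psi> z + N (Phi' \<kappa> (U_ext \<epsilon> u z)) *
        ((\<Psi> (fst z, snd z + \<epsilon>) + \<Psi> (fst z, snd z - \<epsilon>) - 2 * \<Psi> (fst z, snd z)) / \<epsilon>\<^sup>2))"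
      by (cases "fst z \<in> {0..T}") (simp_all add: A_def B'_def NP_def algebra_simps add_divide_distrib diff_divide_distrib)
  qed
  finally show ?thesis .
qed

lemma Omega_lebesgue: "Omega T \<in> sets lebesgue"
proof -
  have "closed (Omega T)" unfolding Omega_def by (intro closed_Times closed_atLeastAtMost closed_UNIV)
  then show ?thesis by (simp add: borel_closed)
qed

lemma integral_Omega_eq_strip:
  fixes F :: "real \<times> real \<Rightarrow> real"
  assumes "\<And>\<tau> \<xi>. R \<le> \<bar>\<xi>\<bar> \<Longrightarrow> F (\<tau>, \<xi>) = 0"
  shows "(LINT z|lebesgue_on (Omega T). F z) = (LINT z|lebesgue_on ({0..T} \<times> {-R..R}). F z)"
proof -
  have K: "{0..T} \<times> {-R..R} \<in> sets lebesgue"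
    using compact_imp_closed[OF compact_Times[OF compact_Icc[of 0 T] compact_Icc[of "-R" R]]]
    by (simp add: borel_closed)
  have "(LINT z|lebesgue_on (Omega T). F z) = (LINT z|lebesgue. indicator (Omega T) z *\<^sub>R F z)"
    by (rule integral_restrict_space) (simp add: Omega_lebesgue)
  also have "\<dots> = (LINT z|lebesgue. indicator ({0..T} \<times> {-R..R}) z *\<^sub>R F z)"
  proof (rule Bochner_Integration.integral_cong[OF refl])
    fix z :: "real \<times> real"
    show "indicator (Omega T) z *\<^sub>R F z = indicator ({0..T} \<times> {-R..R}) z *\<^sub>R F z"
    proof (cases "R \<le> \<bar>snd z\<bar>")
      case True
      then have "F z = 0" using assms[of "snd z" "fst z"] by simp
      then show ?thesis by simp
    qed (auto simp: indicator_def Omega_def)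
  qed
  also have "\<dots> = (LINT z|lebesgue_on ({0..T} \<times> {-R..R}). F z)"
    by (rule integral_restrict_space[symmetric]) (simp add: K)
  finally show ?thesis .
qed

text \<open>The data enter only through the Lipschitz functions \<open>\<eta>\<close> and \<open>N\<close>, multiplied by uniformly convergent
  factors; strong convergence in \<open>L\<^sup>1\<close> therefore suffices for the passage to the limit, and the
  gradients of \<open>P_eps\<close> do not occur.

  The hypothesis \<open>conv\<close> holds for convex \<open>N\<close> if \<open>\<Psi> \<ge> 0\<close>, and for linear \<open>N\<close> with equality and
  without a sign of \<open>\<Psi>\<close>. The hypothesis \<open>bdry\<close> controls the contribution of the initial data
  when \<open>\<Psi>\<close> does not vanish at time 0.\<close>
lemma lattice_entropy_limit:
  fixes N \<mu> \<eta> :: "real \<Rightarrow> real" and \<Psi> :: "real \<times> real \<Rightarrow> real"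
  assumes \<kappa>: "0 < \<kappa>" and T: "0 < T" and e: "\<And>n. 0 < e n" "e \<longlonglongrightarrow> 0"
    and sol: "\<And>n. solves_lattice \<kappa> (u n)"
    and U: "Ls_loc_tendsto 1 (Omega T) (\<lambda>n. U_eps (e n) (u n)) U"
    and P: "Ls_loc_tendsto 1 (Omega T) (\<lambda>n. P_eps \<kappa> (e n) (u n)) P"
    and N: "L1-lipschitz_on UNIV N" and \<mu>: "continuous_on UNIV \<mu>"
    and \<eta>: "\<And>v. (\<eta> has_real_derivative \<mu> (Phi' \<kappa> v)) (at v)" "L2-lipschitz_on UNIV \<eta>"
    and \<Psi>: "test_function ({..<T} \<times> UNIV) \<Psi>"
    and conv: "\<And>z a b. 0 \<le> \<Psi> z * (N b - N a - \<mu> a * (b - a))"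
    and bdry: "\<forall>\<^sub>F n in sequentially. \<forall>\<xi>. c * \<Psi> (0, \<xi>) \<le> - \<eta> (U_eps (e n) (u n) (0, \<xi>)) * \<Psi> (0, \<xi>)"
  shows "c * (LINT \<xi>|lborel. \<Psi> (0, \<xi>)) \<le>
    (LINT z|lebesgue_on (Omega T). \<eta> (U z) * d_tau \<Psi> z + N (P z) * d_xi (d_xi \<Psi>) z)"
proof -
  let ?H = "d_xi (d_xi \<Psi>)"
  have tH: "test_function ({..<T} \<times> UNIV) ?H" by (intro test_function_d_xi \<Psi>)
  have tt: "test_function ({..<T} \<times> UNIV) (d_tau \<Psi>)" by (intro test_function_d_tau \<Psi>)
  obtain R1 where R1: "0 < R1" "\<And>\<tau> \<xi>. R1 \<le> \<bar>\<tau>\<bar> \<or> R1 \<le> \<bar>\<xi>\<bar> \<Longrightarrow> \<Psi> (\<tau>, \<xi>) = 0"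
    using test_function_support_box[OF \<Psi>] by metis
  obtain R2 where R2: "0 < R2" "\<And>\<tau> \<xi>. R2 \<le> \<bar>\<tau>\<bar> \<or> R2 \<le> \<bar>\<xi>\<bar> \<Longrightarrow> d_tau \<Psi> (\<tau>, \<xi>) = 0"
    using test_function_support_box[OF tt] by metis
  obtain R3 where R3: "0 < R3" "\<And>\<tau> \<xi>. R3 \<le> \<bar>\<tau>\<bar> \<or> R3 \<le> \<bar>\<xi>\<bar> \<Longrightarrow> ?H (\<tau>, \<xi>) = 0"
    using test_function_support_box[OF tH] by metis
  define R where "R = R1 + R2 + R3 + 1"
  define K where "K = {0..T} \<times> {-R..R}"
  let ?M = "lebesgue_on K"
  have K: "compact K" "K \<subseteq> Omega T" "K \<in> sets lebesgue"
  proof -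
    show 1: "compact K" unfolding K_def by (intro compact_Times compact_Icc)
    show "K \<subseteq> Omega T" by (auto simp: K_def Omega_def)
    show "K \<in> sets lebesgue" using compact_imp_closed[OF 1] by (simp add: borel_closed)
  qed
  have fin: "finite_measure ?M"
    using K(1) by (intro finite_measure_lebesgue_on lmeasurable_compact)
  have borel_M: "f \<in> borel_measurable ?M" if "f \<in> borel_measurable borel" for f :: "real \<times> real \<Rightarrow> real"
    using that by (intro measurable_restrict_space1 measurable_completion) simp
  define D where "D n z = (\<Psi> (fst z, snd z + e n) + \<Psi> (fst z, snd z - e n) - 2 * \<Psi> (fst z, snd z)) / (e n)\<^sup>2" for n z
  have D_borel: "D n \<in> borel_measurable borel" for n
  proof -
    have "continuous_on UNIV (\<lambda>z. \<Psi> (fst z, snd z + r))" for r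
      using \<Psi> by (intro continuous_on_compose2[OF smooth_continuous_on[of \<Psi> UNIV]] continuous_intros)
        (auto simp: test_function_def)
    from this[of "e n"] this[of "- e n"] this[of 0] have "continuous_on UNIV (D n)"
      unfolding D_def[abs_def] using e(1)[of n] by (intro continuous_intros) auto
    then show ?thesis by (rule borel_measurable_continuous_onI)
  qed
  note LU = Lipschitz_compose_L1[OF \<eta>(2) fin Ls_loc_1_tendsto_L1(2,3)[OF U K(1,2)] Ls_loc_1_tendsto_L1(1)[OF U K(1,2)]]
  note LP = Lipschitz_compose_L1[OF N fin Ls_loc_1_tendsto_L1(2,3)[OF P K(1,2)] Ls_loc_1_tendsto_L1(1)[OF P K(1,2)]]
  obtain C1 where C1: "\<And>z. \<bar>d_tau \<Psi> z\<bar> \<le> C1" using test_function_bounded[OF tt] by blast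
  obtain C2 where C2: "\<And>z. \<bar>?H z\<bar> \<le> C2" using test_function_bounded[OF tH] by blast
  have lim1: "(\<lambda>n. LINT z|?M. \<eta> (U_eps (e n) (u n) z) * d_tau \<Psi> z) \<longlonglongrightarrow> (LINT z|?M. \<eta> (U z) * d_tau \<Psi> z)"
    by (rule tendsto_integral_mult_L1_uniform[OF LU(2,1,3) _ _ C1])
       (auto intro!: borel_M test_function_borel[OF tt])
  have small: "\<forall>\<^sub>F n in sequentially. e n < r" if "0 < r" for r
    using order_tendstoD(2)[OF e(2) that] .
  have lim2: "(\<lambda>n. LINT z|?M. N (P_eps \<kappa> (e n) (u n) z) * D n z) \<longlonglongrightarrow> (LINT z|?M. N (P z) * ?H z)"
  proof (rule tendsto_integral_mult_L1_uniform[OF LP(2,1,3) _ _ C2])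
    show "D n \<in> borel_measurable ?M" for n by (rule borel_M[OF D_borel])
    show "?H \<in> borel_measurable ?M" by (rule borel_M[OF test_function_borel[OF tH]])
    fix \<delta> :: real assume "0 < \<delta>"
    from second_difference_uniform[OF \<Psi> this]
    obtain \<epsilon>0 where \<epsilon>0: "\<epsilon>0 > 0" "\<And>\<epsilon> \<tau> \<xi>. 0 < \<epsilon> \<Longrightarrow> \<epsilon> < \<epsilon>0 \<Longrightarrow>
      \<bar>(\<Psi> (\<tau>, \<xi> + \<epsilon>) + \<Psi> (\<tau>, \<xi> - \<epsilon>) - 2 * \<Psi> (\<tau>, \<xi>)) / \<epsilon>\<^sup>2 - ?H (\<tau>, \<xi>)\<bar> \<le> \<delta>" by blast
    show "\<forall>\<^sub>F n in sequentially. \<forall>z\<in>space ?M. \<bar>D n z - ?H z\<bar> \<le> \<delta>"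
      using small[OF \<epsilon>0(1)]
    proof eventually_elim
      fix n assume n: "e n < \<epsilon>0"
      show "\<forall>z\<in>space ?M. \<bar>D n z - ?H z\<bar> \<le> \<delta>"
      proof
        fix z :: "real \<times> real"
        show "\<bar>D n z - ?H z\<bar> \<le> \<delta>" using \<epsilon>0(2)[OF e(1) n, of "fst z" "snd z"] by (simp add: D_def)
      qed
    qed
  qed
  have iU: "integrable ?M (\<lambda>z. \<eta> (U_eps (e n) (u n) z) * d_tau \<Psi> z)" for n
    by (rule integrable_mult_bounded[OF LU(2) borel_M[OF test_function_borel[OF tt]] C1])
  have DB: "\<exists>B. \<forall>z. \<bar>D n z\<bar> \<le> B" for n
  proof -
    obtain C where C: "\<And>z. \<bar>\<Psi> z\<bar> \<le> C" using test_function_bounded[OF \<Psi>] by blast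
    have "\<bar>D n z\<bar> \<le> (C + C + 2 * C) / (e n)\<^sup>2" for z
    proof -
      have "\<bar>\<Psi> (fst z, snd z + e n) + \<Psi> (fst z, snd z - e n) - 2 * \<Psi> (fst z, snd z)\<bar> \<le> C + C + 2 * C"
        using C[of "(fst z, snd z + e n)"] C[of "(fst z, snd z - e n)"] C[of "(fst z, snd z)"] by linarith
      then show ?thesis unfolding D_def by (simp add: abs_divide divide_right_mono)
    qed
    then show ?thesis by blast
  qed
  have iP: "integrable ?M (\<lambda>z. N (P_eps \<kappa> (e n) (u n) z) * D n z)" for n
  proof -
    obtain B where "\<And>z. \<bar>D n z\<bar> \<le> B" using DB by blast
    then show ?thesis by (rule integrable_mult_bounded[OF LP(2) borel_M[OF D_borel]])
  qed
  have lim: "(\<lambda>n. LINT z|?M. \<eta> (U_eps (e n) (u n) z) * d_tau \<Psi> z + N (P_eps \<kappa> (e n) (u n) z) * D n z) \<longlonglongrightarrow>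
      (LINT z|?M. \<eta> (U z) * d_tau \<Psi> z + N (P z) * ?H z)"
  proof -
    have "integrable ?M (\<lambda>z. \<eta> (U z) * d_tau \<Psi> z)" "integrable ?M (\<lambda>z. N (P z) * ?H z)"
      by (rule integrable_mult_bounded[OF LU(1) borel_M[OF test_function_borel[OF tt]] C1]
          integrable_mult_bounded[OF LP(1) borel_M[OF test_function_borel[OF tH]] C2])+
    then show ?thesis using tendsto_add[OF lim1 lim2] iU iP by simp
  qed
  have "\<forall>\<^sub>F n in sequentially. c * (LINT \<xi>|lborel. \<Psi> (0, \<xi>)) \<le>
      (LINT z|?M. \<eta> (U_eps (e n) (u n) z) * d_tau \<Psi> z + N (P_eps \<kappa> (e n) (u n) z) * D n z)"
    using bdry small[of 1, OF zero_less_one]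
  proof eventually_elim
    fix n assume b: "\<forall>\<xi>. c * \<Psi> (0, \<xi>) \<le> - \<eta> (U_eps (e n) (u n) (0, \<xi>)) * \<Psi> (0, \<xi>)" and n: "e n < 1"
    let ?f = "\<lambda>z. \<eta> (U_ext (e n) (u n) z) * d_tau \<Psi> z + N (Phi' \<kappa> (U_ext (e n) (u n) z)) * D n z"
    let ?F = "\<lambda>z. \<eta> (U_eps (e n) (u n) z) * d_tau \<Psi> z + N (P_eps \<kappa> (e n) (u n) z) * D n z"
    have "c * (LINT \<xi>|lborel. \<Psi> (0, \<xi>)) \<le> (LINT z|lborel. indicator {0..T} (fst z) * ?f z)"
      unfolding D_def
      by (rule lattice_entropy_weak[OF \<kappa> sol e(1) T lipschitz_on_continuous_on[OF N] \<mu> \<eta>(1) \<Psi> conv b[rule_format]])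
    also have "\<dots> = (LINT z|lebesgue. indicator {0..T} (fst z) * ?f z)"
    proof (rule integral_completion[symmetric])
      have [measurable]: "\<eta> \<in> borel_measurable borel" "N \<in> borel_measurable borel" "Phi' \<kappa> \<in> borel_measurable borel"
        "U_ext (e n) (u n) \<in> borel_measurable borel" "d_tau \<Psi> \<in> borel_measurable borel" "D n \<in> borel_measurable borel"
        using lipschitz_on_continuous_on[OF N] lipschitz_on_continuous_on[OF \<eta>(2)] continuous_on_Phi'[OF \<kappa>]
          borel_measurable_continuous_onI U_ext_borel[OF sol] test_function_borel[OF tt] D_borel by blast+
      have [measurable]: "fst \<in> borel_measurable (borel :: (real \<times> real) measure)"
        by (intro borel_measurable_continuous_onI continuous_intros)
      show "(\<lambda>z. indicator {0..T} (fst z) * ?f z) \<in> borel_measurable lborel" by measurable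
    qed
    also have "\<dots> = (LINT z|lebesgue. indicator K z *\<^sub>R ?F z)"
    proof (rule Bochner_Integration.integral_cong[OF refl])
      fix z :: "real \<times> real"
      obtain \<tau> \<xi> where z: "z = (\<tau>, \<xi>)" by (cases z)
      show "indicator {0..T} (fst z) * ?f z = indicator K z *\<^sub>R ?F z"
      proof (cases "\<tau> \<in> {0..T}")
        case True
        then have f: "?f z = ?F z" by (simp add: z U_ext_eq P_eps_eq)
        show ?thesis
        proof (cases "\<xi> \<in> {-R..R}")
          case 1: False
          then have "R \<le> \<bar>\<xi>\<bar>" by auto
          then have "R1 \<le> \<bar>\<xi> + e n\<bar>" "R1 \<le> \<bar>\<xi> - e n\<bar>" "R1 \<le> \<bar>\<xi>\<bar>" "R2 \<le> \<bar>\<xi>\<bar>"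
            using e(1)[of n] n R1(1) R2(1) R3(1) unfolding R_def by arith+
          then have "d_tau \<Psi> z = 0" "D n z = 0" using R1(2) R2(2) by (simp_all add: z D_def)
          then show ?thesis by simp
        qed (use True f in \<open>simp add: z K_def\<close>)
      qed (auto simp: z K_def indicator_def)
    qed
    also have "\<dots> = (LINT z|?M. ?F z)" using K(3) by (simp add: integral_restrict_space)
    finally show "c * (LINT \<xi>|lborel. \<Psi> (0, \<xi>)) \<le> (LINT z|?M. ?F z)" .
  qed
  from tendsto_lowerbound[OF lim this] have "c * (LINT \<xi>|lborel. \<Psi> (0, \<xi>)) \<le> (LINT z|?M. \<eta> (U z) * d_tau \<Psi> z + N (P z) * ?H z)"
    by simp
  also have "\<dots> = (LINT z|lebesgue_on (Omega T). \<eta> (U z) * d_tau \<Psi> z + N (P z) * ?H z)"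
    unfolding K_def by (rule integral_Omega_eq_strip[symmetric]) (use R1(1) R2 R3 in \<open>auto simp: R_def\<close>)
  finally show ?thesis .
qed

section \<open>Null sets of the space-time strip\<close>

lemma Linf_tendsto_AE:
  assumes "Linf_tendsto A f g"
  shows "AE x in lebesgue_on A. (\<lambda>n. f n x) \<longlonglongrightarrow> g x"
proof -
  define s where "s n = esssup (lebesgue_on A) (\<lambda>x. ereal \<bar>f n x - g x\<bar>)" for n
  have s: "s \<longlonglongrightarrow> 0" using assms unfolding Linf_tendsto_def s_def .
  have "AE x in lebesgue_on A. \<forall>n. ereal \<bar>f n x - g x\<bar> \<le> s n"
    unfolding AE_all_countable s_def by (intro allI esssup_AE)
  then show ?thesis
  proof eventually_elim
    fix x assume x: "\<forall>n. ereal \<bar>f n x - g x\<bar> \<le> s n"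
    have "(\<lambda>n. ereal \<bar>f n x - g x\<bar>) \<longlonglongrightarrow> 0"
      by (rule tendsto_sandwich[where f="\<lambda>_. 0" and h=s]) (use x s in auto)
    then have "(\<lambda>n. ereal \<bar>f n x - g x\<bar>) \<longlonglongrightarrow> ereal 0" by (simp add: zero_ereal_def)
    then have "(\<lambda>n. \<bar>f n x - g x\<bar>) \<longlonglongrightarrow> 0" by (simp only: lim_ereal)
    then show "(\<lambda>n. f n x) \<longlonglongrightarrow> g x" by (simp add: tendsto_rabs_zero_iff LIM_zero_iff)
  qed
qed

lemma AE_lebesgue_on_iff:
  "S \<in> sets lebesgue \<Longrightarrow> (AE x in lebesgue_on S. Q x) \<longleftrightarrow> (AE x in lebesgue. x \<in> S \<longrightarrow> Q x)"
  by (simp add: AE_restrict_space_iff)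

lemma AE_Omega_fst:
  assumes "AE \<tau> in lebesgue_on {0..T}. Q \<tau>"
  shows "AE z in lebesgue_on (Omega T). Q (fst z)"
proof -
  have "AE \<tau> in lebesgue. \<tau> \<in> {0..T} \<longrightarrow> Q \<tau>"
    using assms by (subst (asm) AE_lebesgue_on_iff) auto
  then obtain N where N: "N \<in> null_sets lebesgue" "{\<tau>. \<not> (\<tau> \<in> {0..T} \<longrightarrow> Q \<tau>)} \<subseteq> N"
    unfolding eventually_ae_filter by auto
  obtain N' where N': "N' \<in> null_sets lborel" "N \<subseteq> N'"
    using N(1)[unfolded null_sets_completion_iff2] by blast
  have "N' \<times> UNIV \<in> null_sets (lborel \<Otimes>\<^sub>M (lborel :: real measure))"
    using N'(1) by (intro lborel.times_in_null_sets1) auto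
  then have "N' \<times> UNIV \<in> null_sets (lebesgue :: (real \<times> real) measure)"
    unfolding lborel_prod by (rule null_sets_completionI)
  then have "AE z in lebesgue. z \<in> Omega T \<longrightarrow> Q (fst z)"
    by (rule AE_I') (use N(2) N'(2) in \<open>auto simp: Omega_def\<close>)
  then show ?thesis by (simp add: AE_lebesgue_on_iff[OF Omega_lebesgue])
qed

text \<open>The interior of the strip is dense in the strip, and nonempty open sets are not negligible.\<close>
lemma AE_Omega_dense:
  assumes T: "0 < T" and ae: "AE z in lebesgue_on (Omega T). Q z"
    and S: "open S" "z0 \<in> S" "z0 \<in> Omega T"
  obtains z where "z \<in> S" "z \<in> Omega T" "Q z"
proof -
  have "\<exists>z\<in>S \<inter> Omega T. Q z"
  proof (rule ccontr)
    assume no: "\<not> ?thesis"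
    let ?I = "{0<..<T} \<times> (UNIV :: real set)"
    have "closure ?I = Omega T" using T by (simp add: closure_Times Omega_def)
    then have "S \<inter> closure ?I \<noteq> {}" using S by auto
    then have "S \<inter> ?I \<noteq> {}" using open_Int_closure_eq_empty[OF S(1)] by blast
    moreover have "open (S \<inter> ?I)" using S(1) by (intro open_Int open_Times) auto
    ultimately have "\<not> negligible (S \<inter> ?I)" using open_not_negligible by blast
    moreover have "AE z in lebesgue. z \<in> Omega T \<longrightarrow> Q z"
      using ae by (simp add: AE_lebesgue_on_iff[OF Omega_lebesgue])
    then obtain N where N: "N \<in> null_sets lebesgue" "{z. \<not> (z \<in> Omega T \<longrightarrow> Q z)} \<subseteq> N"
      unfolding eventually_ae_filter by auto
    have "S \<inter> ?I \<subseteq> N" using no N(2) by (auto simp: Omega_def)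
    then have "negligible (S \<inter> ?I)" using N(1) negligible_subset by (simp add: negligible_iff_null_sets[symmetric])
    ultimately show False by simp
  qed
  then show thesis using that by blast
qed

text \<open>A bound that holds almost everywhere on the relatively open set \<open>{g > 0}\<close> extends to all of its
  points if the bounded function is continuous.\<close>
lemma AE_relatively_open_bound:
  fixes f g :: "real \<times> real \<Rightarrow> real"
  assumes T: "0 < T" and f: "continuous_on (Omega T) f" and g: "continuous_on (Omega T) g"
    and ae: "AE z in lebesgue_on (Omega T). 0 < g z \<longrightarrow> 0 \<le> f z"
    and z: "z \<in> Omega T" "0 < g z"
  shows "0 \<le> f z"
proof (rule ccontr)
  assume neg: "\<not> 0 \<le> f z"
  have 1: "openin (top_of_set (Omega T)) (Omega T \<inter> f -` {..<0})"
    by (rule continuous_openin_preimage_gen[OF f]) simp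
  have 2: "openin (top_of_set (Omega T)) (Omega T \<inter> g -` {0<..})"
    by (rule continuous_openin_preimage_gen[OF g]) simp
  obtain S where S: "open S" "(Omega T \<inter> f -` {..<0}) \<inter> (Omega T \<inter> g -` {0<..}) = S \<inter> Omega T"
    using openin_Int[OF 1 2] unfolding openin_open by blast
  have "z \<in> S" using S(2) z neg by auto
  then obtain z' where z': "z' \<in> S" "z' \<in> Omega T" "0 < g z' \<longrightarrow> 0 \<le> f z'"
    using AE_Omega_dense[OF T ae S(1) _ z(1)] by blast
  then have "z' \<in> (Omega T \<inter> f -` {..<0}) \<inter> (Omega T \<inter> g -` {0<..})" using S(2) by blast
  then show False using z'(3) by auto
qed

lemma locally_Hoelder_continuous_on:
  assumes "locally_Hoelder_on (Omega T) P"
  shows "continuous_on (Omega T) P"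
  unfolding continuous_on_def
proof
  fix z assume z: "z \<in> Omega T"
  define K where "K = Omega T \<inter> cball z 1"
  have "closed (Omega T)" unfolding Omega_def by (intro closed_Times closed_atLeastAtMost closed_UNIV)
  then have "compact K" unfolding K_def by (intro closed_Int_compact) auto
  then obtain \<gamma> C where C: "0 < \<gamma>" "\<And>x y. x \<in> K \<Longrightarrow> y \<in> K \<Longrightarrow> \<bar>P x - P y\<bar> \<le> C * dist x y powr \<gamma>"
    using assms unfolding locally_Hoelder_on_def K_def by (metis Int_lower1)
  have "((\<lambda>x. dist x z powr \<gamma>) \<longlongrightarrow> 0 powr \<gamma>) (at z within Omega T)"
    using C(1) by (intro tendsto_intros tendsto_dist[of "\<lambda>x. x" z _ "\<lambda>_. z" z, simplified]) auto
  then have lim: "((\<lambda>x. C * dist x z powr \<gamma>) \<longlongrightarrow> 0) (at z within Omega T)"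
    using tendsto_mult_right_zero by fastforce
  have "\<forall>\<^sub>F x in at z within Omega T. norm (P x - P z) \<le> C * dist x z powr \<gamma>"
    unfolding eventually_at
  proof (intro exI[of _ 1] conjI ballI impI)
    fix x assume "x \<in> Omega T" "x \<noteq> z \<and> dist x z < 1"
    then have "x \<in> K" "z \<in> K" using z by (auto simp: K_def dist_commute)
    then show "norm (P x - P z) \<le> C * dist x z powr \<gamma>" using C(2) by simp
  qed simp
  then have "((\<lambda>x. P x - P z) \<longlongrightarrow> 0) (at z within Omega T)"
    by (rule Lim_null_comparison[OF _ lim])
  then show "(P \<longlongrightarrow> P z) (at z within Omega T)" by (simp add: LIM_zero_iff)
qed

lemma test_function_mono: "test_function A \<Psi> \<Longrightarrow> A \<subseteq> B \<Longrightarrow> test_function B \<Psi>"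
  unfolding test_function_def by (meson subset_trans)

section \<open>Phases of the limit, free boundary problem\<close>

locale single_interface_limit =
  fixes \<kappa> T \<alpha> \<beta> :: real and e :: "nat \<Rightarrow> real" and u :: "real \<Rightarrow> real \<Rightarrow> linf"
    and ts :: "real \<Rightarrow> nat \<Rightarrow> ereal" and U P DP M :: "real \<times> real \<Rightarrow> real" and \<Xi> :: "real \<Rightarrow> real"
  assumes \<kappa>: "0 < \<kappa>" and T: "0 < T"
    and sol: "\<And>\<epsilon>. 0 < \<epsilon> \<Longrightarrow> single_interface_solution \<kappa> (u \<epsilon>) (ts \<epsilon>)"
    and initial: "\<And>\<epsilon>. 0 < \<epsilon> \<Longrightarrow> well_prepared \<kappa> \<alpha> \<beta> \<epsilon> (u \<epsilon> 0)"
    and e_pos: "\<And>n. 0 < e n" and e_lim: "e \<longlonglongrightarrow> 0"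
    and limit: "macroscopic_limit \<kappa> T e u ts U P DP M \<Xi>"
begin

abbreviation "U_n n \<equiv> U_eps (e n) (u (e n))"
abbreviation "P_n n \<equiv> P_eps \<kappa> (e n) (u (e n))"
abbreviation "M_n n \<equiv> M_eps \<kappa> (e n) (u (e n)) (ts (e n))"

lemma lattice: "solves_lattice \<kappa> (u (e n))"
  using sol[OF e_pos] by (simp add: single_interface_solution_def)

lemma
  shows U_lim: "Ls_loc_tendsto 1 (Omega T) U_n U" and P_lim: "Ls_loc_tendsto 1 (Omega T) P_n P"
    and M_lim: "Ls_loc_tendsto 1 (Omega T) M_n M"
  using limit unfolding macroscopic_limit_def by auto

lemma P_continuous: "continuous_on (Omega T) P"
  using limit unfolding macroscopic_limit_def by (auto intro: locally_Hoelder_continuous_on)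

lemma Xi_Lipschitz: "\<exists>L. L-lipschitz_on {0..T} \<Xi>"
  using limit unfolding macroscopic_limit_def by auto

lemma Xi_continuous: "continuous_on {0..T} \<Xi>"
  using Xi_Lipschitz lipschitz_on_continuous_on by blast

lemma Xi_fst_continuous: "continuous_on (Omega T) (\<lambda>z. \<Xi> (fst z))"
  by (rule continuous_on_compose2[OF Xi_continuous]) (auto intro!: continuous_intros simp: Omega_def)

lemma interface_AE:
  "AE \<tau> in lebesgue_on {0..T}. (\<lambda>n. Xi_star (e n) (ts (e n)) \<tau>) \<longlonglongrightarrow> \<Xi> \<tau> \<and>
     (\<lambda>n. Xi_sharp \<kappa> (e n) (u (e n)) (ts (e n)) \<tau>) \<longlonglongrightarrow> \<Xi> \<tau>"
proof -
  have "Linf_tendsto {0..T} (\<lambda>n. Xi_star (e n) (ts (e n))) \<Xi>"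
    "Linf_tendsto {0..T} (\<lambda>n. Xi_sharp \<kappa> (e n) (u (e n)) (ts (e n))) \<Xi>"
    using limit unfolding macroscopic_limit_def by auto
  from this[THEN Linf_tendsto_AE] show ?thesis by (rule AE_conjI)
qed

text \<open>What survives in the limit of the phase structure of the lattice at a point off the interface.\<close>
definition phase_separated :: "real \<times> real \<Rightarrow> bool" where
  "phase_separated z \<longleftrightarrow>
     (snd z < \<Xi> (fst z) \<longrightarrow> u_star \<kappa> \<le> U z \<and> P z = U z - 1 \<and> M z = 1) \<and>
     (\<Xi> (fst z) < snd z \<longrightarrow> - u_dstar \<kappa> \<le> U z \<and> U z \<le> - u_star \<kappa> \<and> P z = U z + 1 \<and> M z = - 1)"

text \<open>At a point to the left of \<open>\<Xi>(\<tau>)\<close> the lattice data belong, for all large indices, to particles to the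
  left of the interface, where \<open>p = u - 1\<close>; on the other side \<open>p = u + 1\<close>. The inequalities and
  the linear relations pass to the limit.\<close>
lemma phase_separated_limit:
  assumes \<tau>: "0 \<le> \<tau>" and r: "strict_mono r"
    and star: "(\<lambda>n. Xi_star (e n) (ts (e n)) \<tau>) \<longlonglongrightarrow> \<Xi> \<tau>"
    and sharp: "(\<lambda>n. Xi_sharp \<kappa> (e n) (u (e n)) (ts (e n)) \<tau>) \<longlonglongrightarrow> \<Xi> \<tau>"
    and UU: "(\<lambda>n. U_n (r n) (\<tau>, \<xi>)) \<longlonglongrightarrow> U (\<tau>, \<xi>)" and PP: "(\<lambda>n. P_n (r n) (\<tau>, \<xi>)) \<longlonglongrightarrow> P (\<tau>, \<xi>)"
    and MM: "(\<lambda>n. M_n (r n) (\<tau>, \<xi>)) \<longlonglongrightarrow> M (\<tau>, \<xi>)"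
  shows "phase_separated (\<tau>, \<xi>)"
proof -
  have sub: "(\<lambda>n. f (r n)) \<longlonglongrightarrow> l" if "f \<longlonglongrightarrow> l" for f :: "nat \<Rightarrow> real" and l
    using LIMSEQ_subseq_LIMSEQ[OF that r] by (simp add: o_def)
  let ?S = "\<lambda>n. Xi_star (e n) (ts (e n)) \<tau>" and ?H = "\<lambda>n. Xi_sharp \<kappa> (e n) (u (e n)) (ts (e n)) \<tau>"
  have us: "0 < u_star \<kappa>" using \<kappa> by (rule u_star_pos)
  show ?thesis
    unfolding phase_separated_def fst_conv snd_conv
  proof (intro conjI[of "_ \<longrightarrow> _"] impI)
    assume \<xi>: "\<xi> < \<Xi> \<tau>"
    have "(\<lambda>n. ?S n - e n) \<longlonglongrightarrow> \<Xi> \<tau> - 0" by (intro tendsto_diff star e_lim)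
    then have "\<forall>\<^sub>F n in sequentially. \<xi> < ?S n - e n" using order_tendstoD(1) \<xi> by fastforce
    moreover have "\<forall>\<^sub>F n in sequentially. \<xi> < ?H n" using order_tendstoD(1)[OF sharp \<xi>] .
    ultimately have "\<forall>\<^sub>F n in sequentially. u_star \<kappa> \<le> U_n n (\<tau>, \<xi>) \<and> P_n n (\<tau>, \<xi>) = U_n n (\<tau>, \<xi>) - 1 \<and> M_n n (\<tau>, \<xi>) = 1"
    proof eventually_elim
      fix n assume n: "\<xi> < ?S n - e n" "\<xi> < ?H n"
      have "u_star \<kappa> \<le> U_n n (\<tau>, \<xi>)" by (rule U_eps_phases(1)[OF sol[OF e_pos] \<kappa> e_pos \<tau> n(1)])
      then show "u_star \<kappa> \<le> U_n n (\<tau>, \<xi>) \<and> P_n n (\<tau>, \<xi>) = U_n n (\<tau>, \<xi>) - 1 \<and> M_n n (\<tau>, \<xi>) = 1"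
        using n us e_pos[of n] by (auto simp: P_eps_eq Phi'_def M_eps_def)
    qed
    then have ev: "\<forall>\<^sub>F n in sequentially. u_star \<kappa> \<le> U_n (r n) (\<tau>, \<xi>) \<and> P_n (r n) (\<tau>, \<xi>) = U_n (r n) (\<tau>, \<xi>) - 1 \<and> M_n (r n) (\<tau>, \<xi>) = 1"
      by (rule eventually_subseq[OF r])
    have "u_star \<kappa> \<le> U (\<tau>, \<xi>)"
      by (rule tendsto_lowerbound[OF UU eventually_mono[OF ev]]) auto
    moreover have "(\<lambda>n. U_n (r n) (\<tau>, \<xi>) - 1) \<longlonglongrightarrow> P (\<tau>, \<xi>)"
      by (rule Lim_transform_eventually[OF PP eventually_mono[OF ev]]) auto
    then have "P (\<tau>, \<xi>) = U (\<tau>, \<xi>) - 1"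
      using LIMSEQ_unique tendsto_diff[OF UU tendsto_const[of 1]] by blast
    moreover have "(\<lambda>n. 1) \<longlonglongrightarrow> M (\<tau>, \<xi>)"
      by (rule Lim_transform_eventually[OF MM eventually_mono[OF ev]]) auto
    then have "M (\<tau>, \<xi>) = 1" by (simp add: LIMSEQ_const_iff)
    ultimately show "u_star \<kappa> \<le> U (\<tau>, \<xi>) \<and> P (\<tau>, \<xi>) = U (\<tau>, \<xi>) - 1 \<and> M (\<tau>, \<xi>) = 1" by blast
  next
    assume \<xi>: "\<Xi> \<tau> < \<xi>"
    have "(\<lambda>n. ?S n + e n) \<longlonglongrightarrow> \<Xi> \<tau> + 0" by (intro tendsto_add star e_lim)
    then have "\<forall>\<^sub>F n in sequentially. ?S n + e n < \<xi>" using order_tendstoD(2) \<xi> by fastforce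
    moreover have "\<forall>\<^sub>F n in sequentially. ?H n < \<xi>" using order_tendstoD(2)[OF sharp \<xi>] .
    ultimately have "\<forall>\<^sub>F n in sequentially. - u_dstar \<kappa> \<le> U_n n (\<tau>, \<xi>) \<and> U_n n (\<tau>, \<xi>) \<le> - u_star \<kappa> \<and>
        P_n n (\<tau>, \<xi>) = U_n n (\<tau>, \<xi>) + 1 \<and> M_n n (\<tau>, \<xi>) = - 1"
    proof eventually_elim
      fix n assume n: "?S n + e n < \<xi>" "?H n < \<xi>"
      have "- u_dstar \<kappa> \<le> U_n n (\<tau>, \<xi>) \<and> U_n n (\<tau>, \<xi>) \<le> - u_star \<kappa>"
        by (rule U_eps_phases(2)[OF sol[OF e_pos] \<kappa> e_pos \<tau> n(1)])
      then show "- u_dstar \<kappa> \<le> U_n n (\<tau>, \<xi>) \<and> U_n n (\<tau>, \<xi>) \<le> - u_star \<kappa> \<and>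
        P_n n (\<tau>, \<xi>) = U_n n (\<tau>, \<xi>) + 1 \<and> M_n n (\<tau>, \<xi>) = - 1"
        using n by (auto simp: P_eps_eq Phi'_def M_eps_def)
    qed
    then have ev: "\<forall>\<^sub>F n in sequentially. - u_dstar \<kappa> \<le> U_n (r n) (\<tau>, \<xi>) \<and> U_n (r n) (\<tau>, \<xi>) \<le> - u_star \<kappa> \<and>
        P_n (r n) (\<tau>, \<xi>) = U_n (r n) (\<tau>, \<xi>) + 1 \<and> M_n (r n) (\<tau>, \<xi>) = - 1"
      by (rule eventually_subseq[OF r])
    have "- u_dstar \<kappa> \<le> U (\<tau>, \<xi>)"
      by (rule tendsto_lowerbound[OF UU eventually_mono[OF ev]]) auto
    moreover have "U (\<tau>, \<xi>) \<le> - u_star \<kappa>"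
      by (rule tendsto_upperbound[OF UU eventually_mono[OF ev]]) auto
    moreover have "(\<lambda>n. U_n (r n) (\<tau>, \<xi>) + 1) \<longlonglongrightarrow> P (\<tau>, \<xi>)"
      by (rule Lim_transform_eventually[OF PP eventually_mono[OF ev]]) auto
    then have "P (\<tau>, \<xi>) = U (\<tau>, \<xi>) + 1"
      using LIMSEQ_unique tendsto_add[OF UU tendsto_const[of 1]] by blast
    moreover have "(\<lambda>n. - 1) \<longlonglongrightarrow> M (\<tau>, \<xi>)"
      by (rule Lim_transform_eventually[OF MM eventually_mono[OF ev]]) auto
    then have "M (\<tau>, \<xi>) = - 1" by (simp add: LIMSEQ_const_iff)
    ultimately show "- u_dstar \<kappa> \<le> U (\<tau>, \<xi>) \<and> U (\<tau>, \<xi>) \<le> - u_star \<kappa> \<and> P (\<tau>, \<xi>) = U (\<tau>, \<xi>) + 1 \<and> M (\<tau>, \<xi>) = - 1"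
      by blast
  qed
qed

text \<open>On each compact part of the strip a common subsequence of the three fields converges almost
  everywhere; for almost every time the two interface curves converge along the whole sequence.\<close>
lemma phase_separated_AE: "AE z in lebesgue_on (Omega T). phase_separated z"
proof -
  have "AE z in lebesgue. z \<in> {0..T} \<times> {- real m..real m} \<longrightarrow> phase_separated z" for m
  proof -
    let ?K = "{0..T} \<times> {- real m..real m}"
    have K: "compact ?K" "?K \<subseteq> Omega T" by (auto simp: Omega_def intro!: compact_Times)
    have Ks: "?K \<in> sets lebesgue" using compact_imp_closed[OF K(1)] by (simp add: borel_closed)
    note LU = Ls_loc_1_tendsto_L1[OF U_lim K] note LP = Ls_loc_1_tendsto_L1[OF P_lim K]
    note LM = Ls_loc_1_tendsto_L1[OF M_lim K]
    define d where "d n z = \<bar>U_n n z - U z\<bar> + \<bar>P_n n z - P z\<bar> + \<bar>M_n n z - M z\<bar>" for n z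
    have "(LINT z|lebesgue_on ?K. norm (d n z)) = (LINT z|lebesgue_on ?K. \<bar>U_n n z - U z\<bar>) +
        (LINT z|lebesgue_on ?K. \<bar>P_n n z - P z\<bar>) + (LINT z|lebesgue_on ?K. \<bar>M_n n z - M z\<bar>)" for n
      unfolding d_def using LU(2,3) LP(2,3) LM(2,3) by simp
    moreover have "(\<lambda>n. (LINT z|lebesgue_on ?K. \<bar>U_n n z - U z\<bar>) +
        (LINT z|lebesgue_on ?K. \<bar>P_n n z - P z\<bar>) + (LINT z|lebesgue_on ?K. \<bar>M_n n z - M z\<bar>)) \<longlonglongrightarrow> 0 + 0 + 0"
      by (intro tendsto_add LU(1) LP(1) LM(1))
    ultimately have "(\<lambda>n. LINT z|lebesgue_on ?K. norm (d n z)) \<longlonglongrightarrow> 0" by simp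
    moreover have "integrable (lebesgue_on ?K) (d n)" for n
      unfolding d_def[abs_def] using LU(2,3) LP(2,3) LM(2,3) by simp
    ultimately obtain r where r: "strict_mono r" "AE z in lebesgue_on ?K. (\<lambda>n. d (r n) z) \<longlonglongrightarrow> 0"
      using tendsto_L1_AE_subseq by blast
    have "AE z in lebesgue. z \<in> ?K \<longrightarrow> (\<lambda>n. d (r n) z) \<longlonglongrightarrow> 0"
      using r(2) unfolding AE_lebesgue_on_iff[OF Ks] .
    moreover have "AE z in lebesgue. z \<in> Omega T \<longrightarrow> (\<lambda>n. Xi_star (e n) (ts (e n)) (fst z)) \<longlonglongrightarrow> \<Xi> (fst z) \<and>
      (\<lambda>n. Xi_sharp \<kappa> (e n) (u (e n)) (ts (e n)) (fst z)) \<longlonglongrightarrow> \<Xi> (fst z)"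
      using AE_Omega_fst[OF interface_AE] unfolding AE_lebesgue_on_iff[OF Omega_lebesgue] .
    ultimately show ?thesis
    proof eventually_elim
      fix z assume d: "z \<in> ?K \<longrightarrow> (\<lambda>n. d (r n) z) \<longlonglongrightarrow> 0"
        and x: "z \<in> Omega T \<longrightarrow> (\<lambda>n. Xi_star (e n) (ts (e n)) (fst z)) \<longlonglongrightarrow> \<Xi> (fst z) \<and>
          (\<lambda>n. Xi_sharp \<kappa> (e n) (u (e n)) (ts (e n)) (fst z)) \<longlonglongrightarrow> \<Xi> (fst z)"
      show "z \<in> ?K \<longrightarrow> phase_separated z"
      proof
        assume z: "z \<in> ?K"
        have dz: "(\<lambda>n. d (r n) z) \<longlonglongrightarrow> 0" using d z by blast
        have lims: "(\<lambda>n. f n) \<longlonglongrightarrow> l" if "\<And>n. \<bar>f n - l\<bar> \<le> d (r n) z" for f :: "nat \<Rightarrow> real" and l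
        proof -
          have "(\<lambda>n. f n - l) \<longlonglongrightarrow> 0"
            by (rule Lim_null_comparison[OF _ dz]) (use that in auto)
          then show ?thesis by (simp add: LIM_zero_iff)
        qed
        have zz: "z = (fst z, snd z)" by simp
        have "phase_separated (fst z, snd z)"
        proof (rule phase_separated_limit[OF _ r(1)])
          show "0 \<le> fst z" using z by auto
          show "(\<lambda>n. Xi_star (e n) (ts (e n)) (fst z)) \<longlonglongrightarrow> \<Xi> (fst z)"
            "(\<lambda>n. Xi_sharp \<kappa> (e n) (u (e n)) (ts (e n)) (fst z)) \<longlonglongrightarrow> \<Xi> (fst z)"
            using x z K(2) by blast+
          show "(\<lambda>n. U_n (r n) (fst z, snd z)) \<longlonglongrightarrow> U (fst z, snd z)"
            "(\<lambda>n. P_n (r n) (fst z, snd z)) \<longlonglongrightarrow> P (fst z, snd z)"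
            "(\<lambda>n. M_n (r n) (fst z, snd z)) \<longlonglongrightarrow> M (fst z, snd z)"
            by (rule lims, simp add: d_def)+
        qed
        then show "phase_separated z" by simp
      qed
    qed
  qed
  then have "AE z in lebesgue. \<forall>m. z \<in> {0..T} \<times> {- real m..real m} \<longrightarrow> phase_separated z"
    unfolding AE_all_countable by blast
  then have "AE z in lebesgue. z \<in> Omega T \<longrightarrow> phase_separated z"
  proof eventually_elim
    fix z assume all: "\<forall>m. z \<in> {0..T} \<times> {- real m..real m} \<longrightarrow> phase_separated z"
    obtain m where "\<bar>snd z\<bar> \<le> real m" using real_arch_simple by blast
    then have "z \<in> Omega T \<longrightarrow> z \<in> {0..T} \<times> {- real m..real m}" by (auto simp: Omega_def abs_le_iff)
    then show "z \<in> Omega T \<longrightarrow> phase_separated z" using all by blast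
  qed
  then show ?thesis by (simp add: AE_lebesgue_on_iff[OF Omega_lebesgue])
qed

lemma p_star_eq: "u_star \<kappa> = 1 - p_star \<kappa>" "u_dstar \<kappa> = 1 + p_star \<kappa>"
  using \<kappa> by (simp_all add: u_star_def p_star_def u_dstar_def field_simps)

text \<open>Almost everywhere the bounds are those of \<open>U\<close>, shifted by the relation between \<open>U\<close> and \<open>P\<close>;
  continuity of \<open>P\<close> and \<open>\<Xi>\<close> extends them to every point off the interface.\<close>
lemma P_bounds_open:
  assumes "\<tau> \<in> {0..T}"
  shows "\<xi> < \<Xi> \<tau> \<Longrightarrow> - p_star \<kappa> \<le> P (\<tau>, \<xi>)"
    and "\<Xi> \<tau> < \<xi> \<Longrightarrow> - p_star \<kappa> \<le> P (\<tau>, \<xi>)" and "\<Xi> \<tau> < \<xi> \<Longrightarrow> P (\<tau>, \<xi>) \<le> p_star \<kappa>"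
proof -
  have z: "(\<tau>, \<xi>) \<in> Omega T" using assms by (simp add: Omega_def)
  have ae: "AE z in lebesgue_on (Omega T). (0 < \<Xi> (fst z) - snd z \<longrightarrow> 0 \<le> P z + p_star \<kappa>) \<and>
    (0 < snd z - \<Xi> (fst z) \<longrightarrow> 0 \<le> P z + p_star \<kappa>) \<and> (0 < snd z - \<Xi> (fst z) \<longrightarrow> 0 \<le> p_star \<kappa> - P z)"
    using phase_separated_AE by eventually_elim (auto simp: phase_separated_def p_star_eq)
  have c: "continuous_on (Omega T) (\<lambda>z. \<Xi> (fst z) - snd z)" "continuous_on (Omega T) (\<lambda>z. snd z - \<Xi> (fst z))"
    "continuous_on (Omega T) (\<lambda>z. P z + p_star \<kappa>)" "continuous_on (Omega T) (\<lambda>z. p_star \<kappa> - P z)"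
    by (intro continuous_intros Xi_fst_continuous P_continuous)+
  show "- p_star \<kappa> \<le> P (\<tau>, \<xi>)" if "\<xi> < \<Xi> \<tau>"
    using AE_relatively_open_bound[OF T c(3,1) eventually_mono[OF ae] z] that by simp
  show "- p_star \<kappa> \<le> P (\<tau>, \<xi>)" if "\<Xi> \<tau> < \<xi>"
    using AE_relatively_open_bound[OF T c(3,2) eventually_mono[OF ae] z] that by simp
  show "P (\<tau>, \<xi>) \<le> p_star \<kappa>" if "\<Xi> \<tau> < \<xi>"
    using AE_relatively_open_bound[OF T c(4,2) eventually_mono[OF ae] z] that by simp
qed

lemma P_slice_continuous:
  assumes "\<tau> \<in> {0..T}"
  shows "continuous_on UNIV (\<lambda>\<xi>. P (\<tau>, \<xi>))"
proof (rule continuous_on_compose2[OF P_continuous])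
  show "continuous_on UNIV (\<lambda>\<xi>. (\<tau>, \<xi>))" by (intro continuous_intros)
  show "(\<lambda>\<xi>. (\<tau>, \<xi>)) ` UNIV \<subseteq> Omega T" using assms by (auto simp: Omega_def)
qed

lemma P_slice_tendsto:
  assumes "\<tau> \<in> {0..T}"
  shows "((\<lambda>\<xi>. P (\<tau>, \<xi>)) \<longlongrightarrow> P (\<tau>, x)) (at x within S)"
proof (rule tendsto_within_subset[OF _ subset_UNIV])
  show "((\<lambda>\<xi>. P (\<tau>, \<xi>)) \<longlongrightarrow> P (\<tau>, x)) (at x)"
    using P_slice_continuous[OF assms] by (simp add: continuous_on_def)
qed

lemma P_bounds:
  assumes "\<tau> \<in> {0..T}"
  shows "\<xi> \<le> \<Xi> \<tau> \<Longrightarrow> - p_star \<kappa> \<le> P (\<tau>, \<xi>)"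
    and "\<Xi> \<tau> \<le> \<xi> \<Longrightarrow> P (\<tau>, \<xi>) \<in> {- p_star \<kappa>..p_star \<kappa>}"
proof -
  have right: "\<forall>\<^sub>F \<xi> in at_right (\<Xi> \<tau>). \<Xi> \<tau> < \<xi>"
    by (rule eventually_at_right_less)
  have at: "- p_star \<kappa> \<le> P (\<tau>, \<Xi> \<tau>)" "P (\<tau>, \<Xi> \<tau>) \<le> p_star \<kappa>"
  proof -
    show "- p_star \<kappa> \<le> P (\<tau>, \<Xi> \<tau>)"
      by (rule tendsto_lowerbound[OF P_slice_tendsto[OF assms, of "\<Xi> \<tau>" "{\<Xi> \<tau><..}"] eventually_mono[OF right]])
         (simp_all add: P_bounds_open(2)[OF assms])
    show "P (\<tau>, \<Xi> \<tau>) \<le> p_star \<kappa>"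
      by (rule tendsto_upperbound[OF P_slice_tendsto[OF assms, of "\<Xi> \<tau>" "{\<Xi> \<tau><..}"] eventually_mono[OF right]])
         (simp_all add: P_bounds_open(3)[OF assms])
  qed
  show "- p_star \<kappa> \<le> P (\<tau>, \<xi>)" if "\<xi> \<le> \<Xi> \<tau>"
    using P_bounds_open(1)[OF assms, of \<xi>] at that by (cases "\<xi> = \<Xi> \<tau>") auto
  show "P (\<tau>, \<xi>) \<in> {- p_star \<kappa>..p_star \<kappa>}" if "\<Xi> \<tau> \<le> \<xi>"
    using P_bounds_open(2,3)[OF assms, of \<xi>] at that by (cases "\<xi> = \<Xi> \<tau>") auto
qed

lemma interface_dense:
  assumes "\<tau>0 \<in> {0..T}" "0 < \<delta>"
  obtains \<tau> where "\<tau> \<in> {0..T}" "\<bar>\<tau> - \<tau>0\<bar> < \<delta>" "(\<lambda>n. Xi_star (e n) (ts (e n)) \<tau>) \<longlonglongrightarrow> \<Xi> \<tau>"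
proof -
  have 1: "(\<tau>0, 0::real) \<in> ball \<tau>0 \<delta> \<times> UNIV" "(\<tau>0, 0::real) \<in> Omega T" using assms by (auto simp: Omega_def)
  have 2: "open (ball \<tau>0 \<delta> \<times> (UNIV :: real set))" by (intro open_Times) auto
  obtain z where "z \<in> ball \<tau>0 \<delta> \<times> (UNIV :: real set)" "z \<in> Omega T"
    "(\<lambda>n. Xi_star (e n) (ts (e n)) (fst z)) \<longlonglongrightarrow> \<Xi> (fst z) \<and>
     (\<lambda>n. Xi_sharp \<kappa> (e n) (u (e n)) (ts (e n)) (fst z)) \<longlonglongrightarrow> \<Xi> (fst z)"
    by (rule AE_Omega_dense[OF T AE_Omega_fst[OF interface_AE] 2 1])
  then show thesis using that[of "fst z"] by (auto simp: Omega_def dist_real_def abs_minus_commute)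
qed

text \<open>Each lattice interface is nondecreasing in time, and it converges for a dense set of times.\<close>
lemma Xi_mono: "mono_on {0..T} \<Xi>"
proof (rule mono_onI, rule ccontr)
  fix \<tau> \<tau>' assume t: "\<tau> \<in> {0..T}" "\<tau>' \<in> {0..T}" "\<tau> \<le> \<tau>'" and "\<not> \<Xi> \<tau> \<le> \<Xi> \<tau>'"
  then have gap: "\<Xi> \<tau>' < \<Xi> \<tau>" "\<tau> < \<tau>'" by (auto simp: less_le)
  define g where "g = (\<Xi> \<tau> - \<Xi> \<tau>') / 2"
  have g: "0 < g" using gap by (simp add: g_def)
  have near: "\<exists>d>0. \<forall>s\<in>{0..T}. \<bar>s - t\<bar> < d \<longrightarrow> \<bar>\<Xi> s - \<Xi> t\<bar> < g" if "t \<in> {0..T}" for t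
    using Xi_continuous that g unfolding continuous_on_iff dist_real_def by blast
  obtain d where d: "d > 0" "\<And>s. s \<in> {0..T} \<Longrightarrow> \<bar>s - \<tau>\<bar> < d \<Longrightarrow> \<bar>\<Xi> s - \<Xi> \<tau>\<bar> < g" using near[OF t(1)] by blast
  obtain d' where d': "d' > 0" "\<And>s. s \<in> {0..T} \<Longrightarrow> \<bar>s - \<tau>'\<bar> < d' \<Longrightarrow> \<bar>\<Xi> s - \<Xi> \<tau>'\<bar> < g" using near[OF t(2)] by blast
  have "0 < min d ((\<tau>' - \<tau>) / 2)" "0 < min d' ((\<tau>' - \<tau>) / 2)" using d d' gap by auto
  obtain s where s: "s \<in> {0..T}" "\<bar>s - \<tau>\<bar> < min d ((\<tau>' - \<tau>) / 2)" "(\<lambda>n. Xi_star (e n) (ts (e n)) s) \<longlonglongrightarrow> \<Xi> s"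
    by (rule interface_dense[OF t(1) \<open>0 < min d ((\<tau>' - \<tau>) / 2)\<close>])
  obtain s' where s': "s' \<in> {0..T}" "\<bar>s' - \<tau>'\<bar> < min d' ((\<tau>' - \<tau>) / 2)" "(\<lambda>n. Xi_star (e n) (ts (e n)) s') \<longlonglongrightarrow> \<Xi> s'"
    by (rule interface_dense[OF t(2) \<open>0 < min d' ((\<tau>' - \<tau>) / 2)\<close>])
  have "\<bar>s - \<tau>\<bar> < (\<tau>' - \<tau>) / 2" "\<bar>s' - \<tau>'\<bar> < (\<tau>' - \<tau>) / 2"
    using s(2) s'(2) by (simp_all only: min_less_iff_conj)
  then have "s \<le> s'" by argo
  have "\<Xi> s \<le> \<Xi> s'"
  proof (rule LIMSEQ_le[OF s(3) s'(3)])
    show "\<exists>N. \<forall>n\<ge>N. Xi_star (e n) (ts (e n)) s \<le> Xi_star (e n) (ts (e n)) s'"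
      using Xi_star_mono[OF sol[OF e_pos] \<kappa> e_pos] s(1) \<open>s \<le> s'\<close> by auto
  qed
  moreover have "\<bar>\<Xi> s - \<Xi> \<tau>\<bar> < g" "\<bar>\<Xi> s' - \<Xi> \<tau>'\<bar> < g" using d(2) d'(2) s s' by auto
  ultimately show False unfolding g_def by argo
qed

lemma Xi_nonneg:
  assumes "\<tau> \<in> {0..T}" shows "0 \<le> \<Xi> \<tau>"
proof (rule ccontr)
  assume "\<not> 0 \<le> \<Xi> \<tau>"
  then have "0 < - \<Xi> \<tau>" by simp
  then obtain d where d: "d > 0" "\<And>s. s \<in> {0..T} \<Longrightarrow> \<bar>s - \<tau>\<bar> < d \<Longrightarrow> \<bar>\<Xi> s - \<Xi> \<tau>\<bar> < - \<Xi> \<tau>"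
    using Xi_continuous assms unfolding continuous_on_iff dist_real_def by metis
  obtain s where s: "s \<in> {0..T}" "\<bar>s - \<tau>\<bar> < d" "(\<lambda>n. Xi_star (e n) (ts (e n)) s) \<longlonglongrightarrow> \<Xi> s"
    by (rule interface_dense[OF assms d(1)])
  have "0 \<le> \<Xi> s"
    by (rule LIMSEQ_le_const[OF s(3)]) (use Xi_star_nonneg[OF sol[OF e_pos] \<kappa> _ e_pos] s(1) in auto)
  with d(2)[OF s(1,2)] show False by linarith
qed

text \<open>A monotone Lipschitz extension of the interface to all times.\<close>
definition Xi_clamped :: "real \<Rightarrow> real" where
  "Xi_clamped \<tau> = \<Xi> (max 0 (min T \<tau>))"

lemma Xi_clamped_eq: "\<tau> \<in> {0..T} \<Longrightarrow> Xi_clamped \<tau> = \<Xi> \<tau>"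
  by (simp add: Xi_clamped_def)

lemma Xi_clamped_mono: "mono Xi_clamped"
proof (rule monoI)
  fix s t :: real assume "s \<le> t"
  then show "Xi_clamped s \<le> Xi_clamped t"
    unfolding Xi_clamped_def using T by (intro mono_onD[OF Xi_mono]) (auto simp: min_def max_def)
qed

lemma Xi_clamped_Lipschitz: "\<exists>L. L-lipschitz_on UNIV Xi_clamped"
proof -
  obtain L where L: "L-lipschitz_on {0..T} \<Xi>" using Xi_Lipschitz by blast
  have "L-lipschitz_on UNIV Xi_clamped"
  proof (rule lipschitz_onI)
    show "0 \<le> L" using L by (rule lipschitz_on_nonneg)
    fix s t :: real
    have "dist (Xi_clamped s) (Xi_clamped t) \<le> L * dist (max 0 (min T s)) (max 0 (min T t))"
      unfolding Xi_clamped_def using T by (intro lipschitz_onD[OF L]) auto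
    also have "\<dots> \<le> L * dist s t"
      using \<open>0 \<le> L\<close> by (intro mult_left_mono) (auto simp: dist_real_def min_def max_def)
    finally show "dist (Xi_clamped s) (Xi_clamped t) \<le> L * dist s t" .
  qed
  then show ?thesis by blast
qed

lemma Xi_clamped_continuous: "continuous_on A Xi_clamped"
  using Xi_clamped_Lipschitz lipschitz_on_continuous_on continuous_on_subset subset_UNIV by metis

lemma DP_measurable_L2: "Ls_loc 2 (Omega T) DP"
  using limit unfolding macroscopic_limit_def L2_loc_weakly_tendsto_def by blast

lemma DP_slice: "\<tau> \<in> {0..T} \<Longrightarrow> weak_derivative (\<lambda>\<xi>. P (\<tau>, \<xi>)) (\<lambda>\<xi>. DP (\<tau>, \<xi>))"
  using limit unfolding macroscopic_limit_def by blast

lemma strip_compact: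
  fixes R :: real
  shows "compact ({0..T} \<times> {- R..R})" "{0..T} \<times> {- R..R} \<subseteq> Omega T"
  "{0..T} \<times> {- R..R} \<in> sets lebesgue"
proof -
  show 1: "compact ({0..T} \<times> {- R..R})" by (intro compact_Times compact_Icc)
  show "{0..T} \<times> {- R..R} \<subseteq> Omega T" by (auto simp: Omega_def)
  show "{0..T} \<times> {- R..R} \<in> sets lebesgue" using compact_imp_closed[OF 1] by (simp add: borel_closed)
qed

lemma strip_finite:
  fixes R :: real
  shows "finite_measure (lebesgue_on ({0..T} \<times> {- R..R}))"
  by (intro finite_measure_lebesgue_on lmeasurable_compact strip_compact)

lemma DP_integrable_strip: "integrable (lebesgue_on ({0..T} \<times> {- R..R})) DP"
proof -
  let ?M = "lebesgue_on ({0..T} \<times> {- R..R})"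
  have m: "DP \<in> borel_measurable ?M" by (rule Ls_loc_measurable_on[OF DP_measurable_L2 strip_compact(2)])
  have "(\<integral>\<^sup>+z. ennreal (\<bar>DP z\<bar> powr 2) \<partial>?M) < \<infinity>"
    using DP_measurable_L2 strip_compact[of R] unfolding Ls_loc_def by blast
  then have "(\<integral>\<^sup>+z. ennreal (norm ((DP z)\<^sup>2)) \<partial>?M) < \<infinity>" by (simp add: powr_numeral)
  then have i: "integrable ?M (\<lambda>z. (DP z)\<^sup>2)"
    using m by (intro integrableI_bounded) auto
  show ?thesis
  proof (rule Bochner_Integration.integrable_bound[OF _ m])
    show "integrable ?M (\<lambda>z. 1 + (DP z)\<^sup>2)"
      by (intro Bochner_Integration.integrable_add i finite_measure.integrable_const[OF strip_finite])
    have "\<bar>x\<bar> \<le> 1 + x\<^sup>2" for x :: real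
    proof -
      have "0 \<le> (\<bar>x\<bar> - 1)\<^sup>2" by simp
      then have "2 * \<bar>x\<bar> \<le> 1 + x\<^sup>2" by (simp add: power2_diff)
      then show ?thesis using abs_ge_zero[of x] by linarith
    qed
    then show "AE z in ?M. norm (DP z) \<le> norm (1 + (DP z)\<^sup>2)" by (intro AE_I2) simp
  qed
qed

lemma integrable_Omega_of_strip:
  fixes F :: "real \<times> real \<Rightarrow> real"
  assumes zero: "\<And>\<tau> \<xi>. R \<le> \<bar>\<xi>\<bar> \<Longrightarrow> F (\<tau>, \<xi>) = 0"
    and int: "integrable (lebesgue_on ({0..T} \<times> {- R..R})) F"
  shows "integrable lebesgue (\<lambda>z. indicator (Omega T) z *\<^sub>R F z)" "integrable (lebesgue_on (Omega T)) F"
proof -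
  have "integrable lebesgue (\<lambda>z. indicator ({0..T} \<times> {- R..R}) z *\<^sub>R F z)"
    using int strip_compact(3)[of R] by (simp add: integrable_restrict_space)
  moreover have "(\<lambda>z. indicator ({0..T} \<times> {- R..R}) z *\<^sub>R F z) = (\<lambda>z. indicator (Omega T) z *\<^sub>R F z)"
  proof
    fix z :: "real \<times> real"
    show "indicator ({0..T} \<times> {- R..R}) z *\<^sub>R F z = indicator (Omega T) z *\<^sub>R F z"
    proof (cases "R \<le> \<bar>snd z\<bar>")
      case True
      then have "F z = 0" using zero[of "snd z" "fst z"] by simp
      then show ?thesis by simp
    qed (auto simp: indicator_def Omega_def)
  qed
  ultimately show 1: "integrable lebesgue (\<lambda>z. indicator (Omega T) z *\<^sub>R F z)" by simp
  then show "integrable (lebesgue_on (Omega T)) F"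
    using Omega_lebesgue[of T] by (simp add: integrable_restrict_space)
qed

lemma borel_imp_lebesgue_on_measurable:
  "f \<in> borel_measurable borel \<Longrightarrow> f \<in> borel_measurable (lebesgue_on S)" for f :: "real \<times> real \<Rightarrow> real"
  by (intro measurable_restrict_space1 measurable_completion) simp

lemma U_test_integrable:
  assumes \<eta>: "L-lipschitz_on UNIV \<eta>" and h: "test_function A h"
  shows "integrable (lebesgue_on (Omega T)) (\<lambda>z. \<eta> (U z) * h z)"
proof -
  obtain R where R: "0 < R" "\<And>\<tau> \<xi>. R \<le> \<bar>\<tau>\<bar> \<or> R \<le> \<bar>\<xi>\<bar> \<Longrightarrow> h (\<tau>, \<xi>) = 0"
    using test_function_support_box[OF h] by metis
  obtain C where C: "\<And>z. \<bar>h z\<bar> \<le> C" using test_function_bounded[OF h] by blast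
  note K = strip_compact[of R]
  have "integrable (lebesgue_on ({0..T} \<times> {- R..R})) (\<lambda>z. \<eta> (U z))"
    by (rule Lipschitz_compose_L1(1)[OF \<eta> strip_finite Ls_loc_1_tendsto_L1(2,3,1)[OF U_lim K(1,2)]])
  then have "integrable (lebesgue_on ({0..T} \<times> {- R..R})) (\<lambda>z. \<eta> (U z) * h z)"
    by (rule integrable_mult_bounded[OF _ borel_imp_lebesgue_on_measurable[OF test_function_borel[OF h]] C])
  then show ?thesis by (rule integrable_Omega_of_strip(2)[rotated]) (use R in auto)
qed

text \<open>The weak chain rule on every time slice, integrated over time.\<close>
lemma weak_derivative_test:
  fixes N \<mu> :: "real \<Rightarrow> real"
  assumes N: "\<And>x. (N has_real_derivative \<mu> x) (at x)" and \<mu>: "continuous_on UNIV \<mu>"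
    and \<Psi>: "test_function A \<Psi>"
  shows "(LINT z|lebesgue_on (Omega T). N (P z) * d_xi (d_xi \<Psi>) z) =
      - (LINT z|lebesgue_on (Omega T). \<mu> (P z) * DP z * d_xi \<Psi> z)"
    and "integrable (lebesgue_on (Omega T)) (\<lambda>z. N (P z) * d_xi (d_xi \<Psi>) z)"
    and "integrable (lebesgue_on (Omega T)) (\<lambda>z. \<mu> (P z) * DP z * d_xi \<Psi> z)"
proof -
  let ?D = "d_xi \<Psi>" and ?H = "d_xi (d_xi \<Psi>)"
  have tD: "test_function A ?D" and tH: "test_function A ?H" by (intro test_function_d_xi \<Psi>)+
  obtain R1 where R1: "0 < R1" "\<And>\<tau> \<xi>. R1 \<le> \<bar>\<tau>\<bar> \<or> R1 \<le> \<bar>\<xi>\<bar> \<Longrightarrow> ?D (\<tau>, \<xi>) = 0"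
    using test_function_support_box[OF tD] by metis
  obtain R2 where R2: "0 < R2" "\<And>\<tau> \<xi>. R2 \<le> \<bar>\<tau>\<bar> \<or> R2 \<le> \<bar>\<xi>\<bar> \<Longrightarrow> ?H (\<tau>, \<xi>) = 0"
    using test_function_support_box[OF tH] by metis
  define R where "R = R1 + R2"
  have R: "0 < R" "\<And>\<tau> \<xi>. R \<le> \<bar>\<xi>\<bar> \<Longrightarrow> ?D (\<tau>, \<xi>) = 0" "\<And>\<tau> \<xi>. R \<le> \<bar>\<xi>\<bar> \<Longrightarrow> ?H (\<tau>, \<xi>) = 0"
    using R1 R2 by (auto simp: R_def)
  note K = strip_compact[of R]
  let ?M = "lebesgue_on ({0..T} \<times> {- R..R})"
  have cN: "continuous_on UNIV N" using N DERIV_isCont by (blast intro: continuous_at_imp_continuous_on)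
  have cP: "continuous_on ({0..T} \<times> {- R..R}) (\<lambda>z. N (P z))" "continuous_on ({0..T} \<times> {- R..R}) (\<lambda>z. \<mu> (P z))"
    by (rule continuous_on_compose2[OF cN continuous_on_subset[OF P_continuous K(2)]]
        continuous_on_compose2[OF \<mu> continuous_on_subset[OF P_continuous K(2)]], simp)+
  have bounded_compact: "\<exists>C. \<forall>z\<in>{0..T} \<times> {- R..R}. \<bar>f z\<bar> \<le> C"
    if "continuous_on ({0..T} \<times> {- R..R}) f" for f :: "real \<times> real \<Rightarrow> real"
    using compact_imp_bounded[OF compact_continuous_image[OF that K(1)]] unfolding bounded_iff by auto
  have cD: "continuous_on ({0..T} \<times> {- R..R}) ?D" "continuous_on ({0..T} \<times> {- R..R}) ?H"
    using tD tH smooth_continuous_on by (auto simp: test_function_def)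
  have sp: "space ?M = {0..T} \<times> {- R..R}" by simp
  have i1: "integrable ?M (\<lambda>z. N (P z) * ?H z)"
  proof -
    have c: "continuous_on ({0..T} \<times> {- R..R}) (\<lambda>z. N (P z) * ?H z)" by (intro continuous_intros cP cD)
    then obtain C where C: "\<forall>z\<in>{0..T} \<times> {- R..R}. \<bar>N (P z) * ?H z\<bar> \<le> C" using bounded_compact by blast
    have m: "(\<lambda>z. N (P z) * ?H z) \<in> borel_measurable ?M"
      by (rule continuous_imp_measurable_on_sets_lebesgue[OF c K(3)])
    have "integrable ?M (\<lambda>z. 1 * (N (P z) * ?H z))"
      by (rule integrable_mult_bounded[OF finite_measure.integrable_const[OF strip_finite] m]) (use C sp in blast)
    then show ?thesis by simp
  qed
  have i2: "integrable ?M (\<lambda>z. \<mu> (P z) * DP z * ?D z)"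
  proof -
    have c: "continuous_on ({0..T} \<times> {- R..R}) (\<lambda>z. \<mu> (P z) * ?D z)" by (intro continuous_intros cP cD)
    then obtain C where C: "\<forall>z\<in>{0..T} \<times> {- R..R}. \<bar>\<mu> (P z) * ?D z\<bar> \<le> C" using bounded_compact by blast
    have m: "(\<lambda>z. \<mu> (P z) * ?D z) \<in> borel_measurable ?M"
      by (rule continuous_imp_measurable_on_sets_lebesgue[OF c K(3)])
    have "integrable ?M (\<lambda>z. DP z * (\<mu> (P z) * ?D z))"
      by (rule integrable_mult_bounded[OF DP_integrable_strip m]) (use C sp in blast)
    then show ?thesis by (simp add: mult_ac)
  qed
  have z1: "N (P (\<tau>, \<xi>)) * ?H (\<tau>, \<xi>) = 0" "\<mu> (P (\<tau>, \<xi>)) * DP (\<tau>, \<xi>) * ?D (\<tau>, \<xi>) = 0" if "R \<le> \<bar>\<xi>\<bar>" for \<tau> \<xi>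
    using R that by auto
  have I1: "integrable lebesgue (\<lambda>z. indicator (Omega T) z *\<^sub>R (N (P z) * ?H z))"
    and I1': "integrable (lebesgue_on (Omega T)) (\<lambda>z. N (P z) * ?H z)"
    by (rule integrable_Omega_of_strip[OF z1(1) i1], assumption)+
  have I2: "integrable lebesgue (\<lambda>z. indicator (Omega T) z *\<^sub>R (\<mu> (P z) * DP z * ?D z))"
    and I2': "integrable (lebesgue_on (Omega T)) (\<lambda>z. \<mu> (P z) * DP z * ?D z)"
    by (rule integrable_Omega_of_strip[OF z1(2) i2], assumption)+
  show "integrable (lebesgue_on (Omega T)) (\<lambda>z. N (P z) * ?H z)"
    "integrable (lebesgue_on (Omega T)) (\<lambda>z. \<mu> (P z) * DP z * ?D z)" by fact+
  have sD: "smooth ?D" using tD by (simp add: test_function_def)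
  have "(LINT z|lebesgue. indicator (Omega T) z *\<^sub>R (N (P z) * ?H z)) =
      (LINT z|lebesgue. - (indicator (Omega T) z *\<^sub>R (\<mu> (P z) * DP z * ?D z)))"
  proof (rule lebesgue_integral_eq_by_slices[OF I1 Bochner_Integration.integrable_minus[OF I2]])
    fix \<tau>
    show "(LINT \<xi>|lebesgue. indicator (Omega T) (\<tau>, \<xi>) *\<^sub>R (N (P (\<tau>, \<xi>)) * ?H (\<tau>, \<xi>))) =
      (LINT \<xi>|lebesgue. - (indicator (Omega T) (\<tau>, \<xi>) *\<^sub>R (\<mu> (P (\<tau>, \<xi>)) * DP (\<tau>, \<xi>) * ?D (\<tau>, \<xi>))))"
    proof (cases "\<tau> \<in> {0..T}")
      case True
      have "(LINT \<xi>|lebesgue. N (P (\<tau>, \<xi>)) * ?H (\<tau>, \<xi>)) = - (LINT \<xi>|lebesgue. \<mu> (P (\<tau>, \<xi>)) * DP (\<tau>, \<xi>) * ?D (\<tau>, \<xi>))"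
      proof (rule weak_chain_rule[OF P_slice_continuous[OF True] DP_slice[OF True] N \<mu>
            smooth_has_xi_derivative[OF sD], where a="- R" and b=R])
        show "continuous_on UNIV (\<lambda>\<xi>. ?H (\<tau>, \<xi>))"
          by (rule continuous_on_compose2[OF smooth_continuous_on[of ?H UNIV]])
             (use tH in \<open>auto intro!: continuous_intros simp: test_function_def\<close>)
        show "?D (\<tau>, x) = 0" if "x \<notin> {- R<..<R}" for x using that by (intro R(2)) auto
        show "?H (\<tau>, x) = 0" if "x \<notin> {- R<..<R}" for x using that by (intro R(3)) auto
        show "- R \<le> R" using R(1) by simp
      qed
      then show ?thesis using True by (simp add: Omega_def indicator_def)
    next
      case False
      then have "indicator (Omega T) (\<tau>, \<xi>) = (0::real)" for \<xi> by (auto simp: Omega_def indicator_def)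
      then show ?thesis by simp
    qed
  qed
  then show "(LINT z|lebesgue_on (Omega T). N (P z) * ?H z) = - (LINT z|lebesgue_on (Omega T). \<mu> (P z) * DP z * ?D z)"
    using Omega_lebesgue[of T] by (simp add: integral_restrict_space)
qed

text \<open>The limit of the lattice entropy inequality for test functions that vanish at time 0, with the
  flux written by the chain rule.\<close>
lemma entropy_balance:
  fixes N \<mu> \<eta> :: "real \<Rightarrow> real"
  assumes N: "\<And>x. (N has_real_derivative \<mu> x) (at x)" "L1-lipschitz_on UNIV N" and \<mu>: "continuous_on UNIV \<mu>"
    and \<eta>: "\<And>v. (\<eta> has_real_derivative \<mu> (Phi' \<kappa> v)) (at v)" "L2-lipschitz_on UNIV \<eta>"
    and \<Psi>: "test_function ({0<..<T} \<times> UNIV) \<Psi>"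
    and conv: "\<And>z a b. 0 \<le> \<Psi> z * (N b - N a - \<mu> a * (b - a))"
  shows "0 \<le> (LINT z|lebesgue_on (Omega T). \<eta> (U z) * d_tau \<Psi> z - \<mu> (P z) * DP z * d_xi \<Psi> z)"
proof -
  have \<Psi>': "test_function ({..<T} \<times> UNIV) \<Psi>"
    by (rule test_function_mono[OF \<Psi>]) auto
  have \<Psi>0: "\<Psi> (0, \<xi>) = 0" for \<xi> using \<Psi> unfolding test_function_def by fastforce
  have "0 * (LINT \<xi>|lborel. \<Psi> (0, \<xi>)) \<le>
    (LINT z|lebesgue_on (Omega T). \<eta> (U z) * d_tau \<Psi> z + N (P z) * d_xi (d_xi \<Psi>) z)"
    by (rule lattice_entropy_limit[OF \<kappa> T e_pos e_lim lattice U_lim P_lim N(2) \<mu> \<eta> \<Psi>' conv]) (simp add: \<Psi>0)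
  also have "\<dots> = (LINT z|lebesgue_on (Omega T). \<eta> (U z) * d_tau \<Psi> z) + (LINT z|lebesgue_on (Omega T). N (P z) * d_xi (d_xi \<Psi>) z)"
    by (rule Bochner_Integration.integral_add[OF U_test_integrable[OF \<eta>(2) test_function_d_tau[OF \<Psi>]] weak_derivative_test(2)[OF N(1) \<mu> \<Psi>]])
  also have "\<dots> = (LINT z|lebesgue_on (Omega T). \<eta> (U z) * d_tau \<Psi> z) - (LINT z|lebesgue_on (Omega T). \<mu> (P z) * DP z * d_xi \<Psi> z)"
    using weak_derivative_test(1)[OF N(1) \<mu> \<Psi>] by simp
  also have "\<dots> = (LINT z|lebesgue_on (Omega T). \<eta> (U z) * d_tau \<Psi> z - \<mu> (P z) * DP z * d_xi \<Psi> z)"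
    by (rule Bochner_Integration.integral_diff[symmetric, OF U_test_integrable[OF \<eta>(2) test_function_d_tau[OF \<Psi>]] weak_derivative_test(3)[OF N(1) \<mu> \<Psi>]])
  finally show ?thesis by simp
qed

text \<open>The graph of a continuous function is a null set, by Fubini's theorem.\<close>
lemma off_interface_AE: "AE z in lebesgue_on (Omega T). snd z \<noteq> \<Xi> (fst z)"
proof -
  have "open {z :: real \<times> real. snd z \<noteq> Xi_clamped (fst z)}"
    by (intro open_Collect_neq continuous_intros continuous_on_compose2[OF Xi_clamped_continuous[of UNIV]]) auto
  then have m: "{z. snd z \<noteq> Xi_clamped (fst z)} \<in> sets (borel :: (real \<times> real) measure)" by simp
  have "AE z in lborel \<Otimes>\<^sub>M lborel. snd z \<noteq> Xi_clamped (fst z)"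
  proof (rule lborel_pair.AE_pair_measure)
    show "{z \<in> space (lborel \<Otimes>\<^sub>M lborel). snd z \<noteq> Xi_clamped (fst z)} \<in> sets (lborel \<Otimes>\<^sub>M lborel)"
      unfolding lborel_prod using m by simp
    show "AE x in lborel. AE y in lborel. snd (x, y) \<noteq> Xi_clamped (fst (x, y))"
      unfolding fst_conv snd_conv by (intro AE_I2 AE_lborel_singleton)
  qed
  then have "AE z in lebesgue. snd z \<noteq> Xi_clamped (fst z)" unfolding lborel_prod by (rule AE_completion)
  then have "AE z in lebesgue. z \<in> Omega T \<longrightarrow> snd z \<noteq> \<Xi> (fst z)"
    by eventually_elim (auto simp: Xi_clamped_def Omega_def)
  then show ?thesis by (simp add: AE_lebesgue_on_iff[OF Omega_lebesgue])
qed

lemma U_eq_AE: "AE z in lebesgue_on (Omega T). U z = P z + M z"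
  using phase_separated_AE off_interface_AE
  by eventually_elim (auto simp: phase_separated_def linorder_neq_iff)

lemma limit_measurable:
  "U \<in> borel_measurable (lebesgue_on (Omega T))" "M \<in> borel_measurable (lebesgue_on (Omega T))"
  "P \<in> borel_measurable (lebesgue_on (Omega T))" "DP \<in> borel_measurable (lebesgue_on (Omega T))"
  using U_lim M_lim P_lim DP_measurable_L2 unfolding Ls_loc_tendsto_def Ls_loc_def by auto

text \<open>For \<open>N(p) = p\<close> and \<open>N(p) = -p\<close> the tangent condition is an equality for test functions of any sign,
  so the two entropy balances are opposite inequalities for the same integral. Moreover
  \<open>U = P + M\<close> almost everywhere.\<close>
lemma Stefan_solution: "Stefan_distributional_solution T P DP M"
  unfolding Stefan_distributional_solution_def
proof (intro allI impI)
  fix \<Psi> :: "real \<times> real \<Rightarrow> real" assume \<Psi>: "test_function ({0<..<T} \<times> UNIV) \<Psi>"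
  let ?W = "lebesgue_on (Omega T)"
  have lip: "1-lipschitz_on UNIV (\<lambda>x::real. x)" "1-lipschitz_on UNIV (\<lambda>x::real. - x)"
    by (auto intro!: lipschitz_onI simp: dist_real_def)
  have 1: "0 \<le> (LINT z|?W. U z * d_tau \<Psi> z - 1 * DP z * d_xi \<Psi> z)"
    by (rule entropy_balance[where N="\<lambda>x. x" and \<mu>="\<lambda>_. 1"]) (use lip \<Psi> in \<open>auto intro!: derivative_eq_intros\<close>)
  have 2: "0 \<le> (LINT z|?W. - U z * d_tau \<Psi> z - (- 1) * DP z * d_xi \<Psi> z)"
    by (rule entropy_balance[where N="\<lambda>x. - x" and \<mu>="\<lambda>_. - 1"]) (use lip \<Psi> in \<open>auto intro!: derivative_eq_intros\<close>)
  have iU: "integrable ?W (\<lambda>z. U z * d_tau \<Psi> z)"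
    using U_test_integrable[OF lip(1) test_function_d_tau[OF \<Psi>]] by simp
  have iD: "integrable ?W (\<lambda>z. DP z * d_xi \<Psi> z)"
    using weak_derivative_test(3)[of "\<lambda>x. x" "\<lambda>_. 1", OF _ _ \<Psi>] by (simp add: DERIV_ident)
  have "(LINT z|?W. U z * d_tau \<Psi> z) = (LINT z|?W. DP z * d_xi \<Psi> z)"
    using 1 2 iU iD by simp
  moreover have "(LINT z|?W. (P z + M z) * d_tau \<Psi> z) = (LINT z|?W. U z * d_tau \<Psi> z)"
  proof (rule integral_cong_AE)
    have "d_tau \<Psi> \<in> borel_measurable ?W" by (rule borel_imp_lebesgue_on_measurable[OF test_function_borel[OF test_function_d_tau[OF \<Psi>]]])
    then show "(\<lambda>z. (P z + M z) * d_tau \<Psi> z) \<in> borel_measurable ?W" "(\<lambda>z. U z * d_tau \<Psi> z) \<in> borel_measurable ?W"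
      using limit_measurable by auto
    show "AE z in ?W. (P z + M z) * d_tau \<Psi> z = U z * d_tau \<Psi> z"
      using U_eq_AE by eventually_elim simp
  qed
  ultimately show "(LINT z|?W. (P z + M z) * d_tau \<Psi> z) = (LINT z|?W. DP z * d_xi \<Psi> z)" by simp
qed

end

section \<open>The initial position of the interface\<close>

text \<open>On \<open>(-s, s)\<close> the two exponents add up to \<open>-2 s / (s\<^sup>2 - x\<^sup>2)\<close>.\<close>
lemma bump_symmetric_decreasing:
  assumes "0 \<le> x" "x \<le> y"
  shows "bump (- s) s y \<le> bump (- s) s x"
proof (cases "y < s")
  case False
  then show ?thesis using bump_eq_0[of y "- s" s] bump_nonneg by simp
next
  case True
  have b: "bump (- s) s z = exp (- (2 * s / (s\<^sup>2 - z\<^sup>2)))" if "0 \<le> z" "z < s" for z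
  proof -
    have "inverse (z + s) + inverse (s - z) = 2 * s / (s\<^sup>2 - z\<^sup>2)"
      using that by (simp add: field_simps power2_eq_square)
    then show ?thesis using that by (simp add: bump_def flat_def exp_add[symmetric])
  qed
  have sq: "x\<^sup>2 \<le> y\<^sup>2" "y\<^sup>2 < s\<^sup>2"
    using assms True by (auto intro!: power_mono power_strict_mono)
  have "2 * s / (s\<^sup>2 - x\<^sup>2) \<le> 2 * s / (s\<^sup>2 - y\<^sup>2)"
    using sq le_less_trans[OF sq] assms True by (intro divide_left_mono mult_pos_pos) auto
  then show ?thesis using assms True by (simp add: b)
qed

lemma Omega_integral_slices:
  fixes f :: "real \<times> real \<Rightarrow> real"
  assumes f: "f \<in> borel_measurable borel" and int: "integrable lborel (\<lambda>z. indicator {0..T} (fst z) * f z)"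
  shows "(LINT z|lebesgue_on (Omega T). f z) = (LINT \<xi>|lborel. LINT \<tau>|lborel. indicator {0..T} \<tau> * f (\<tau>, \<xi>))"
    and "integrable (lebesgue_on (Omega T)) f"
    and "integrable lborel (\<lambda>\<xi>. LINT \<tau>|lborel. indicator {0..T} \<tau> * f (\<tau>, \<xi>))"
proof -
  have e: "(\<lambda>z. indicator (Omega T) z *\<^sub>R f z) = (\<lambda>z. indicator {0..T} (fst z) * f z)"
    by (auto simp: Omega_def indicator_def fun_eq_iff)
  have m: "(\<lambda>z. indicator {0..T} (fst z) * f z) \<in> borel_measurable lborel"
    using int by (rule borel_measurable_integrable)
  have "(LINT z|lebesgue_on (Omega T). f z) = (LINT z|lebesgue. indicator {0..T} (fst z) * f z)"
    using Omega_lebesgue[of T] by (simp add: integral_restrict_space e[simplified])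
  also have "\<dots> = (LINT z|lborel. indicator {0..T} (fst z) * f z)" by (rule integral_completion[OF m])
  also have "\<dots> = (LINT \<xi>|lborel. LINT \<tau>|lborel. indicator {0..T} \<tau> * f (\<tau>, \<xi>))"
    using lborel_pair.integral_snd[of "\<lambda>\<tau> \<xi>. indicator {0..T} \<tau> * f (\<tau>, \<xi>)"] int
    by (simp add: lborel_prod case_prod_beta')
  finally show "(LINT z|lebesgue_on (Omega T). f z) = (LINT \<xi>|lborel. LINT \<tau>|lborel. indicator {0..T} \<tau> * f (\<tau>, \<xi>))" .
  have "integrable lebesgue (\<lambda>z. indicator (Omega T) z *\<^sub>R f z)"
    unfolding e using int m by (simp add: integrable_completion)
  then show "integrable (lebesgue_on (Omega T)) f"
    using Omega_lebesgue[of T] by (simp add: integrable_restrict_space)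
  show "integrable lborel (\<lambda>\<xi>. LINT \<tau>|lborel. indicator {0..T} \<tau> * f (\<tau>, \<xi>))"
    using lborel_pair.integrable_snd[of "\<lambda>\<tau> \<xi>. indicator {0..T} \<tau> * f (\<tau>, \<xi>)"] int
    by (simp add: lborel_prod case_prod_beta')
qed

lemma indicator_fst_integrable:
  fixes f g :: "real \<times> real \<Rightarrow> real"
  assumes f: "f \<in> borel_measurable borel" and g: "integrable lborel g" and le: "\<And>z. \<bar>f z\<bar> \<le> \<bar>g z\<bar>"
  shows "integrable lborel (\<lambda>z. indicator {0..T} (fst z) * f z)"
proof (rule Bochner_Integration.integrable_bound[OF g])
  have [measurable]: "fst \<in> borel_measurable (borel :: (real \<times> real) measure)"
    by (intro borel_measurable_continuous_onI continuous_intros)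
  show "(\<lambda>z. indicator {0..T} (fst z) * f z) \<in> borel_measurable lborel" using f by measurable
  show "AE z in lborel. norm (indicator {0..T} (fst z) * f z) \<le> norm (g z)"
    using le by (intro AE_I2) (auto simp: indicator_def)
qed

lemma Omega_integral_d_tau:
  fixes \<Psi> :: "real \<times> real \<Rightarrow> real"
  assumes T: "0 < T" and \<Psi>: "test_function ({..<T} \<times> UNIV) \<Psi>"
  shows "(LINT z|lebesgue_on (Omega T). d_tau \<Psi> z) = - (LINT \<xi>|lborel. \<Psi> (0, \<xi>))"
    and "integrable (lebesgue_on (Omega T)) (d_tau \<Psi>)"
proof -
  have t: "test_function ({..<T} \<times> UNIV) (d_tau \<Psi>)" by (rule test_function_d_tau[OF \<Psi>])
  have s: "smooth \<Psi>" "smooth (d_tau \<Psi>)" using \<Psi> t by (auto simp: test_function_def)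
  have i: "integrable lborel (\<lambda>z. indicator {0..T} (fst z) * d_tau \<Psi> z)"
    by (rule indicator_fst_integrable[OF test_function_borel[OF t] test_function_integrable[OF t]]) simp
  show "integrable (lebesgue_on (Omega T)) (d_tau \<Psi>)"
    by (rule Omega_integral_slices(2)[OF test_function_borel[OF t] i])
  have "(LINT \<tau>|lborel. indicator {0..T} \<tau> * d_tau \<Psi> (\<tau>, \<xi>)) = - \<Psi> (0, \<xi>)" for \<xi>
  proof -
    have "(LINT \<tau>|lborel. d_tau \<Psi> (\<tau>, \<xi>) * indicator {0..T} \<tau>) = \<Psi> (T, \<xi>) - \<Psi> (0, \<xi>)"
    proof (rule integral_FTC_Icc_real)
      show "0 \<le> T" using T by simp
      show "((\<lambda>\<tau>. \<Psi> (\<tau>, \<xi>)) has_real_derivative d_tau \<Psi> (\<tau>, \<xi>)) (at \<tau>)" for \<tau>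
        by (rule smooth_has_tau_derivative[OF s(1)])
      have "continuous_on UNIV (\<lambda>\<tau>. d_tau \<Psi> (\<tau>, \<xi>))"
        by (rule continuous_on_compose2[OF smooth_continuous_on[OF s(2), of UNIV]]) (auto intro!: continuous_intros)
      then show "isCont (\<lambda>\<tau>. d_tau \<Psi> (\<tau>, \<xi>)) \<tau>" for \<tau>
        by (simp add: continuous_on_eq_continuous_at)
    qed
    moreover have "\<Psi> (T, \<xi>) = 0" using \<Psi> unfolding test_function_def by fastforce
    ultimately show ?thesis by (simp add: mult.commute)
  qed
  then show "(LINT z|lebesgue_on (Omega T). d_tau \<Psi> z) = - (LINT \<xi>|lborel. \<Psi> (0, \<xi>))"
    using Omega_integral_slices(1)[OF test_function_borel[OF t] i] by simp
qed

lemma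
  fixes f g :: "real \<Rightarrow> real"
  assumes f: "smooth f" and g: "smooth g"
  shows d_tau_tensor: "d_tau (\<lambda>z. f (fst z) * g (snd z)) = (\<lambda>z. deriv f (fst z) * g (snd z))"
    and d_xi_tensor: "d_xi (\<lambda>z. f (fst z) * g (snd z)) = (\<lambda>z. f (fst z) * deriv g (snd z))"
proof -
  have "deriv (\<lambda>t. f t * c) \<tau> = deriv f \<tau> * c" for c \<tau>
    by (rule DERIV_imp_deriv[OF DERIV_cmult_right[OF smooth_real_deriv(1)[OF f]]])
  then show "d_tau (\<lambda>z. f (fst z) * g (snd z)) = (\<lambda>z. deriv f (fst z) * g (snd z))"
    by (simp add: d_tau_def fun_eq_iff)
  have "deriv (\<lambda>t. c * g t) \<xi> = c * deriv g \<xi>" for c \<xi>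
    by (rule DERIV_imp_deriv[OF DERIV_cmult[OF smooth_real_deriv(1)[OF g]]])
  then show "d_xi (\<lambda>z. f (fst z) * g (snd z)) = (\<lambda>z. f (fst z) * deriv g (snd z))"
    by (simp add: d_xi_def fun_eq_iff)
qed

lemma test_function_deriv:
  fixes f :: "real \<Rightarrow> real"
  assumes "test_function A f"
  shows "test_function A (deriv f)"
proof -
  have "smooth f" using assms by (simp add: test_function_def)
  then have "(\<lambda>x. frechet_derivative f (at x) 1) = deriv f"
    using frechet_derivative_real[OF smooth_real_deriv(1)] by simp
  then show ?thesis using test_function_directional_derivative[OF assms, of 1] by simp
qed

lemma test_function_bump: "test_function {a..b} (bump a b)"
  unfolding test_function_def using smooth_bump bump_eq_0
  by (intro conjI exI[of _ "{a..b}"]) auto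

lemma bump_integral_pos:
  assumes "a < b" shows "0 < (LINT x|lborel. bump a b x)"
proof -
  have i: "integrable lborel (bump a b)" by (rule test_function_integrable[OF test_function_bump])
  have "(LINT x|lborel. bump a b x) \<noteq> 0"
  proof
    assume "(LINT x|lborel. bump a b x) = 0"
    then have "AE x in lborel. bump a b x = 0"
      using integral_nonneg_eq_0_iff_AE[OF i] bump_nonneg by simp
    then have "AE x in lborel. x \<notin> {a<..<b}"
      by eventually_elim (use bump_pos in force)
    then have "{a<..<b} \<in> null_sets lborel" by (subst AE_iff_null_sets) auto
    then have "emeasure lborel {a<..<b} = 0" by auto
    then show False using assms by simp
  qed
  moreover have "0 \<le> (LINT x|lborel. bump a b x)" by (intro integral_nonneg_AE AE_I2) (simp add: bump_nonneg)
  ultimately show ?thesis by simp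
qed

context single_interface_limit
begin

text \<open>Initially all particles with index above 1 are in the left well of the potential, and at a fixed
  \<open>\<xi> > 0\<close> the cell index exceeds 1 as soon as \<open>\<epsilon>\<close> is small.\<close>
lemma initial_phase:
  assumes c: "0 < c"
  shows "\<forall>\<^sub>F n in sequentially. \<forall>\<xi>>c. U_n n (0, \<xi>) \<le> - u_star \<kappa>"
proof -
  have "\<forall>\<^sub>F n in sequentially. e n < c / 2" using order_tendstoD(2)[OF e_lim, of "c / 2"] c by simp
  then show ?thesis
  proof eventually_elim
    fix n assume n: "e n < c / 2"
    show "\<forall>\<xi>>c. U_n n (0, \<xi>) \<le> - u_star \<kappa>"
    proof (intro allI impI)
      fix \<xi> assume \<xi>: "c < \<xi>"
      obtain \<zeta> where \<zeta>: "\<xi> = e n * (real_of_int (cell (e n) \<xi>) + \<zeta>)" "\<zeta> \<le> 1 / 2"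
        using cell_iff[OF e_pos, of n \<xi> "cell (e n) \<xi>"] by auto
      have "e n * 2 < e n * (real_of_int (cell (e n) \<xi>) + \<zeta>)" using \<zeta>(1) \<xi> n by linarith
      then have "2 < real_of_int (cell (e n) \<xi>) + \<zeta>" using e_pos[of n] by simp
      then have "1 < cell (e n) \<xi>" using \<zeta>(2) by linarith
      moreover have "u (e n) 0 \<in> X_set \<kappa> 1" using initial[OF e_pos] by (simp add: well_prepared_def)
      ultimately show "U_n n (0, \<xi>) \<le> - u_star \<kappa>"
        using X_set_right_phase(2)[of "u (e n) 0" \<kappa> 1 "cell (e n) \<xi>"] by (simp add: U_eps_def)
    qed
  qed
qed

text \<open>If \<open>c = \<Xi>(0)\<close> were positive, then \<open>U \<ge> u\<^sub>*\<close> on \<open>(c/4, c/2)\<close> at all times, although the lattice data are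
  below \<open>-u\<^sub>*\<close> there initially. This jump of \<open>2 u\<^sub>*\<close> is excluded by testing the limit equation with
  \<open>a(\<tau>) \<phi>(\<xi>)\<close>, where \<open>\<phi>\<close> is a bump on \<open>(c/4, c/2)\<close> and \<open>a\<close> decreases from \<open>a(0)\<close> to 0 within the time
  \<open>s\<close>: the diffusion term is at most \<open>O(s) a(0)\<close>, so the jump would have to vanish as \<open>s\<close> tends to 0.\<close>
lemma Xi_initial: "\<Xi> 0 = 0"
proof (rule ccontr)
  assume "\<Xi> 0 \<noteq> 0"
  define c where "c = \<Xi> 0"
  have c: "0 < c" using Xi_nonneg[of 0] T \<open>\<Xi> 0 \<noteq> 0\<close> by (simp add: c_def)
  let ?us = "u_star \<kappa>"
  have us: "0 < ?us" using \<kappa> by (rule u_star_pos)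
  let ?W = "lebesgue_on (Omega T)"
  define \<phi> where "\<phi> = bump (c / 4) (c / 2)"
  have t\<phi>: "test_function {c / 4..c / 2} \<phi>" unfolding \<phi>_def by (rule test_function_bump)
  have t\<phi>2: "test_function {c / 4..c / 2} (deriv (deriv \<phi>))" by (intro test_function_deriv t\<phi>)
  have s\<phi>: "smooth \<phi>" "smooth (deriv \<phi>)"
    using t\<phi> test_function_deriv[OF t\<phi>] by (auto simp: test_function_def)
  obtain C where C: "0 < C" "\<And>x. \<bar>deriv (deriv \<phi>) x\<bar> \<le> C" using test_function_bounded[OF t\<phi>2] by metis
  have \<phi>0: "deriv (deriv \<phi>) x = 0" if "x \<notin> {c / 4..c / 2}" for x
    using t\<phi>2 that unfolding test_function_def by blast
  define I where "I = (LINT x|lborel. \<phi> x)"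
  have I: "0 < I" unfolding I_def \<phi>_def using c by (intro bump_integral_pos) simp
  obtain B0 where B0: "AE z in ?W. \<bar>P z\<bar> \<le> B0"
    using limit unfolding macroscopic_limit_def ess_bounded_on_def by blast
  define B where "B = \<bar>B0\<bar>"
  have main: "2 * ?us * I \<le> (B * C * (c / 4)) * s" if s: "0 < s" "s < T" for s
  proof -
    define a where "a = bump (- s) s"
    define a0 where "a0 = a 0"
    have a0: "0 < a0" unfolding a0_def a_def by (rule bump_pos) (use s in auto)
    have sa: "smooth a" unfolding a_def by (rule smooth_bump)
    define \<Psi> where "\<Psi> = (\<lambda>z. a (fst z) * \<phi> (snd z))"
    have \<Psi>: "test_function ({..<T} \<times> UNIV) \<Psi>"
      unfolding \<Psi>_def a_def \<phi>_def by (rule test_function_bump_tensor) (use s in auto)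
    have dt: "d_tau \<Psi> = (\<lambda>z. deriv a (fst z) * \<phi> (snd z))" unfolding \<Psi>_def by (rule d_tau_tensor[OF sa s\<phi>(1)])
    have dx: "d_xi (d_xi \<Psi>) = (\<lambda>z. a (fst z) * deriv (deriv \<phi>) (snd z))"
      unfolding \<Psi>_def by (simp only: d_xi_tensor[OF sa s\<phi>(1)] d_xi_tensor[OF sa s\<phi>(2)])
    have lip: "1-lipschitz_on UNIV (\<lambda>x::real. x)" by (auto intro!: lipschitz_onI simp: dist_real_def)
    have \<Psi>I: "(LINT \<xi>|lborel. \<Psi> (0, \<xi>)) = a0 * I" by (simp add: \<Psi>_def a0_def I_def)
    have "?us * (LINT \<xi>|lborel. \<Psi> (0, \<xi>)) \<le> (LINT z|?W. U z * d_tau \<Psi> z + P z * d_xi (d_xi \<Psi>) z)"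
    proof (rule lattice_entropy_limit[OF \<kappa> T e_pos e_lim lattice U_lim P_lim lip, where \<mu>="\<lambda>_. 1", OF _ _ lip \<Psi>])
      have "0 < c / 4" using c by simp
      show "\<forall>\<^sub>F n in sequentially. \<forall>\<xi>. ?us * \<Psi> (0, \<xi>) \<le> - U_n n (0, \<xi>) * \<Psi> (0, \<xi>)"
        using initial_phase[OF \<open>0 < c / 4\<close>]
      proof eventually_elim
        fix n assume n: "\<forall>\<xi>>c / 4. U_n n (0, \<xi>) \<le> - ?us"
        show "\<forall>\<xi>. ?us * \<Psi> (0, \<xi>) \<le> - U_n n (0, \<xi>) * \<Psi> (0, \<xi>)"
        proof
          fix \<xi>
          show "?us * \<Psi> (0, \<xi>) \<le> - U_n n (0, \<xi>) * \<Psi> (0, \<xi>)"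
          proof (cases "c / 4 < \<xi>")
            case True
            then have "?us \<le> - U_n n (0, \<xi>)" using n by fastforce
            moreover have "0 \<le> \<Psi> (0, \<xi>)" by (simp add: \<Psi>_def a_def \<phi>_def bump_nonneg)
            ultimately show ?thesis by (rule mult_right_mono)
          next
            case False
            then have "\<Psi> (0, \<xi>) = 0" by (simp add: \<Psi>_def \<phi>_def bump_eq_0)
            then show ?thesis by simp
          qed
        qed
      qed
    qed (auto intro!: derivative_eq_intros continuous_intros)
    also have "\<dots> \<le> (LINT z|?W. ?us * d_tau \<Psi> z + (B * a0 * C) * indicator ({0..s} \<times> {c / 4..c / 2}) z)"
    proof (rule integral_mono_AE)
      show "integrable ?W (\<lambda>z. U z * d_tau \<Psi> z + P z * d_xi (d_xi \<Psi>) z)"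
        by (rule Bochner_Integration.integrable_add[OF U_test_integrable[OF lip test_function_d_tau[OF \<Psi>]]
              weak_derivative_test(2)[of "\<lambda>x. x" "\<lambda>_. 1", OF _ _ \<Psi>]]) (auto intro!: derivative_eq_intros)
      have "compact ({0..s} \<times> {c / 4..c / 2})" by (intro compact_Times compact_Icc)
      then have "integrable lborel (indicator ({0..s} \<times> {c / 4..c / 2}) :: real \<times> real \<Rightarrow> real)"
        by (intro integrable_real_indicator emeasure_compact_finite) (auto dest: compact_imp_closed)
      then have "integrable ?W (indicator ({0..s} \<times> {c / 4..c / 2}) :: real \<times> real \<Rightarrow> real)"
        by (intro Omega_integral_slices(2) indicator_fst_integrable) (auto dest: borel_measurable_integrable)
      then show "integrable ?W (\<lambda>z. ?us * d_tau \<Psi> z + (B * a0 * C) * indicator ({0..s} \<times> {c / 4..c / 2}) z)"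
        by (intro Bochner_Integration.integrable_add integrable_mult_right Omega_integral_d_tau(2)[OF T \<Psi>])
      have "AE \<tau> in lebesgue_on {0..T}. 0 < \<tau>"
      proof -
        have "AE \<tau> in lebesgue. \<tau> \<noteq> (0::real)" by (rule AE_completion[OF AE_lborel_singleton])
        then have "AE \<tau> in lebesgue. \<tau> \<in> {0..T} \<longrightarrow> 0 < \<tau>" by eventually_elim auto
        then show ?thesis by (subst AE_lebesgue_on_iff) auto
      qed
      from AE_Omega_fst[OF this] phase_separated_AE B0 AE_space[of ?W]
      show "AE z in ?W. U z * d_tau \<Psi> z + P z * d_xi (d_xi \<Psi>) z \<le>
          ?us * d_tau \<Psi> z + (B * a0 * C) * indicator ({0..s} \<times> {c / 4..c / 2}) z"
      proof eventually_elim
        fix z assume z: "0 < fst z" "phase_separated z" "\<bar>P z\<bar> \<le> B0" "z \<in> space ?W"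
        have zT: "fst z \<in> {0..T}" using z(4) by (auto simp: Omega_def)
        have "- deriv a (fst z) \<ge> 0"
        proof (rule mono_on_imp_deriv_nonneg[of "{0..}" "\<lambda>\<tau>. - a \<tau>"])
          show "mono_on {0..} (\<lambda>\<tau>. - a \<tau>)"
            by (rule mono_onI) (simp add: a_def bump_symmetric_decreasing)
          show "((\<lambda>\<tau>. - a \<tau>) has_real_derivative - deriv a (fst z)) (at (fst z))"
            by (intro DERIV_minus smooth_real_deriv(1)[OF sa])
          show "fst z \<in> interior {0..}" using z(1) by simp
        qed
        then have neg: "d_tau \<Psi> z \<le> 0" by (simp add: dt \<phi>_def bump_nonneg mult_nonpos_nonneg)
        have 1: "U z * d_tau \<Psi> z \<le> ?us * d_tau \<Psi> z"
        proof (cases "snd z < c / 2")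
          case True
          have "c \<le> \<Xi> (fst z)" unfolding c_def using mono_onD[OF Xi_mono, of 0 "fst z"] zT T by simp
          then have "?us \<le> U z" using z(2) True c by (simp add: phase_separated_def)
          then show ?thesis using neg by (rule mult_right_mono_neg)
        next
          case False
          then have "d_tau \<Psi> z = 0" by (simp add: dt \<phi>_def bump_eq_0)
          then show ?thesis by simp
        qed
        have 2: "P z * d_xi (d_xi \<Psi>) z \<le> (B * a0 * C) * indicator ({0..s} \<times> {c / 4..c / 2}) z"
        proof (cases "z \<in> {0..s} \<times> {c / 4..c / 2}")
          case True
          have "\<bar>P z\<bar> \<le> B" using z(3) by (simp add: B_def)
          moreover have "\<bar>a (fst z)\<bar> \<le> a0"
            using bump_symmetric_decreasing[of 0 "fst z" s] z(1) by (simp add: a_def a0_def bump_nonneg)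
          ultimately have "\<bar>P z\<bar> * (\<bar>a (fst z)\<bar> * \<bar>deriv (deriv \<phi>) (snd z)\<bar>) \<le> B * (a0 * C)"
            using C a0 by (intro mult_mono) (auto simp: B_def)
          then have "P z * d_xi (d_xi \<Psi>) z \<le> B * (a0 * C)"
            unfolding dx by (metis abs_ge_self abs_mult order_trans)
          then show ?thesis using True by (simp add: mult.assoc)
        next
          case False
          then have "s < fst z \<or> snd z \<notin> {c / 4..c / 2}" using z(1) by (cases z) auto
          then have "d_xi (d_xi \<Psi>) z = 0" using \<phi>0 bump_eq_0[of "fst z" "- s" s] by (auto simp: dx a_def)
          then show ?thesis using False by simp
        qed
        show "U z * d_tau \<Psi> z + P z * d_xi (d_xi \<Psi>) z \<le>
          ?us * d_tau \<Psi> z + (B * a0 * C) * indicator ({0..s} \<times> {c / 4..c / 2}) z"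
          using 1 2 by (rule add_mono)
      qed
    qed
    also have "\<dots> = ?us * - (a0 * I) + (B * a0 * C) * (s * (c / 4))"
    proof -
      let ?box = "{0..s} \<times> {c / 4..c / 2}"
      have bc: "?box = cbox (0, c / 4) (s, c / 2)" by (simp add: cbox_Pair_eq)
      have "compact ?box" by (intro compact_Times compact_Icc)
      then have ib: "integrable lborel (indicator ?box :: real \<times> real \<Rightarrow> real)"
        by (intro integrable_real_indicator emeasure_compact_finite) (auto dest: compact_imp_closed)
      have iW: "integrable ?W (indicator ?box :: real \<times> real \<Rightarrow> real)"
        by (intro Omega_integral_slices(2) indicator_fst_integrable[OF _ ib]) (use ib in \<open>auto dest: borel_measurable_integrable\<close>)
      have "(LINT z|?W. indicator ?box z :: real) = (LINT z|lebesgue. indicator (Omega T) z *\<^sub>R (indicator ?box z :: real))"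
        by (rule integral_restrict_space) (simp add: Omega_lebesgue)
      also have "\<dots> = (LINT z|lebesgue. indicator ?box z)"
        by (rule Bochner_Integration.integral_cong) (use s in \<open>auto simp: indicator_def Omega_def\<close>)
      also have "\<dots> = measure lborel (cbox (0, c / 4) (s, c / 2))"
        unfolding bc by simp
      also have "\<dots> = s * (c / 4)" using s c by (simp add: content_Pair field_simps)
      finally have "(LINT z|?W. indicator ?box z :: real) = s * (c / 4)" .
      moreover have "(LINT z|?W. ?us * d_tau \<Psi> z + (B * a0 * C) * indicator ?box z) =
          ?us * (LINT z|?W. d_tau \<Psi> z) + (B * a0 * C) * (LINT z|?W. indicator ?box z)"
        using Omega_integral_d_tau(2)[OF T \<Psi>] iW by simp
      ultimately show ?thesis by (simp only: Omega_integral_d_tau(1)[OF T \<Psi>] \<Psi>I)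
    qed
    finally have "?us * (a0 * I) \<le> ?us * - (a0 * I) + (B * a0 * C) * (s * (c / 4))" by (simp only: \<Psi>I)
    then have "a0 * (2 * ?us * I) \<le> a0 * ((B * C * (c / 4)) * s)" by (simp add: algebra_simps)
    then show ?thesis using a0 by simp
  qed
  define Q where "Q = B * C * (c / 4)"
  have Q: "0 \<le> Q" using C c by (simp add: Q_def B_def)
  define s where "s = min (T / 2) (?us * I / (Q + 1))"
  have s: "0 < s" "s < T" using T us I Q by (auto simp: s_def)
  have "Q * s \<le> Q * (?us * I / (Q + 1))" using Q by (intro mult_left_mono) (auto simp: s_def)
  also have "\<dots> \<le> ?us * I" using Q us I by (simp add: field_simps)
  finally have "Q * s \<le> ?us * I" .
  moreover have "2 * ?us * I \<le> Q * s" using main[OF s] unfolding Q_def .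
  moreover have "0 < ?us * I" using us I by simp
  ultimately show False by (simp add: mult.assoc)
qed

end

section \<open>Entropy pairs and the flow rule\<close>

lemma antiderivative_exists:
  fixes f :: "real \<Rightarrow> real"
  assumes "continuous_on UNIV f"
  obtains F where "\<And>x. (F has_real_derivative f x) (at x)"
proof -
  have "\<exists>F. \<forall>x::real. -\<infinity> < ereal x \<longrightarrow> ereal x < \<infinity> \<longrightarrow> (F has_vector_derivative f x) (at x)"
    by (rule einterval_antiderivative) (use assms in \<open>auto simp: continuous_on_eq_continuous_at\<close>)
  then show thesis using that by (auto simp: has_real_derivative_iff_has_vector_derivative)
qed

lemma bounded_derivative_Lipschitz:
  fixes f :: "real \<Rightarrow> real"
  assumes "\<And>x. (f has_real_derivative f' x) (at x)" "\<And>x. \<bar>f' x\<bar> \<le> B"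
  shows "B-lipschitz_on UNIV f"
proof (rule lipschitz_onI)
  show "0 \<le> B" using assms(2)[of 0] by linarith
  fix x y
  have "norm (f x - f y) \<le> B * norm (x - y)"
    by (rule field_differentiable_bound[OF convex_UNIV, of f f']) (use assms in auto)
  then show "dist (f x) (f y) \<le> B * dist x y" by (simp add: dist_real_def)
qed

text \<open>The graph of a function with monotone derivative lies above its tangents.\<close>
lemma mono_derivative_tangent:
  fixes N :: "real \<Rightarrow> real"
  assumes N: "\<And>x. (N has_real_derivative \<mu> x) (at x)" and \<mu>: "mono \<mu>"
  shows "0 \<le> N b - N a - \<mu> a * (b - a)"
proof -
  consider "a < b" | "a = b" | "b < a" by linarith
  then show ?thesis
  proof cases
    case 1
    obtain z where z: "a < z" "z < b" "N b - N a = (b - a) * \<mu> z" using MVT2[OF 1, of N \<mu>] N by blast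
    have "0 \<le> (\<mu> z - \<mu> a) * (b - a)" using monoD[OF \<mu>, of a z] z 1 by (intro mult_nonneg_nonneg) auto
    then show ?thesis using z(3) by (simp add: algebra_simps)
  next
    case 3
    obtain z where z: "b < z" "z < a" "N a - N b = (a - b) * \<mu> z" using MVT2[OF 3, of N \<mu>] N by blast
    have "0 \<le> (\<mu> a - \<mu> z) * (a - b)" using monoD[OF \<mu>, of z a] z 3 by (intro mult_nonneg_nonneg) auto
    then show ?thesis using z(3) by (simp add: algebra_simps)
  qed simp
qed

lemma smooth_deriv_nonneg_imp_mono:
  fixes \<mu> :: "real \<Rightarrow> real"
  assumes "smooth \<mu>" "\<And>x. 0 \<le> deriv \<mu> x"
  shows "mono \<mu>"
proof (rule monoI)
  fix x y :: real assume "x \<le> y"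
  then show "\<mu> x \<le> \<mu> y"
    by (rule DERIV_nonneg_imp_nondecreasing) (use assms smooth_real_deriv(1) in blast)
qed

lemma Phi'_abs_le:
  assumes "0 < \<kappa>" shows "\<bar>Phi' \<kappa> v\<bar> \<le> \<bar>v\<bar> + 1"
proof -
  let ?m = "max (- u_star \<kappa>) (min (u_star \<kappa>) v)"
  have "0 < u_star \<kappa>" using assms by (rule u_star_pos)
  then have "\<bar>?m\<bar> \<le> u_star \<kappa>" by auto
  then have "(1 + \<kappa>) * \<bar>?m\<bar> \<le> (1 + \<kappa>) * u_star \<kappa>" using assms by (intro mult_left_mono) auto
  also have "\<dots> = 1" using assms by (simp add: u_star_def)
  finally have "\<bar>(1 + \<kappa>) * ?m\<bar> \<le> 1" using assms by (simp add: abs_mult)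
  then show ?thesis unfolding Phi'_eq[OF assms] by linarith
qed

context single_interface_limit
begin

text \<open>Truncating \<open>\<mu>\<close> outside the essential ranges of \<open>P\<close> and \<open>\<Phi>'(U)\<close> leaves the limit inequality unchanged,
  but makes \<open>N\<close> and \<open>\<eta>\<close> Lipschitz continuous, as the passage to the limit requires.\<close>
lemma entropy_pair_inequality:
  assumes pair: "smooth_entropy_pair \<kappa> \<eta> \<mu>"
  shows "entropy_inequality T U P DP \<eta> \<mu>"
  unfolding entropy_inequality_def
proof (intro allI impI)
  fix \<Psi> :: "real \<times> real \<Rightarrow> real"
  assume "test_function ({0<..<T} \<times> UNIV) \<Psi> \<and> (\<forall>z. 0 \<le> \<Psi> z)"
  then have \<Psi>: "test_function ({0<..<T} \<times> UNIV) \<Psi>" and \<Psi>0: "\<And>z. 0 \<le> \<Psi> z" by auto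
  let ?W = "lebesgue_on (Omega T)"
  have s\<mu>: "smooth \<mu>" "\<And>x. 0 \<le> deriv \<mu> x" and d\<eta>: "\<And>v. (\<eta> has_real_derivative \<mu> (Phi' \<kappa> v)) (at v)"
    using pair by (auto simp: smooth_entropy_pair_def)
  have mono\<mu>: "mono \<mu>" by (rule smooth_deriv_nonneg_imp_mono[OF s\<mu>])
  have c\<mu>: "continuous_on UNIV \<mu>" by (rule smooth_continuous_on[OF s\<mu>(1)])
  obtain C1 where C1: "AE z in ?W. \<bar>U z\<bar> \<le> C1"
    using limit unfolding macroscopic_limit_def ess_bounded_on_def by blast
  obtain C2 where C2: "AE z in ?W. \<bar>P z\<bar> \<le> C2"
    using limit unfolding macroscopic_limit_def ess_bounded_on_def by blast
  \<comment> \<open>\<open>\<bar>\<Phi>'(v)\<bar> \<le> \<bar>v\<bar> + 1\<close>, so this bounds both \<open>P\<close> and \<open>\<Phi>'(U)\<close>\<close>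
  define R where "R = \<bar>C1\<bar> + \<bar>C2\<bar> + 1"
  have R: "0 < R" "C2 \<le> R" "\<bar>C1\<bar> + 1 \<le> R" by (auto simp: R_def)
  define m where "m x = \<mu> (max (- R) (min R x))" for x
  have m_eq: "m x = \<mu> x" if "\<bar>x\<bar> \<le> R" for x using that by (simp add: m_def)
  have m_mono: "mono m"
    unfolding m_def by (rule monoI, rule monoD[OF mono\<mu>]) (auto simp: min_def max_def)
  have cm: "continuous_on A m" for A
    unfolding m_def by (rule continuous_on_compose2[OF c\<mu>]) (auto intro!: continuous_intros)
  have m_bound: "\<bar>m x\<bar> \<le> \<bar>\<mu> (- R)\<bar> + \<bar>\<mu> R\<bar>" for x
  proof -
    have "\<mu> (- R) \<le> m x" "m x \<le> \<mu> R"
      unfolding m_def using R(1) by (auto intro!: monoD[OF mono\<mu>] simp: min_def max_def)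
    then show ?thesis by linarith
  qed
  obtain N where N: "\<And>x. (N has_real_derivative m x) (at x)" using antiderivative_exists[OF cm] by metis
  have cmP: "continuous_on UNIV (\<lambda>v. m (Phi' \<kappa> v))"
    by (rule continuous_on_compose2[OF cm continuous_on_Phi'[OF \<kappa>] subset_UNIV])
  obtain h0 where h0: "\<And>v. (h0 has_real_derivative m (Phi' \<kappa> v)) (at v)" using antiderivative_exists[OF cmP] by metis
  \<comment> \<open>normalised such that it coincides with \<open>\<eta>\<close> on the range of \<open>U\<close>\<close>
  define h where "h v = h0 v + (\<eta> 0 - h0 0)" for v
  have h: "(h has_real_derivative m (Phi' \<kappa> v)) (at v)" for v
    unfolding h_def using DERIV_add[OF h0 DERIV_const] by simp
  have h_eq: "h v = \<eta> v" if "\<bar>v\<bar> \<le> \<bar>C1\<bar>" for v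
  proof -
    have "\<exists>k. \<forall>v\<in>{- \<bar>C1\<bar>..\<bar>C1\<bar>}. h v - \<eta> v = k"
    proof (rule has_field_derivative_zero_constant)
      fix v assume v: "v \<in> {- \<bar>C1\<bar>..\<bar>C1\<bar>}"
      then have "\<bar>Phi' \<kappa> v\<bar> \<le> R" using Phi'_abs_le[OF \<kappa>, of v] R(3) by auto
      then have "((\<lambda>v. h v - \<eta> v) has_real_derivative 0) (at v)"
        using DERIV_diff[OF h d\<eta>, of v] by (simp add: m_eq)
      then show "((\<lambda>v. h v - \<eta> v) has_real_derivative 0) (at v within {- \<bar>C1\<bar>..\<bar>C1\<bar>})"
        by (rule has_field_derivative_at_within)
    qed simp
    then obtain k where k: "\<And>v. v \<in> {- \<bar>C1\<bar>..\<bar>C1\<bar>} \<Longrightarrow> h v - \<eta> v = k" by blast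
    have "h 0 - \<eta> 0 = 0" by (simp add: h_def)
    moreover have "h 0 - \<eta> 0 = k" by (rule k) simp
    moreover have "h v - \<eta> v = k" by (rule k) (use that in auto)
    ultimately show ?thesis by simp
  qed
  note lipN = bounded_derivative_Lipschitz[OF N m_bound]
  note liph = bounded_derivative_Lipschitz[OF h m_bound]
  have "0 \<le> (LINT z|?W. h (U z) * d_tau \<Psi> z - m (P z) * DP z * d_xi \<Psi> z)"
    by (rule entropy_balance[OF N lipN cm h liph \<Psi> mult_nonneg_nonneg[OF \<Psi>0 mono_derivative_tangent[OF N m_mono]]])
  also have "\<dots> = (LINT z|?W. \<eta> (U z) * d_tau \<Psi> z - \<mu> (P z) * DP z * d_xi \<Psi> z)"
  proof (rule integral_cong_AE)
    have [measurable]: "d_tau \<Psi> \<in> borel_measurable ?W" "d_xi \<Psi> \<in> borel_measurable ?W"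
      by (intro borel_imp_lebesgue_on_measurable test_function_borel[OF test_function_d_tau[OF \<Psi>]] test_function_borel[OF test_function_d_xi[OF \<Psi>]])+
    note [measurable] = limit_measurable
    have c: "continuous_on UNIV \<eta>" "continuous_on UNIV h"
      using d\<eta> h DERIV_isCont by (blast intro: continuous_at_imp_continuous_on)+
    have [measurable]: "\<eta> \<in> borel_measurable borel" "h \<in> borel_measurable borel" "\<mu> \<in> borel_measurable borel" "m \<in> borel_measurable borel"
      by (intro borel_measurable_continuous_onI c c\<mu> cm)+
    show "(\<lambda>z. h (U z) * d_tau \<Psi> z - m (P z) * DP z * d_xi \<Psi> z) \<in> borel_measurable ?W" by measurable
    show "(\<lambda>z. \<eta> (U z) * d_tau \<Psi> z - \<mu> (P z) * DP z * d_xi \<Psi> z) \<in> borel_measurable ?W" by measurable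
    show "AE z in ?W. h (U z) * d_tau \<Psi> z - m (P z) * DP z * d_xi \<Psi> z = \<eta> (U z) * d_tau \<Psi> z - \<mu> (P z) * DP z * d_xi \<Psi> z"
      using C1 C2
    proof eventually_elim
      fix z assume z: "\<bar>U z\<bar> \<le> C1" "\<bar>P z\<bar> \<le> C2"
      have "h (U z) = \<eta> (U z)" by (rule h_eq) (use z(1) in linarith)
      moreover have "m (P z) = \<mu> (P z)" by (rule m_eq) (use z(2) R(2) in linarith)
      ultimately show "h (U z) * d_tau \<Psi> z - m (P z) * DP z * d_xi \<Psi> z = \<eta> (U z) * d_tau \<Psi> z - \<mu> (P z) * DP z * d_xi \<Psi> z" by simp
    qed
  qed
  finally show "0 \<le> (LINT z|?W. \<eta> (U z) * d_tau \<Psi> z - \<mu> (P z) * DP z * d_xi \<Psi> z)" .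
qed

lemma AE_interior_time: "AE \<tau> in lebesgue_on {0..T}. \<tau> \<in> {0<..<T}"
proof -
  have "AE \<tau> in lebesgue. \<tau> \<noteq> (0::real)" "AE \<tau> in lebesgue. \<tau> \<noteq> T"
    by (rule AE_completion[OF AE_lborel_singleton])+
  then have "AE \<tau> in lebesgue. \<tau> \<in> {0..T} \<longrightarrow> \<tau> \<in> {0<..<T}" by eventually_elim auto
  then show ?thesis by (subst AE_lebesgue_on_iff) auto
qed

lemma Xi_differentiable_AE:
  "AE \<tau> in lebesgue_on {0..T}. \<Xi> field_differentiable at \<tau> \<and> 0 \<le> deriv \<Xi> \<tau>"
proof -
  obtain L where L: "L-lipschitz_on UNIV Xi_clamped" using Xi_clamped_Lipschitz by blast
  have "AE \<tau> in lebesgue. Xi_clamped differentiable at \<tau>" by (rule mono_lipschitz_differentiable_AE[OF Xi_clamped_mono L])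
  then have "AE \<tau> in lebesgue_on {0..T}. Xi_clamped differentiable at \<tau>"
    by (subst AE_lebesgue_on_iff) (auto elim: eventually_mono)
  then show ?thesis using AE_interior_time
  proof eventually_elim
    fix \<tau> assume d: "Xi_clamped differentiable at \<tau>" and \<tau>: "\<tau> \<in> {0<..<T}"
    obtain D where D: "(Xi_clamped has_real_derivative D) (at \<tau>)" using d real_differentiable_def by blast
    have "0 \<le> D"
      by (rule mono_on_imp_deriv_nonneg[OF _ D, of UNIV]) (use Xi_clamped_mono in \<open>auto simp: mono_def intro: mono_onI\<close>)
    moreover have "(\<Xi> has_real_derivative D) (at \<tau>)"
      by (rule has_field_derivative_transform_within_open[OF D, of "{0<..<T}"]) (use \<tau> Xi_clamped_eq in auto)
    ultimately show "\<Xi> field_differentiable at \<tau> \<and> 0 \<le> deriv \<Xi> \<tau>"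
      using DERIV_imp_deriv field_differentiable_def by metis
  qed
qed

text \<open>Take \<open>c\<close> between \<open>P(\<tau>\<^sub>0, \<Xi>(\<tau>\<^sub>0))\<close> and \<open>p\<^sub>*\<close>, and an entropy pair whose \<open>\<mu>\<close> vanishes up to \<open>c\<close> and is positive
  above. Near \<open>(\<tau>\<^sub>0, \<Xi>(\<tau>\<^sub>0))\<close> we have \<open>P < c\<close>, hence the flux vanishes and \<open>\<eta>(U)\<close> takes two constant
  values: \<open>A\<close> ahead of the interface and \<open>B\<close> behind it. Going from one well to the other, \<open>\<Phi>'\<close>
  passes through values in \<open>(c, p\<^sub>*)\<close>, so that \<open>A < B\<close>. The entropy inequality now says that the region
  behind the interface, weighted by \<open>B - A > 0\<close>, cannot grow; since \<open>\<Xi>\<close> is nondecreasing, it is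
  constant.\<close>
lemma interface_constant_below_threshold:
  assumes \<tau>0: "\<tau>0 \<in> {0<..<T}" and below: "P (\<tau>0, \<Xi> \<tau>0) < p_star \<kappa>"
  shows "\<exists>\<delta>>0. \<forall>\<tau>. \<bar>\<tau> - \<tau>0\<bar> < \<delta> \<longrightarrow> \<Xi> \<tau> = \<Xi> \<tau>0"
proof -
  let ?W = "lebesgue_on (Omega T)"
  obtain c where c: "P (\<tau>0, \<Xi> \<tau>0) < c" "c < p_star \<kappa>" using below dense by blast
  have cp: "- p_star \<kappa> < c" using P_bounds(1)[of \<tau>0 "\<Xi> \<tau>0"] \<tau>0 c(1) by auto
  have "(\<tau>0, \<Xi> \<tau>0) \<in> Omega T" using \<tau>0 by (auto simp: Omega_def)
  moreover have "0 < c - P (\<tau>0, \<Xi> \<tau>0)" using c(1) by simp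
  ultimately obtain d where d: "d > 0" "\<And>z. z \<in> Omega T \<Longrightarrow> dist z (\<tau>0, \<Xi> \<tau>0) < d \<Longrightarrow> dist (P z) (P (\<tau>0, \<Xi> \<tau>0)) < c - P (\<tau>0, \<Xi> \<tau>0)"
    using P_continuous[unfolded continuous_on_iff] by blast
  have Pc: "P (\<tau>, \<xi>) < c" if "\<tau> \<in> {0..T}" "\<bar>\<tau> - \<tau>0\<bar> < d / 2" "\<bar>\<xi> - \<Xi> \<tau>0\<bar> < d / 2" for \<tau> \<xi>
  proof -
    have "dist (\<tau>, \<xi>) (\<tau>0, \<Xi> \<tau>0) \<le> \<bar>\<tau> - \<tau>0\<bar> + \<bar>\<xi> - \<Xi> \<tau>0\<bar>"
      using norm_Pair_le[of "\<tau> - \<tau>0" "\<xi> - \<Xi> \<tau>0"] by (simp add: dist_norm)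
    also have "\<dots> < d" using that(2,3) by argo
    finally show ?thesis using d(2)[of "(\<tau>, \<xi>)"] that(1) by (auto simp: Omega_def dist_real_def)
  qed
  obtain d2 where d2: "d2 > 0" "\<And>\<tau>. \<tau> \<in> {0..T} \<Longrightarrow> \<bar>\<tau> - \<tau>0\<bar> < d2 \<Longrightarrow> \<bar>\<Xi> \<tau> - \<Xi> \<tau>0\<bar> < d / 2"
  proof -
    have "\<tau>0 \<in> {0..T}" "0 < d / 2" using \<tau>0 d(1) by auto
    then show ?thesis using that Xi_continuous[unfolded continuous_on_iff dist_real_def] by blast
  qed
  \<comment> \<open>the final factor keeps the closed interval \<open>{p..q}\<close> inside all the required neighbourhoods\<close>
  define \<delta> where "\<delta> = min (d / 2) (min d2 (min \<tau>0 (T - \<tau>0))) / 2"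
  have \<delta>: "0 < \<delta>" "\<delta> < d / 2" "\<delta> < d2" "\<delta> < \<tau>0" "\<delta> < T - \<tau>0"
    using d(1) d2(1) \<tau>0 by (auto simp: \<delta>_def min_def)
  define p where "p = \<tau>0 - \<delta>"
  define q where "q = \<tau>0 + \<delta>"
  have pq: "0 < p" "q < T" using \<delta> by (auto simp: p_def q_def)
  have near: "\<tau> \<in> {0..T}" "\<bar>\<tau> - \<tau>0\<bar> < d / 2" "\<bar>\<tau> - \<tau>0\<bar> < d2" if "\<tau> \<in> {p..q}" for \<tau>
    using that pq \<delta> by (auto simp: p_def q_def abs_if)
  have const: "\<Xi> t1 = \<Xi> t2" if t: "t1 \<in> {p<..<q}" "t2 \<in> {p<..<q}" "t1 \<le> t2" for t1 t2
  proof (rule ccontr)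
    have t12: "t1 \<in> {0..T}" "t2 \<in> {0..T}" using near(1) t by auto
    assume "\<Xi> t1 \<noteq> \<Xi> t2"
    then have lt: "\<Xi> t1 < \<Xi> t2" using mono_onD[OF Xi_mono t12 t(3)] by simp
    define a where "a = bump p q"
    define b where "b = bump (\<Xi> t1) (\<Xi> t2)"
    have s: "smooth a" "smooth b" unfolding a_def b_def by (rule smooth_bump)+
    define \<Psi> where "\<Psi> = (\<lambda>z. a (fst z) * b (snd z))"
    have \<Psi>: "test_function ({0<..<T} \<times> UNIV) \<Psi>"
      unfolding \<Psi>_def a_def b_def by (rule test_function_bump_tensor) (use pq in auto)
    have \<Psi>0: "0 \<le> \<Psi> z" for z by (simp add: \<Psi>_def a_def b_def bump_nonneg)
    have dt: "d_tau \<Psi> = (\<lambda>z. deriv a (fst z) * b (snd z))" unfolding \<Psi>_def by (rule d_tau_tensor[OF s])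
    have dx: "d_xi \<Psi> = (\<lambda>z. a (fst z) * deriv b (snd z))" unfolding \<Psi>_def by (rule d_xi_tensor[OF s])
    have a0: "deriv a x = 0" if "x \<notin> {p..q}" for x
      using test_function_deriv[OF test_function_bump[of p q]] that unfolding test_function_def a_def by blast
    have b0: "deriv b x = 0" if "x \<notin> {\<Xi> t1..\<Xi> t2}" for x
      using test_function_deriv[OF test_function_bump[of "\<Xi> t1" "\<Xi> t2"]] that unfolding test_function_def b_def by blast
    define \<mu> where "\<mu> x = flat 0 (x - c)" for x
    have s\<mu>: "smooth \<mu>"
      using smooth_compose_real_affine[OF smooth_flat, of 0 1 "- c"] by (simp add: \<mu>_def[abs_def])
    have \<mu>_nonneg: "0 \<le> \<mu> x" for x by (simp add: \<mu>_def flat_nonneg)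
    have \<mu>0: "\<mu> x = 0" if "x \<le> c" for x using that by (simp add: \<mu>_def flat_def)
    have \<mu>pos: "0 < \<mu> x" if "c < x" for x using that by (simp add: \<mu>_def flat_pos_iff)
    have mono\<mu>: "mono_on UNIV \<mu>" by (rule mono_onI) (simp add: \<mu>_def flat_mono)
    have d\<mu>: "0 \<le> deriv \<mu> x" for x
      by (rule mono_on_imp_deriv_nonneg[OF mono\<mu> smooth_real_deriv(1)[OF s\<mu>]]) simp
    have "continuous_on UNIV (\<lambda>v. \<mu> (Phi' \<kappa> v))"
      by (rule continuous_on_compose2[OF smooth_continuous_on[OF s\<mu>] continuous_on_Phi'[OF \<kappa>] subset_UNIV])
    then obtain \<eta> where \<eta>: "\<And>v. (\<eta> has_real_derivative \<mu> (Phi' \<kappa> v)) (at v)"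
      using antiderivative_exists by metis
    have "smooth_entropy_pair \<kappa> \<eta> \<mu>" using s\<mu> d\<mu> \<eta> by (simp add: smooth_entropy_pair_def)
    from entropy_pair_inequality[OF this] have ineq: "0 \<le> (LINT z|?W. \<eta> (U z) * d_tau \<Psi> z - \<mu> (P z) * DP z * d_xi \<Psi> z)"
      using \<Psi> \<Psi>0 unfolding entropy_inequality_def by blast
    have us: "u_star \<kappa> = 1 - p_star \<kappa>" "0 < u_star \<kappa>" using p_star_eq(1) u_star_pos[OF \<kappa>] by auto
    define A where "A = \<eta> (c - 1)"
    define B where "B = \<eta> (u_star \<kappa>)"
    have etaA: "\<eta> v = A" if v: "v \<le> c - 1" for v
    proof -
      have "\<exists>k. \<forall>v\<in>{..c - 1}. \<eta> v = k"
      proof (rule has_field_derivative_zero_constant)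
        fix v assume "v \<in> {..c - 1}"
        then have "Phi' \<kappa> v = v + 1" "v + 1 \<le> c" using us c(2) by (auto simp: Phi'_def)
        then show "(\<eta> has_real_derivative 0) (at v within {..c - 1})"
          using has_field_derivative_at_within[OF \<eta>[of v]] by (simp add: \<mu>0)
      qed simp
      then show ?thesis unfolding A_def using v by auto
    qed
    have etaB: "\<eta> v = B" if v: "u_star \<kappa> \<le> v" "v \<le> c + 1" for v
    proof -
      have "\<exists>k. \<forall>v\<in>{u_star \<kappa>..c + 1}. \<eta> v = k"
      proof (rule has_field_derivative_zero_constant)
        fix v assume "v \<in> {u_star \<kappa>..c + 1}"
        then have "Phi' \<kappa> v = v - 1" "v - 1 \<le> c" using us by (auto simp: Phi'_def)
        then show "(\<eta> has_real_derivative 0) (at v within {u_star \<kappa>..c + 1})"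
          using has_field_derivative_at_within[OF \<eta>[of v]] by (simp add: \<mu>0)
      qed simp
      then show ?thesis unfolding B_def using v by auto
    qed
    have AB: "A < B"
    proof -
      have l: "c - 1 < - u_star \<kappa>" using us c(2) by simp
      obtain z where z: "c - 1 < z" "z < - u_star \<kappa>" "\<eta> (- u_star \<kappa>) - \<eta> (c - 1) = (- u_star \<kappa> - (c - 1)) * \<mu> (Phi' \<kappa> z)"
        using MVT2[OF l, of \<eta> "\<lambda>v. \<mu> (Phi' \<kappa> v)"] \<eta> by blast
      have "Phi' \<kappa> z = z + 1" using z(2) by (simp add: Phi'_def)
      then have "0 < \<eta> (- u_star \<kappa>) - \<eta> (c - 1)" unfolding z(3) using l z(1) by (intro mult_pos_pos \<mu>pos) auto
      moreover have "\<eta> (- u_star \<kappa>) \<le> \<eta> (u_star \<kappa>)"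
        by (rule DERIV_nonneg_imp_nondecreasing) (use us(2) \<eta> \<mu>_nonneg in \<open>auto intro!: exI\<close>)
      ultimately show ?thesis by (simp add: A_def B_def)
    qed
    define g where "g z = (A + (B - A) * indicator {z. snd z \<le> Xi_clamped (fst z)} z) * d_tau \<Psi> z" for z
    have t\<Psi>: "test_function ({0<..<T} \<times> UNIV) (d_tau \<Psi>)" by (rule test_function_d_tau[OF \<Psi>])
    have g_borel: "g \<in> borel_measurable borel"
    proof -
      have "closed {z :: real \<times> real. snd z \<le> Xi_clamped (fst z)}"
        by (intro closed_Collect_le continuous_intros continuous_on_compose2[OF Xi_clamped_continuous[of UNIV]]) auto
      then have [measurable]: "{z :: real \<times> real. snd z \<le> Xi_clamped (fst z)} \<in> sets borel" by (rule borel_closed)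
      have [measurable]: "d_tau \<Psi> \<in> borel_measurable borel" by (rule test_function_borel[OF t\<Psi>])
      show ?thesis unfolding g_def[abs_def] by measurable
    qed
    have g_int: "integrable lborel (\<lambda>z. indicator {0..T} (fst z) * g z)"
    proof (rule indicator_fst_integrable[OF g_borel])
      show "integrable lborel (\<lambda>z. (\<bar>A\<bar> + \<bar>B - A\<bar>) * d_tau \<Psi> z)"
        using test_function_integrable[OF t\<Psi>] by simp
      fix z
      have "\<bar>A + (B - A) * indicator {z. snd z \<le> Xi_clamped (fst z)} z\<bar> \<le> \<bar>\<bar>A\<bar> + \<bar>B - A\<bar>\<bar>"
        by (auto simp: indicator_def)
      then show "\<bar>g z\<bar> \<le> \<bar>(\<bar>A\<bar> + \<bar>B - A\<bar>) * d_tau \<Psi> z\<bar>"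
        unfolding g_def abs_mult by (intro mult_right_mono) auto
    qed
    have "(LINT z|?W. \<eta> (U z) * d_tau \<Psi> z - \<mu> (P z) * DP z * d_xi \<Psi> z) = (LINT z|?W. g z)"
    proof (rule integral_cong_AE)
      have [measurable]: "d_tau \<Psi> \<in> borel_measurable ?W" "d_xi \<Psi> \<in> borel_measurable ?W"
        by (intro borel_imp_lebesgue_on_measurable test_function_borel[OF t\<Psi>] test_function_borel[OF test_function_d_xi[OF \<Psi>]])+
      note [measurable] = limit_measurable
      have "continuous_on UNIV \<eta>" using \<eta> DERIV_isCont by (blast intro: continuous_at_imp_continuous_on)
      then have [measurable]: "\<eta> \<in> borel_measurable borel" by (rule borel_measurable_continuous_onI)
      have [measurable]: "\<mu> \<in> borel_measurable borel" by (rule borel_measurable_continuous_onI[OF smooth_continuous_on[OF s\<mu>]])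
      show "(\<lambda>z. \<eta> (U z) * d_tau \<Psi> z - \<mu> (P z) * DP z * d_xi \<Psi> z) \<in> borel_measurable ?W" by measurable
      show "g \<in> borel_measurable ?W" by (rule borel_imp_lebesgue_on_measurable[OF g_borel])
      show "AE z in ?W. \<eta> (U z) * d_tau \<Psi> z - \<mu> (P z) * DP z * d_xi \<Psi> z = g z"
        using phase_separated_AE off_interface_AE AE_space[of ?W]
      proof eventually_elim
        fix z assume z: "phase_separated z" "snd z \<noteq> \<Xi> (fst z)" "z \<in> space ?W"
        have zT: "fst z \<in> {0..T}" using z(3) by (auto simp: Omega_def)
        show "\<eta> (U z) * d_tau \<Psi> z - \<mu> (P z) * DP z * d_xi \<Psi> z = g z"
        proof (cases "fst z \<in> {p..q} \<and> snd z \<in> {\<Xi> t1..\<Xi> t2}")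
          case False
          then have "d_tau \<Psi> z = 0" "d_xi \<Psi> z = 0"
            using a0[of "fst z"] b0[of "snd z"] bump_eq_0[of "fst z" p q] bump_eq_0[of "snd z" "\<Xi> t1" "\<Xi> t2"]
            by (auto simp: dt dx a_def b_def)
          then show ?thesis by (simp add: g_def)
        next
          case True
          have "\<bar>\<Xi> t1 - \<Xi> \<tau>0\<bar> < d / 2" "\<bar>\<Xi> t2 - \<Xi> \<tau>0\<bar> < d / 2" using d2(2) near t by auto
          moreover have "\<Xi> t1 \<le> snd z" "snd z \<le> \<Xi> t2" using True by auto
          ultimately have "\<bar>snd z - \<Xi> \<tau>0\<bar> < d / 2" by argo
          then have Pz: "P z < c" using Pc[of "fst z" "snd z"] near[of "fst z"] True by simp
          then have "\<mu> (P z) = 0" by (simp add: \<mu>0)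
          moreover have "\<eta> (U z) = A + (B - A) * indicator {z. snd z \<le> Xi_clamped (fst z)} z"
          proof (cases "snd z < \<Xi> (fst z)")
            case True
            then have "u_star \<kappa> \<le> U z" "U z \<le> c + 1" using z(1) Pz by (auto simp: phase_separated_def)
            then show ?thesis using etaB True by (simp add: Xi_clamped_eq[OF zT])
          next
            case False
            then have "\<Xi> (fst z) < snd z" using z(2) by simp
            then have "U z \<le> c - 1" "\<not> snd z \<le> Xi_clamped (fst z)" using z(1) Pz by (auto simp: phase_separated_def Xi_clamped_eq[OF zT])
            then show ?thesis using etaA by simp
          qed
          ultimately show ?thesis by (simp add: g_def)
        qed
      qed
    qed
    also have "\<dots> = (LINT \<xi>|lborel. LINT \<tau>|lborel. indicator {0..T} \<tau> * g (\<tau>, \<xi>))"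
      by (rule Omega_integral_slices(1)[OF g_borel g_int])
    finally have ge: "0 \<le> (LINT \<xi>|lborel. LINT \<tau>|lborel. indicator {0..T} \<tau> * g (\<tau>, \<xi>))" using ineq by simp
    have ca: "continuous_on A a" for A by (rule smooth_continuous_on[OF s(1)])
    obtain m where m: "0 < m" "\<And>\<tau>. \<tau> \<in> {t1..t2} \<Longrightarrow> m \<le> a \<tau>"
    proof -
      obtain x where x: "x \<in> {t1..t2}" "\<And>y. y \<in> {t1..t2} \<Longrightarrow> a x \<le> a y"
        using continuous_attains_inf[OF compact_Icc _ ca, of t1 t2] t(3) by auto
      have "0 < a x" unfolding a_def by (rule bump_pos) (use x(1) t in auto)
      then show ?thesis using that x(2) by blast
    qed
    have FTC: "(LINT \<tau>|lborel. deriv a \<tau> * indicator {x..T} \<tau>) = - a x" if "x \<in> {0..T}" for x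
    proof -
      have "(LINT \<tau>|lborel. deriv a \<tau> * indicator {x..T} \<tau>) = a T - a x"
      proof (rule integral_FTC_Icc_real)
        show "x \<le> T" using that by simp
        show "(a has_real_derivative deriv a \<tau>) (at \<tau>)" for \<tau> by (rule smooth_real_deriv(1)[OF s(1)])
        show "isCont (deriv a) \<tau>" for \<tau>
          using smooth_continuous_on[OF smooth_real_deriv(2)[OF s(1)], of UNIV] by (simp add: continuous_on_eq_continuous_at)
      qed
      then show ?thesis using pq by (simp add: a_def bump_eq_0)
    qed
    have "(LINT \<xi>|lborel. LINT \<tau>|lborel. indicator {0..T} \<tau> * g (\<tau>, \<xi>)) \<le> (LINT \<xi>|lborel. - ((B - A) * m) * b \<xi>)"
    proof (rule integral_mono)
      show "integrable lborel (\<lambda>\<xi>. LINT \<tau>|lborel. indicator {0..T} \<tau> * g (\<tau>, \<xi>))"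
        by (rule Omega_integral_slices(3)[OF g_borel g_int])
      show "integrable lborel (\<lambda>\<xi>. - ((B - A) * m) * b \<xi>)"
        unfolding b_def using test_function_integrable[OF test_function_bump] by simp
      fix \<xi>
      show "(LINT \<tau>|lborel. indicator {0..T} \<tau> * g (\<tau>, \<xi>)) \<le> - ((B - A) * m) * b \<xi>"
      proof (cases "\<Xi> t1 < \<xi> \<and> \<xi> < \<Xi> t2")
        case False
        then have "b \<xi> = 0" unfolding b_def by (intro bump_eq_0) auto
        then show ?thesis by (simp add: g_def dt)
      next
        case True
        \<comment> \<open>\<open>\<sigma>\<close> is the first time at which the interface reaches \<open>\<xi>\<close>\<close>
        have "closed ({t1..t2} \<inter> Xi_clamped -` {\<xi>..})"
          by (rule continuous_closed_preimage[OF Xi_clamped_continuous closed_atLeastAtMost closed_atLeast])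
        then have "compact ({t1..t2} \<inter> ({t1..t2} \<inter> Xi_clamped -` {\<xi>..}))"
          by (rule compact_Int_closed[OF compact_Icc])
        moreover have "{t1..t2} \<inter> ({t1..t2} \<inter> Xi_clamped -` {\<xi>..}) = {\<tau> \<in> {t1..t2}. \<xi> \<le> Xi_clamped \<tau>}" by auto
        ultimately have "compact {\<tau> \<in> {t1..t2}. \<xi> \<le> Xi_clamped \<tau>}" by simp
        moreover have "t2 \<in> {\<tau> \<in> {t1..t2}. \<xi> \<le> Xi_clamped \<tau>}" using True t(3) t12 Xi_clamped_eq by auto
        ultimately obtain \<sigma> where \<sigma>: "\<sigma> \<in> {\<tau> \<in> {t1..t2}. \<xi> \<le> Xi_clamped \<tau>}" "\<And>\<tau>. \<tau> \<in> {\<tau> \<in> {t1..t2}. \<xi> \<le> Xi_clamped \<tau>} \<Longrightarrow> \<sigma> \<le> \<tau>"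
          using compact_attains_inf[of "{\<tau> \<in> {t1..t2}. \<xi> \<le> Xi_clamped \<tau>}"] by blast
        have \<sigma>T: "\<sigma> \<in> {0..T}" using \<sigma>(1) t12 by auto
        have reach: "\<xi> \<le> Xi_clamped \<tau> \<longleftrightarrow> \<sigma> \<le> \<tau>" for \<tau>
        proof
          assume \<tau>: "\<xi> \<le> Xi_clamped \<tau>"
          show "\<sigma> \<le> \<tau>"
          proof (cases "\<tau> < t1")
            case 1: True
            then have "Xi_clamped \<tau> \<le> \<Xi> t1" using monoD[OF Xi_clamped_mono, of \<tau> t1] Xi_clamped_eq[OF t12(1)] by simp
            then show ?thesis using \<tau> True by simp
          next
            case 2: False
            show ?thesis
            proof (cases "\<tau> \<le> t2")
              case 3: True
              then show ?thesis using 2 \<tau> by (intro \<sigma>(2)) auto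
            qed (use \<sigma>(1) in auto)
          qed
        next
          assume "\<sigma> \<le> \<tau>"
          then show "\<xi> \<le> Xi_clamped \<tau>" using monoD[OF Xi_clamped_mono, of \<sigma> \<tau>] \<sigma>(1) by simp
        qed
        have ia: "integrable lborel (\<lambda>\<tau>. deriv a \<tau> * indicator {x..T} \<tau>)" for x
        proof -
          have "integrable lborel (\<lambda>\<tau>. indicator {x..T} \<tau> *\<^sub>R deriv a \<tau>)"
            by (rule borel_integrable_compact[OF compact_Icc smooth_continuous_on[OF smooth_real_deriv(2)[OF s(1)]]])
          then show ?thesis by (simp add: mult.commute)
        qed
        have "(LINT \<tau>|lborel. indicator {0..T} \<tau> * g (\<tau>, \<xi>)) =
            (LINT \<tau>|lborel. b \<xi> * (A * (deriv a \<tau> * indicator {0..T} \<tau>) + (B - A) * (deriv a \<tau> * indicator {\<sigma>..T} \<tau>)))"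
          by (rule Bochner_Integration.integral_cong[OF refl])
             (use \<sigma>T in \<open>auto simp: g_def dt reach indicator_def algebra_simps\<close>)
        also have "\<dots> = b \<xi> * (A * - a 0 + (B - A) * - a \<sigma>)"
          using ia FTC[OF \<sigma>T] FTC[of 0] T by simp
        also have "a 0 = 0" using pq by (simp add: a_def bump_eq_0)
        finally have "(LINT \<tau>|lborel. indicator {0..T} \<tau> * g (\<tau>, \<xi>)) = - ((B - A) * b \<xi> * a \<sigma>)" by (simp add: algebra_simps)
        moreover have "(B - A) * b \<xi> * m \<le> (B - A) * b \<xi> * a \<sigma>"
          using AB m(2)[of \<sigma>] \<sigma>(1) by (intro mult_left_mono) (auto simp: b_def bump_nonneg)
        ultimately show ?thesis by (simp add: algebra_simps)
      qed
    qed
    also have "\<dots> = - ((B - A) * m) * (LINT \<xi>|lborel. b \<xi>)" by simp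
    also have "\<dots> < 0"
      using AB m(1) bump_integral_pos[OF lt] by (simp add: b_def mult_pos_pos)
    finally show False using ge by simp
  qed
  show ?thesis
  proof (intro exI[of _ \<delta>] conjI allI impI \<delta>(1))
    fix \<tau> assume "\<bar>\<tau> - \<tau>0\<bar> < \<delta>"
    then have mem: "\<tau> \<in> {p<..<q}" "\<tau>0 \<in> {p<..<q}" using \<delta>(1) by (auto simp: p_def q_def abs_less_iff)
    show "\<Xi> \<tau> = \<Xi> \<tau>0"
    proof (cases "\<tau> \<le> \<tau>0")
      case True
      then show ?thesis by (rule const[OF mem])
    next
      case False
      then have "\<tau>0 \<le> \<tau>" by simp
      then show ?thesis by (rule const[OF mem(2,1), symmetric])
    qed
  qed
qed

lemma flow_rule_AE: "AE \<tau> in lebesgue_on {0..T}. P (\<tau>, \<Xi> \<tau>) < p_star \<kappa> \<longrightarrow> deriv \<Xi> \<tau> = 0"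
  using AE_interior_time
proof eventually_elim
  fix \<tau>0 assume \<tau>0: "\<tau>0 \<in> {0<..<T}"
  show "P (\<tau>0, \<Xi> \<tau>0) < p_star \<kappa> \<longrightarrow> deriv \<Xi> \<tau>0 = 0"
  proof
    assume "P (\<tau>0, \<Xi> \<tau>0) < p_star \<kappa>"
    from interface_constant_below_threshold[OF \<tau>0 this]
    obtain \<delta> where \<delta>: "\<delta> > 0" "\<And>\<tau>. \<bar>\<tau> - \<tau>0\<bar> < \<delta> \<Longrightarrow> \<Xi> \<tau> = \<Xi> \<tau>0" by blast
    have "((\<lambda>_. \<Xi> \<tau>0) has_real_derivative 0) (at \<tau>0)" by simp
    then have "(\<Xi> has_real_derivative 0) (at \<tau>0)"
    proof (rule has_field_derivative_transform_within_open)
      show "open (ball \<tau>0 \<delta>)" "\<tau>0 \<in> ball \<tau>0 \<delta>" using \<delta>(1) by simp_all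
      fix x assume "x \<in> ball \<tau>0 \<delta>"
      then have "\<bar>x - \<tau>0\<bar> < \<delta>" by (simp add: dist_real_def abs_minus_commute)
      then show "\<Xi> \<tau>0 = \<Xi> x" by (rule \<delta>(2)[symmetric])
    qed
    then show "deriv \<Xi> \<tau>0 = 0" by (rule DERIV_imp_deriv)
  qed
qed

lemma P_no_jump:
  assumes "\<tau> \<in> {0..T}" shows "has_jump (\<lambda>\<xi>. P (\<tau>, \<xi>)) 0 (\<Xi> \<tau>)"
  unfolding has_jump_def using P_slice_tendsto[OF assms]
  by (intro exI[of _ "P (\<tau>, \<Xi> \<tau>)"]) simp

lemma initial_data_attained: "attains_initial_data P \<Xi> (\<lambda>\<xi>. P (0, \<xi>)) 0"
  unfolding attains_initial_data_def
proof (intro conjI allI impI refl Xi_initial)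
  fix K :: "real set" assume K: "compact K"
  have "compact ({0..T} \<times> K)" by (intro compact_Times compact_Icc K)
  moreover have "continuous_on ({0..T} \<times> K) P"
    by (rule continuous_on_subset[OF P_continuous]) (auto simp: Omega_def)
  ultimately have uc: "uniformly_continuous_on ({0..T} \<times> K) P" by (intro compact_uniformly_continuous)
  show "uniform_limit K (\<lambda>\<tau> \<xi>. P (\<tau>, \<xi>)) (\<lambda>\<xi>. P (0, \<xi>)) (at_right 0)"
    unfolding uniform_limit_iff
  proof (intro allI impI)
    fix r :: real assume "0 < r"
    then obtain d where d: "d > 0" "\<And>z z'. z \<in> {0..T} \<times> K \<Longrightarrow> z' \<in> {0..T} \<times> K \<Longrightarrow> dist z' z < d \<Longrightarrow> dist (P z') (P z) < r"
      using uc[unfolded uniformly_continuous_on_def] by blast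
    show "\<forall>\<^sub>F \<tau> in at_right 0. \<forall>\<xi>\<in>K. dist (P (\<tau>, \<xi>)) (P (0, \<xi>)) < r"
      unfolding eventually_at_right_field
    proof (intro exI[of _ "min d T"] conjI allI impI ballI)
      show "0 < min d T" using d(1) T by simp
      fix \<tau> \<xi> assume "0 < \<tau>" "\<tau> < min d T" "\<xi> \<in> K"
      then show "dist (P (\<tau>, \<xi>)) (P (0, \<xi>)) < r"
        using T by (intro d(2)) (auto simp: dist_Pair_Pair)
    qed
  qed
qed

lemma phases_AE:
  "AE z in lebesgue_on (Omega T). snd z \<noteq> \<Xi> (fst z) \<longrightarrow>
     M z = sgn (U z) \<and> sgn (U z) = sgn (\<Xi> (fst z) - snd z)"
  using phase_separated_AE
proof eventually_elim
  fix z assume z: "phase_separated z"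
  have us: "0 < u_star \<kappa>" using \<kappa> by (rule u_star_pos)
  show "snd z \<noteq> \<Xi> (fst z) \<longrightarrow> M z = sgn (U z) \<and> sgn (U z) = sgn (\<Xi> (fst z) - snd z)"
  proof
    assume "snd z \<noteq> \<Xi> (fst z)"
    then consider "snd z < \<Xi> (fst z)" | "\<Xi> (fst z) < snd z" by linarith
    then show "M z = sgn (U z) \<and> sgn (U z) = sgn (\<Xi> (fst z) - snd z)"
    proof cases
      case 1
      then have "0 < U z" "M z = 1" using z us by (auto simp: phase_separated_def)
      then show ?thesis using 1 by simp
    next
      case 2
      then have "U z < 0" "M z = - 1" using z us by (auto simp: phase_separated_def)
      then show ?thesis using 2 by simp
    qed
  qed
qed

end

theorem theorem4p2:
  fixes \<kappa> \<tau>fin \<alpha> \<beta> :: real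
    and e :: "nat \<Rightarrow> real"
    and u :: "real \<Rightarrow> real \<Rightarrow> linf"
    and ts :: "real \<Rightarrow> nat \<Rightarrow> ereal"
    and U P DP M :: "real \<times> real \<Rightarrow> real"
    and \<Xi> :: "real \<Rightarrow> real"
  assumes "0 < \<kappa>" and "0 < \<tau>fin" and "0 < \<alpha>" and "0 < \<beta>"
    and "\<And>\<epsilon>. 0 < \<epsilon> \<Longrightarrow> single_interface_solution \<kappa> (u \<epsilon>) (ts \<epsilon>)"
    and "\<And>\<epsilon>. 0 < \<epsilon> \<Longrightarrow> well_prepared \<kappa> \<alpha> \<beta> \<epsilon> (u \<epsilon> 0)"
    and "\<And>n. 0 < e n" and "e \<longlonglongrightarrow> 0"
    and "macroscopic_limit \<kappa> \<tau>fin e u ts U P DP M \<Xi>"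
  shows
    "(Stefan_distributional_solution \<tau>fin P DP M \<and>
      (\<forall>\<tau>\<in>{0..\<tau>fin}. has_jump (\<lambda>\<xi>. P (\<tau>, \<xi>)) 0 (\<Xi> \<tau>)) \<and>
      attains_initial_data P \<Xi> (\<lambda>\<xi>. P (0, \<xi>)) 0 \<and>
      (AE z in lebesgue_on (Omega \<tau>fin). snd z \<noteq> \<Xi> (fst z) \<longrightarrow>
         M z = sgn (U z) \<and> sgn (U z) = sgn (\<Xi> (fst z) - snd z)) \<and>
      (\<forall>\<tau>\<in>{0..\<tau>fin}. \<forall>\<xi>\<le>\<Xi> \<tau>. P (\<tau>, \<xi>) \<ge> - p_star \<kappa>) \<and>
      (\<forall>\<tau>\<in>{0..\<tau>fin}. \<forall>\<xi>\<ge>\<Xi> \<tau>. P (\<tau>, \<xi>) \<in> {- p_star \<kappa>..p_star \<kappa>}) \<and>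
      (AE \<tau> in lebesgue_on {0..\<tau>fin}. \<Xi> field_differentiable at \<tau> \<and> deriv \<Xi> \<tau> \<ge> 0)) \<and>
     ((AE \<tau> in lebesgue_on {0..\<tau>fin}. P (\<tau>, \<Xi> \<tau>) < p_star \<kappa> \<longrightarrow> deriv \<Xi> \<tau> = 0) \<and>
      (\<forall>\<eta> \<mu>. smooth_entropy_pair \<kappa> \<eta> \<mu> \<longrightarrow> entropy_inequality \<tau>fin U P DP \<eta> \<mu>))"
proof -
  interpret single_interface_limit \<kappa> \<tau>fin \<alpha> \<beta> e u ts U P DP M \<Xi>
    by (rule single_interface_limit.intro) (fact assms)+
  show ?thesis
  proof (intro conjI allI ballI impI)
    show "Stefan_distributional_solution \<tau>fin P DP M" by (rule Stefan_solution)
    show "has_jump (\<lambda>\<xi>. P (\<tau>, \<xi>)) 0 (\<Xi> \<tau>)" if "\<tau> \<in> {0..\<tau>fin}" for \<tau>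
      using that by (rule P_no_jump)
    show "attains_initial_data P \<Xi> (\<lambda>\<xi>. P (0, \<xi>)) 0" by (rule initial_data_attained)
    show "AE z in lebesgue_on (Omega \<tau>fin). snd z \<noteq> \<Xi> (fst z) \<longrightarrow>
         M z = sgn (U z) \<and> sgn (U z) = sgn (\<Xi> (fst z) - snd z)" by (rule phases_AE)
    show "- p_star \<kappa> \<le> P (\<tau>, \<xi>)" if "\<tau> \<in> {0..\<tau>fin}" "\<xi> \<le> \<Xi> \<tau>" for \<tau> \<xi>
      using that by (rule P_bounds(1))
    show "P (\<tau>, \<xi>) \<in> {- p_star \<kappa>..p_star \<kappa>}" if "\<tau> \<in> {0..\<tau>fin}" "\<Xi> \<tau> \<le> \<xi>" for \<tau> \<xi>
      using that by (rule P_bounds(2))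
    show "AE \<tau> in lebesgue_on {0..\<tau>fin}. \<Xi> field_differentiable at \<tau> \<and> deriv \<Xi> \<tau> \<ge> 0"
      by (rule Xi_differentiable_AE)
    show "AE \<tau> in lebesgue_on {0..\<tau>fin}. P (\<tau>, \<Xi> \<tau>) < p_star \<kappa> \<longrightarrow> deriv \<Xi> \<tau> = 0"
      by (rule flow_rule_AE)
    show "entropy_inequality \<tau>fin U P DP \<eta> \<mu>" if "smooth_entropy_pair \<kappa> \<eta> \<mu>" for \<eta> \<mu>
      using that by (rule entropy_pair_inequality)
  qed
qed

end
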